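(* Let $G$ be a locally compact Hausdorff group, let $H$ be a closed subgroup of $G$, and let $N$ be a closed subgroup of $G$ with $N \subset H \subset G$. Put $\overline{G} := G/N$ and $\overline{H} := H/N$ (coset spaces), and let $p^{G \to \overline{G}} \colon G \to \overline{G}$, $p^{\overline{G} \to G/H} \colon \overline{G} \to G/H$ and $p^{G \to G/H} \colon G \to G/H$ be the canonical maps. Then the following hold. (1) $M_H(G) \subset M_N(G)$. (2) For every $\mu \in M_H(G)$, the pushforwards $(p^{\overline{G} \to G/H} \circ p^{G \to \overline{G}})_*(\mu)$ and $p^{\overline{G} \to G/H}_* \circ p^{G \to \overline{G}}_*(\mu)$ can be defined, and $$(p^{\overline{G} \to G/H} \circ p^{G \to \overline{G}})_*(\mu) = p^{\overline{G} \to G/H}_* \circ p^{G \to \overline{G}}_*(\mu).$$ (3) Assume that $N$ is normal in $G$ (so that $\overline{G}$ is a locally compact group and $\overline{H}$ a closed subgroup of it), and let $p^{G/H \to \overline{G}/\overline{H}} \colon G/H \to \overline{G}/\overline{H}$ and $p^{\overline{G} \to \overline{G}/\overline{H}} \colon \overline{G} \to \overline{G}/\overline{H}$ be the canonical maps. Then, for every $\mu \in M_H(G)$, the pushforwards $p^{G/H \to \overline{G}/\overline{H}}_* \circ p^{G \to G/H}_*(\mu)$ and $p^{\overline{G} \to \overline{G}/\overline{H}}_* \circ p^{G \to \overline{G}}_*(\mu)$ can be defined, and $$p^{G/H \to \overline{G}/\overline{H}}_* \circ p^{G \to G/H}_*(\mu) = p^{\overline{G} \to \overline{G}/\overline{H}}_*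 \circ p^{G \to \overline{G}}_*(\mu).$$ (4) If $N$ is normal in $G$, then $p^{G \to \overline{G}}_*(\mu) \in M_{\overline{H}}(\overline{G})$ for every $\mu \in M_H(G)$.
   Context: For a locally compact Hausdorff space $X$, $C(X)$ is the space of continuous functions $X \to \mathbb{C}$ and $C_c(X)$ the subspace of those with compact support. $C_c(X)^*$ denotes the space of complex Radon measures on $X$, i.e. linear forms on $C_c(X)$ that are continuous for the inductive limit topology (for each compact $K \subset X$ there is $C_K$ with $|\mu(f)| \le C_K \|f\|_\infty$ for all $f \in C_c(X)$ supported in $K$); write $\int_X f \, d\mu := \mu(f)$. The support $\mathrm{supp}(\mu)$ is the complement of the largest open set $U$ such that $\mu(f) = 0$ for all $f \in C_c(X)$ with $\mathrm{supp}(f) \subset U$. A continuous map is proper if the inverse image of every compact set is compact. Pushforward: for a continuous map $p \colon X_1 \to X_2$ of locally compact Hausdorff spaces, let $$\mathcal{M}(p, X_1) := \{ \mu \in C_c(X_1)^* \mid p|_{\mathrm{supp}(\mu)} \text{ is proper} \}.$$ For $\mu \in \mathcal{M}(p, X_1)$ the pushforward $p_*(\mu) \in C_c(X_2)^*$ is defined by $\int_{X_2} \alpha_2 \, dp_*(\mu) := \int_{X_1} \alpha_1 \, d\mu$ for $\alpha_2 \in C_c(X_2)$, where $\alpha_1 \in C_c(X_1)$ is any function with $\alpha_1(x) = \alpha_2(p(x))$ for all $x \in \mathrm{supp}(\mu)$ (such $\alpha_1$ exists and the value does not depend on its choice). "The pushforward $p_*(\mu)$ can be defined" means $\mu \in \mathcal{M}(p,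 X_1)$; a composite $q_* \circ p_*(\mu)$ can be defined if $\mu \in \mathcal{M}(p, X_1)$ and $p_*(\mu) \in \mathcal{M}(q, X_2)$. For a locally compact group $G$ with left Haar measure $dg$ and a closed subgroup $H$, $$M_H(G) := \{ \phi(g)\, dg \mid \phi \in C(G),\ p^{G \to G/H}|_{\mathrm{supp}(\phi)} \text{ is proper} \} \subset C_c(G)^*,$$ where $p^{G \to G/H} \colon G \to G/H$ is the quotient map; this set does not depend on the choice of $dg$. *)

theory Defs
  imports "HOL-Analysis.Analysis" "HOL-Algebra.Coset"
begin

section \<open>Complex Radon measures as linear forms\<close>

definition fun_support :: "'a topology \<Rightarrow> ('a \<Rightarrow> complex) \<Rightarrow> 'a set" where
  "fun_support X f = X closure_of {x \<in> topspace X. f x \<noteq> 0}"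

(* Functions on the carrier of X are represented by their extension by 0 outside the carrier, so
   that equality and the pointwise operations on C_c(X) are those of the function type. *)
definition Cc :: "'a topology \<Rightarrow> ('a \<Rightarrow> complex) set" where
  "Cc X = {f. continuous_map X euclidean f \<and> compactin X (fun_support X f) \<and>
              (\<forall>x. x \<notin> topspace X \<longrightarrow> f x = 0)}"

(* The supremum runs over the whole type; elements of C_c(X) vanish outside the carrier. *)
definition sup_norm :: "('a \<Rightarrow> complex) \<Rightarrow> real" where
  "sup_norm f = (SUP x. norm (f x))"

(* Linear forms on C_c(X) are represented by functions that are undefined outside C_c(X), so that
   equality of forms is HOL equality. *)
definition radon_measures :: "'a topology \<Rightarrow> (('a \<Rightarrow> complex) \<Rightarrow> complex) set" where
  "radon_measures X = {\<mu> \<in> extensional (Cc X).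
     (\<forall>f\<in>Cc X. \<forall>g\<in>Cc X. \<mu> (\<lambda>x. f x + g x) = \<mu> f + \<mu> g) \<and>
     (\<forall>c. \<forall>f\<in>Cc X. \<mu> (\<lambda>x. c * f x) = c * \<mu> f) \<and>
     (\<forall>K. compactin X K \<longrightarrow>
        (\<exists>C. \<forall>f\<in>Cc X. fun_support X f \<subseteq> K \<longrightarrow> norm (\<mu> f) \<le> C * sup_norm f))}"

(* By a partition of unity, the union below is itself one of the open sets it is taken over, so it
   is the largest open set on which the measure vanishes. *)
definition measure_support :: "'a topology \<Rightarrow> (('a \<Rightarrow> complex) \<Rightarrow> complex) \<Rightarrow> 'a set" where
  "measure_support X \<mu> =
     topspace X - \<Union>{U. openin X U \<and> (\<forall>f\<in>Cc X. fun_support X f \<subseteq> U \<longrightarrow> \<mu> f = 0)}"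


section \<open>Proper maps and pushforward\<close>

(* The library's proper_map asks for a closed map with compact fibres; this is the condition on
   inverse images of compact sets. The two agree for locally compact Hausdorff spaces. *)
definition proper_continuous_map :: "'a topology \<Rightarrow> 'b topology \<Rightarrow> ('a \<Rightarrow> 'b) \<Rightarrow> bool" where
  "proper_continuous_map X Y p \<longleftrightarrow>
     continuous_map X Y p \<and> (\<forall>K. compactin Y K \<longrightarrow> compactin X {x \<in> topspace X. p x \<in> K})"

definition pushable_measures ::
    "'a topology \<Rightarrow> 'b topology \<Rightarrow> ('a \<Rightarrow> 'b) \<Rightarrow> (('a \<Rightarrow> complex) \<Rightarrow> complex) set" where
  "pushable_measures X Y p = {\<mu> \<in> radon_measures X. continuous_map X Y p \<and>
     proper_continuous_map (subtopology X (measure_support X \<mu>)) Y p}"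

definition pushforward ::
    "'a topology \<Rightarrow> 'b topology \<Rightarrow> ('a \<Rightarrow> 'b) \<Rightarrow> (('a \<Rightarrow> complex) \<Rightarrow> complex) \<Rightarrow>
     (('b \<Rightarrow> complex) \<Rightarrow> complex)" where
  "pushforward X Y p \<mu> = (\<lambda>\<alpha>\<^sub>2\<in>Cc Y.
     \<mu> (SOME \<alpha>\<^sub>1. \<alpha>\<^sub>1 \<in> Cc X \<and> (\<forall>x\<in>measure_support X \<mu>. \<alpha>\<^sub>1 x = \<alpha>\<^sub>2 (p x))))"


section \<open>Locally compact groups and coset spaces\<close>

locale locally_compact_group = group G for G (structure) +
  fixes T :: "'a topology"
  assumes topspace_eq: "topspace T = carrier G"
    and continuous_mult: "continuous_map (prod_topology T T) T (\<lambda>(x, y). x \<otimes> y)"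
    and continuous_inv: "continuous_map T T (\<lambda>x. inv x)"
    and locally_compact: "locally_compact_space T"
    and Hausdorff: "Hausdorff_space T"

definition closed_subgroup :: "'a set \<Rightarrow> ('a, 'b) monoid_scheme \<Rightarrow> 'a topology \<Rightarrow> bool" where
  "closed_subgroup H G T \<longleftrightarrow> subgroup H G \<and> closedin T H"

definition quotient_topology :: "'a topology \<Rightarrow> ('a \<Rightarrow> 'b) \<Rightarrow> 'b topology" where
  "quotient_topology X q =
     topology (\<lambda>U. U \<subseteq> q ` topspace X \<and> openin X {x \<in> topspace X. q x \<in> U})"

lemma openin_quotient_topology:
  "openin (quotient_topology X q) U \<longleftrightarrow>
     U \<subseteq> q ` topspace X \<and> openin X {x \<in> topspace X. q x \<in> U}"
proof -
  have "istopology (\<lambda>U. U \<subseteq> q ` topspace X \<and> openin X {x \<in> topspace X. q x \<in> U})"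
    unfolding istopology_def
  proof (intro conjI allI impI)
    fix S U
    assume S: "S \<subseteq> q ` topspace X \<and> openin X {x \<in> topspace X. q x \<in> S}"
      and U: "U \<subseteq> q ` topspace X \<and> openin X {x \<in> topspace X. q x \<in> U}"
    show "S \<inter> U \<subseteq> q ` topspace X"
      using S by blast
    have "{x \<in> topspace X. q x \<in> S \<inter> U} =
        {x \<in> topspace X. q x \<in> S} \<inter> {x \<in> topspace X. q x \<in> U}"
      by blast
    then show "openin X {x \<in> topspace X. q x \<in> S \<inter> U}"
      using S U by auto
  next
    fix \<K>
    assume K: "\<forall>U\<in>\<K>. U \<subseteq> q ` topspace X \<and> openin X {x \<in> topspace X. q x \<in> U}"
    show "\<Union>\<K> \<subseteq> q ` topspace X"
      using K by blast
    have "{x \<in> topspace X. q x \<in> \<Union>\<K>} = (\<Union>U\<in>\<K>. {x \<in> topspace X. q x \<in> U})"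
      by blast
    then show "openin X {x \<in> topspace X. q x \<in> \<Union>\<K>}"
      using K by auto
  qed
  then show ?thesis
    by (simp add: quotient_topology_def topology_inverse')
qed

lemma topspace_quotient_topology [simp]: "topspace (quotient_topology X q) = q ` topspace X"
proof
  show "topspace (quotient_topology X q) \<subseteq> q ` topspace X"
    using openin_quotient_topology[of X q "topspace (quotient_topology X q)"] by simp
  have "{x \<in> topspace X. q x \<in> q ` topspace X} = topspace X"
    by blast
  then have "openin (quotient_topology X q) (q ` topspace X)"
    by (simp add: openin_quotient_topology)
  then show "q ` topspace X \<subseteq> topspace (quotient_topology X q)"
    by (rule openin_subset)
qed

lemma quotient_map_quotient_topology: "quotient_map X (quotient_topology X q) q"
  by (simp add: quotient_map_def openin_quotient_topology)

definition coset_proj :: "('a, 'b) monoid_scheme \<Rightarrow> 'a set \<Rightarrow> 'a \<Rightarrow> 'a set" where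
  "coset_proj G H g = g <#\<^bsub>G\<^esub> H"

definition coset_space :: "('a, 'b) monoid_scheme \<Rightarrow> 'a topology \<Rightarrow> 'a set \<Rightarrow> 'a set topology" where
  "coset_space G T H = quotient_topology T (coset_proj G H)"

(* The canonical map G/N -> G/H, gN |-> gH, for N contained in H. *)
definition coset_map :: "('a, 'b) monoid_scheme \<Rightarrow> 'a set \<Rightarrow> 'a set \<Rightarrow> 'a set" where
  "coset_map G H C = C <#>\<^bsub>G\<^esub> H"

lemma (in group) coset_map_coset_proj:
  assumes "subgroup N G" "subgroup H G" "N \<subseteq> H" "g \<in> carrier G"
  shows "coset_map G H (coset_proj G N g) = coset_proj G H g"
proof -
  interpret N: subgroup N G by fact
  interpret H: subgroup H G by fact
  show ?thesis
  proof
    show "coset_map G H (coset_proj G N g) \<subseteq> coset_proj G H g"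
    proof
      fix x assume "x \<in> coset_map G H (coset_proj G N g)"
      then obtain n h where nh: "n \<in> N" "h \<in> H" "x = g \<otimes> n \<otimes> h"
        by (auto simp: coset_map_def coset_proj_def set_mult_def l_coset_def)
      then have "n \<in> H" "x = g \<otimes> (n \<otimes> h)"
        using assms by (auto simp: m_assoc)
      then show "x \<in> coset_proj G H g"
        using nh by (auto simp: coset_proj_def l_coset_def)
    qed
    show "coset_proj G H g \<subseteq> coset_map G H (coset_proj G N g)"
    proof
      fix x assume "x \<in> coset_proj G H g"
      then obtain h where h: "h \<in> H" "x = g \<otimes> \<one> \<otimes> h"
        using assms by (auto simp: coset_proj_def l_coset_def)
      then show "x \<in> coset_map G H (coset_proj G N g)"
        unfolding coset_map_def coset_proj_def set_mult_def l_coset_def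
        using N.one_closed by blast
    qed
  qed
qed

definition quotient_subgroup :: "('a, 'b) monoid_scheme \<Rightarrow> 'a set \<Rightarrow> 'a set \<Rightarrow> 'a set set" where
  "quotient_subgroup G N H = coset_proj G N ` H"

(* The canonical map G/H -> (G/N)/(H/N), gH |-> (gN)(H/N), for N normal and contained in H. *)
definition quotient_coset_map :: "('a, 'b) monoid_scheme \<Rightarrow> 'a set \<Rightarrow> 'a set \<Rightarrow> 'a set set" where
  "quotient_coset_map G N C = coset_proj G N ` C"

lemma (in group) quotient_coset_map_coset_proj:
  assumes "N \<lhd> G" "subgroup H G" "g \<in> carrier G"
  shows "quotient_coset_map G N (coset_proj G H g) =
         coset_proj (G Mod N) (quotient_subgroup G N H) (coset_proj G N g)"
proof -
  interpret N: normal N G by fact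
  interpret H: subgroup H G by fact
  have mult: "(g <# N) <#> (h <# N) = (g \<otimes> h) <# N" if "h \<in> H" for h
    using N.rcos_sum[of g h] N.coset_eq assms that by (metis H.mem_carrier m_closed)
  have "quotient_coset_map G N (coset_proj G H g) = (\<lambda>h. (g \<otimes> h) <# N) ` H"
    by (auto simp: quotient_coset_map_def coset_proj_def l_coset_def[of G g H])
  also have "\<dots> = (\<lambda>h. (g <# N) <#> (h <# N)) ` H"
    using mult by (auto simp: image_iff)
  also have "\<dots> = coset_proj (G Mod N) (quotient_subgroup G N H) (coset_proj G N g)"
    by (auto simp: coset_proj_def quotient_subgroup_def FactGroup_def l_coset_def[of "_\<lparr>carrier := _\<rparr>"]
        l_coset_def[of "\<lparr>carrier = _, mult = _, one = _\<rparr>"])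
  finally show ?thesis .
qed

(* Cosets in G Mod N are right cosets in the library; for normal N they are the points of G/N. *)
lemma (in locally_compact_group) topspace_coset_space_normal:
  assumes "N \<lhd> G"
  shows "topspace (coset_space G T N) = carrier (G Mod N)"
  using normal.coset_eq[OF assms]
  by (auto simp: coset_space_def coset_proj_def carrier_FactGroup topspace_eq)


section \<open>Haar measures and the measures with properly supported density\<close>

definition left_haar_measure ::
    "('a, 'b) monoid_scheme \<Rightarrow> 'a topology \<Rightarrow> (('a \<Rightarrow> complex) \<Rightarrow> complex) \<Rightarrow> bool" where
  "left_haar_measure G T m \<longleftrightarrow>
     m \<in> radon_measures T \<and>
     (\<forall>f\<in>Cc T. (\<forall>x. f x \<in> \<real>\<^sub>\<ge>\<^sub>0) \<longrightarrow> m f \<in> \<real>\<^sub>\<ge>\<^sub>0) \<and>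
     (\<exists>f\<in>Cc T. m f \<noteq> 0) \<and>
     (\<forall>g\<in>carrier G. \<forall>f\<in>Cc T. m (\<lambda>x. if x \<in> carrier G then f (g \<otimes>\<^bsub>G\<^esub> x) else 0) = m f)"

definition density_measure ::
    "'a topology \<Rightarrow> ('a \<Rightarrow> complex) \<Rightarrow> (('a \<Rightarrow> complex) \<Rightarrow> complex) \<Rightarrow>
     (('a \<Rightarrow> complex) \<Rightarrow> complex)" where
  "density_measure X \<phi> m = (\<lambda>f\<in>Cc X. m (\<lambda>x. \<phi> x * f x))"

(* A left Haar measure is unique up to a positive scalar, which can be absorbed in the density, so
   letting the Haar measure dg vary gives the same set as fixing one. *)
definition M_space ::
    "('a, 'b) monoid_scheme \<Rightarrow> 'a topology \<Rightarrow> 'a set \<Rightarrow> (('a \<Rightarrow> complex) \<Rightarrow> complex) set" where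
  "M_space G T H = {density_measure T \<phi> dg | \<phi> dg.
     left_haar_measure G T dg \<and> continuous_map T euclidean \<phi> \<and>
     proper_continuous_map (subtopology T (fun_support T \<phi>)) (coset_space G T H) (coset_proj G H)}"

end

theory Submission
  imports Defs
begin

text \<open>If the composite \<open>q \<circ> p\<close> is proper on \<open>supp \<mu>\<close>, then \<open>p\<close> is proper on \<open>supp \<mu>\<close> and \<open>q\<close> is proper on
  the closed set \<open>p(supp \<mu>)\<close>, which contains the support of \<open>p\<^sub>* \<mu>\<close>; functoriality of the pushforward and
  parts (1) to (3) follow, since \<open>G/H\<close> and \<open>(G/N)/(H/N)\<close> are homeomorphic. For part (4), choose left
  Haar measures \<open>dn\<close> on \<open>N\<close> and \<open>dy\<close> on \<open>G/N\<close>. Averaging over the cosets of \<open>N\<close> with \<open>dn\<close> and then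
  integrating with \<open>dy\<close> is a left Haar integral on \<open>G\<close>, hence by uniqueness a multiple of any given
  one, and \<open>p\<^sub>*(\<phi> dg)\<close> has, up to a constant, the coset average of \<open>\<phi>\<close> as its density. The Haar
  measures come from Weil's covering numbers and Tychonoff's theorem.\<close>

section \<open>Compactly supported functions and Radon measures\<close>

text \<open>The difficulty of part (4) is to produce a continuous density on \<open>G/N\<close>
  although \<open>\<phi>\<close> need not have compact support. Properness over \<open>G/N\<close>
  replaces compactness twice. On each coset of N the density has compact support, so its average is
  defined. Multiplied by \<open>u \<circ> p\<close>, with u in C_c of \<open>G/N\<close>, it lies in
  C_c of G, so continuity of the average and the computation of its integral reduce to C_c. Left
  cosets fit left Haar measure: another representative of \<open>g N\<close> changes the integrand
  on N by a left translation. The constant from uniqueness may be any complex number, since it goes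
  into the density. Measures being linear forms on C_c, Fubini's theorem and the uniqueness and
  existence of Haar measure are all treated for such forms. Supports need care because a function
  that vanishes on the support of a measure need not vanish near it; approximation shows that the
  measure still kills it, and this makes the pushforward independent of the chosen lift.\<close>

lemma continuous_map_mult:
  fixes f g :: "'a \<Rightarrow> 'b::real_normed_algebra"
  assumes "continuous_map X euclidean f" "continuous_map X euclidean g"
  shows "continuous_map X euclidean (\<lambda>x. f x * g x)"
  using assms by (simp add: continuous_map_atin tendsto_mult)

lemma continuous_map_divide:
  fixes f g :: "'a \<Rightarrow> 'b::real_normed_field"
  assumes "continuous_map X euclidean f" "continuous_map X euclidean g"
    and "\<And>x. x \<in> topspace X \<Longrightarrow> g x \<noteq> 0"
  shows "continuous_map X euclidean (\<lambda>x. f x / g x)"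
  using assms by (simp add: continuous_map_atin tendsto_divide)

lemma continuous_map_compose_continuous_on:
  assumes "continuous_map X euclidean f" "continuous_on UNIV h"
  shows "continuous_map X euclidean (\<lambda>x. h (f x))"
  using continuous_map_compose[OF assms(1), of euclidean h] assms(2) by (simp add: o_def)

lemma continuous_map_local:
  assumes "\<And>x. x \<in> topspace X \<Longrightarrow>
     \<exists>U g. openin X U \<and> x \<in> U \<and> continuous_map X Y g \<and> (\<forall>y\<in>U. f y = g y)"
  shows "continuous_map X Y f"
  unfolding continuous_map_atin
proof
  fix x assume x: "x \<in> topspace X"
  then obtain U g where U: "openin X U" "x \<in> U" "continuous_map X Y g" "\<forall>y\<in>U. f y = g y"
    using assms by blast
  have "limitin Y g (g x) (atin X x)"
    using U(3) x by (auto simp: continuous_map_atin)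
  moreover have "\<forall>\<^sub>F y in atin X x. g y = f y"
    using U x by (auto simp: eventually_atin)
  ultimately show "limitin Y f (f x) (atin X x)"
    using U limitin_transform_eventually[of g f] by auto
qed

lemma continuous_map_complexI:
  fixes f :: "'a \<Rightarrow> complex"
  assumes "\<And>x \<epsilon>. x \<in> topspace X \<Longrightarrow> 0 < \<epsilon> \<Longrightarrow>
    \<exists>U. openin X U \<and> x \<in> U \<and> (\<forall>y\<in>U. norm (f y - f x) \<le> \<epsilon>)"
  shows "continuous_map X euclidean f"
  unfolding continuous_map_atin limitin_canonical_iff tendsto_iff
proof (intro ballI allI impI)
  fix x \<epsilon> assume x: "x \<in> topspace X" and "(0::real) < \<epsilon>"
  then obtain U where U: "openin X U" "x \<in> U" "\<forall>y\<in>U. norm (f y - f x) \<le> \<epsilon> / 2"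
    using assms[of x "\<epsilon> / 2"] by auto
  have "dist (f y) (f x) < \<epsilon>" if "y \<in> U" for y
    using U(3) that \<open>0 < \<epsilon>\<close> by (force simp: dist_norm)
  then show "\<forall>\<^sub>F y in atin X x. dist (f y) (f x) < \<epsilon>"
    using U x by (auto simp: eventually_atin)
qed

text \<open>Closes estimates that hold with an error depending on \<epsilon>: the bound may be any
  expression with the right limit at 0, such as a product of perturbed factors.\<close>

lemma le_limit_at_right_0:
  fixes f :: "real \<Rightarrow> real"
  assumes "(f \<longlongrightarrow> l) (at_right 0)" "\<And>\<epsilon>. 0 < \<epsilon> \<Longrightarrow> x \<le> f \<epsilon>"
  shows "x \<le> l"
proof (rule tendsto_lowerbound[OF assms(1) _ trivial_limit_at_right_real])
  show "\<forall>\<^sub>F \<epsilon> in at_right 0. x \<le> f \<epsilon>"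
    using eventually_at_right_less[of "0::real"] by eventually_elim (rule assms(2))
qed

lemma compactin_finite_subcover:
  assumes "compactin X K" "\<And>x. x \<in> K \<Longrightarrow> openin X (V x) \<and> x \<in> V x"
  shows "\<exists>B. finite B \<and> B \<subseteq> K \<and> K \<subseteq> (\<Union>x\<in>B. V x)"
proof -
  have "\<forall>U\<in>V ` K. openin X U" "K \<subseteq> \<Union>(V ` K)" using assms(2) by auto
  then obtain F where F: "finite F" "F \<subseteq> V ` K" "K \<subseteq> \<Union>F"
    using assms(1) unfolding compactin_def by meson
  then obtain B where "finite B" "B \<subseteq> K" "F = V ` B"
    by (meson finite_subset_image)
  then show ?thesis using F by blast
qed

lemma Cc_continuous: "f \<in> Cc X \<Longrightarrow> continuous_map X euclidean f"
  and Cc_outside: "f \<in> Cc X \<Longrightarrow> x \<notin> topspace X \<Longrightarrow> f x = 0"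
  and Cc_compact_support: "f \<in> Cc X \<Longrightarrow> compactin X (fun_support X f)"
  by (auto simp: Cc_def)

lemma fun_support_outside:
  "x \<in> topspace X \<Longrightarrow> x \<notin> fun_support X f \<Longrightarrow> f x = 0"
  using closure_of_subset[of "{x \<in> topspace X. f x \<noteq> 0}" X] by (auto simp: fun_support_def)

lemma Cc_outside_support: "f \<in> Cc X \<Longrightarrow> x \<notin> fun_support X f \<Longrightarrow> f x = 0"
  using fun_support_outside Cc_outside by metis

lemma closedin_fun_support: "closedin X (fun_support X f)"
  by (simp add: fun_support_def)

lemma fun_support_subset:
  "closedin X K \<Longrightarrow> (\<And>x. x \<in> topspace X \<Longrightarrow> x \<notin> K \<Longrightarrow> f x = 0) \<Longrightarrow> fun_support X f \<subseteq> K"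
  unfolding fun_support_def by (rule closure_of_minimal) auto

lemma Cc_bounded:
  assumes "f \<in> Cc X" shows "\<exists>B. \<forall>x. norm (f x) \<le> B"
proof -
  have "compact (f ` fun_support X f)"
    using image_compactin[OF Cc_compact_support Cc_continuous] assms by fastforce
  then obtain B where "\<forall>y\<in>f ` fun_support X f. norm y \<le> B"
    using compact_imp_bounded bounded_iff by blast
  then have "norm (f x) \<le> max B 0" for x
    by (cases "x \<in> fun_support X f") (auto simp: Cc_outside_support[OF assms] le_max_iff_disj)
  then show ?thesis by blast
qed

lemma norm_le_sup_norm: "f \<in> Cc X \<Longrightarrow> norm (f x) \<le> sup_norm f"
  unfolding sup_norm_def using Cc_bounded[of f X]
  by (intro cSUP_upper) (auto simp: bdd_above_def)

lemma sup_norm_le: "(\<And>x. norm (f x) \<le> B) \<Longrightarrow> sup_norm f \<le> B"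
  unfolding sup_norm_def by (rule cSUP_least) auto

lemma sup_norm_nonneg: "f \<in> Cc X \<Longrightarrow> 0 \<le> sup_norm f"
  using norm_le_sup_norm[of f X] norm_ge_zero order_trans by blast

section \<open>Cutoff functions and partitions of unity on locally compact Hausdorff spaces\<close>

locale locally_compact_Hausdorff =
  fixes X :: "'a topology"
  assumes lc: "locally_compact_space X" and Haus: "Hausdorff_space X"
begin

lemma closedin_compactin: "compactin X K \<Longrightarrow> closedin X K"
  using Haus compactin_imp_closedin by blast

lemma CcI:
  assumes "continuous_map X euclidean f" "compactin X K" "\<And>x. x \<notin> K \<Longrightarrow> f x = 0"
  shows "f \<in> Cc X" and "fun_support X f \<subseteq> K"
proof -
  show *: "fun_support X f \<subseteq> K"
    using assms by (intro fun_support_subset closedin_compactin)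
  then have "compactin X (fun_support X f)"
    using assms(2) closed_compactin closedin_fun_support by blast
  then show "f \<in> Cc X"
    using assms by (auto simp: Cc_def dest: compactin_subset_topspace)
qed

lemma Cc_add: assumes "f \<in> Cc X" "g \<in> Cc X" shows "(\<lambda>x. f x + g x) \<in> Cc X"
proof (rule CcI(1))
  show "compactin X (fun_support X f \<union> fun_support X g)"
    using assms by (simp add: Cc_compact_support compactin_Un)
qed (use assms in \<open>auto intro: continuous_map_add Cc_continuous simp: Cc_outside_support\<close>)

lemma Cc_mult:
  assumes "f \<in> Cc X" "continuous_map X euclidean h"
  shows "(\<lambda>x. h x * f x) \<in> Cc X"
  by (rule CcI(1)[of _ "fun_support X f"])
    (use assms in \<open>auto intro: continuous_map_mult Cc_continuous simp: Cc_outside_support Cc_compact_support\<close>)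

lemma Cc_mult2: "f \<in> Cc X \<Longrightarrow> h \<in> Cc X \<Longrightarrow> (\<lambda>x. h x * f x) \<in> Cc X"
  by (simp add: Cc_mult Cc_continuous)

lemma Cc_scale: "f \<in> Cc X \<Longrightarrow> (\<lambda>x. c * f x) \<in> Cc X"
  by (rule Cc_mult) auto

lemma Cc_zero: "(\<lambda>x. 0) \<in> Cc X"
  by (rule CcI(1)[of _ "{}"]) auto

lemma Cc_diff: "f \<in> Cc X \<Longrightarrow> g \<in> Cc X \<Longrightarrow> (\<lambda>x. f x - g x) \<in> Cc X"
  using Cc_add[OF _ Cc_scale[of g "-1"]] by simp

lemma Cc_sum: "(\<And>i. i \<in> A \<Longrightarrow> f i \<in> Cc X) \<Longrightarrow> (\<lambda>x. \<Sum>i\<in>A. f i x) \<in> Cc X"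
  by (induction A rule: infinite_finite_induct) (auto simp: Cc_zero Cc_add)

lemma Cc_compose:
  assumes "f \<in> Cc X" "continuous_on UNIV h" "h 0 = 0"
  shows "(\<lambda>x. h (f x)) \<in> Cc X"
  by (rule CcI(1)[of _ "fun_support X f"])
    (use assms in \<open>auto intro: continuous_map_compose_continuous_on Cc_continuous
        simp: Cc_outside_support Cc_compact_support\<close>)

lemma Cc_Re: "f \<in> Cc X \<Longrightarrow> (\<lambda>x. complex_of_real (Re (f x))) \<in> Cc X"
  and Cc_Im: "f \<in> Cc X \<Longrightarrow> (\<lambda>x. complex_of_real (Im (f x))) \<in> Cc X"
  using Cc_compose[of f "\<lambda>z. complex_of_real (Re z)"] Cc_compose[of f "\<lambda>z. complex_of_real (Im z)"]
  by (simp_all add: continuous_intros)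

text \<open>Near a point of the support of f the denominator stays away from 0. Off the support,
  which is an open set, the quotient is 0 whatever h does there.\<close>

lemma Cc_divide:
  assumes f: "f \<in> Cc X" and h: "continuous_map X euclidean h"
    and nz: "\<And>x. x \<in> fun_support X f \<Longrightarrow> h x \<noteq> 0"
  shows "(\<lambda>x. f x / h x) \<in> Cc X"
proof (rule CcI(1)[of _ "fun_support X f"])
  show "continuous_map X euclidean (\<lambda>x. f x / h x)"
  proof (rule continuous_map_local)
    fix x assume x: "x \<in> topspace X"
    show "\<exists>U g. openin X U \<and> x \<in> U \<and> continuous_map X euclidean g \<and> (\<forall>y\<in>U. f y / h y = g y)"
    proof (cases "x \<in> fun_support X f")
      case True
      define d where "d = norm (h x) / 2"
      have d: "0 < d" "d < norm (h x)" using nz[OF True] by (auto simp: d_def)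
      define U where "U = {y \<in> topspace X. norm (h y) \<in> {d<..}}"
      have "openin X U"
        unfolding U_def by (rule openin_continuous_map_preimage[OF continuous_map_norm[OF h]]) auto
      \<comment> \<open>On \<open>U\<close> this is \<open>norm (h y)\<close>, so \<open>?g\<close>
        below is \<open>f / h\<close> expanded by the conjugate of h. The lower bound d keeps the
        denominator nonzero on the whole space.\<close>
      let ?k = "\<lambda>y. complex_of_real (max d (norm (h y)))"
      let ?g = "\<lambda>y. f y * cnj (h y) / (?k y * ?k y)"
      have "continuous_map X euclidean ?k"
        using continuous_map_compose_continuous_on[OF h, of "\<lambda>z. complex_of_real (max d (norm z))"]
        by (simp add: continuous_intros)
      moreover have "continuous_map X euclidean (\<lambda>y. cnj (h y))"
        by (rule continuous_map_compose_continuous_on[OF h]) (simp add: continuous_intros)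
      ultimately have "continuous_map X euclidean ?g"
        using d by (intro continuous_map_divide continuous_map_mult Cc_continuous[OF f]) (auto simp: max_def)
      moreover have "f y / h y = ?g y" if "y \<in> U" for y
      proof -
        have "?k y * ?k y = h y * cnj (h y)" "h y \<noteq> 0"
          using that d complex_norm_square[of "h y"] by (auto simp: U_def max_def power2_eq_square)
        then show ?thesis by simp
      qed
      ultimately show ?thesis
        using \<open>openin X U\<close> x d by (intro exI[of _ U] exI[of _ ?g]) (auto simp: U_def)
    next
      case False
      show ?thesis
        by (rule exI[of _ "topspace X - fun_support X f"], rule exI[of _ "\<lambda>_. 0"])
          (use False x closedin_fun_support in \<open>auto simp: Cc_outside_support[OF f]\<close>)
    qed
  qed
qed (use assms in \<open>auto simp: Cc_outside_support Cc_compact_support\<close>)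

lemma compact_neighbourhood:
  assumes "compactin X K"
  obtains W L where "openin X W" "compactin X L" "K \<subseteq> W" "W \<subseteq> L"
  using lc Haus assms unfolding locally_compact_space_compact_closed_compact[OF disjI1[OF Haus]] by blast

lemma Urysohn_cutoff:
  assumes K: "compactin X K" and U: "openin X U" "K \<subseteq> U"
  shows "\<exists>f L. (\<lambda>x. of_real (f x)) \<in> Cc X \<and> (\<forall>x. 0 \<le> f x \<and> f x \<le> (1::real)) \<and>
    (\<forall>x\<in>K. f x = 1) \<and> compactin X L \<and> L \<subseteq> U \<and> (\<forall>x. x \<notin> L \<longrightarrow> f x = 0)"
proof -
  obtain W M where W: "openin X W" "compactin X M" "K \<subseteq> W" "W \<subseteq> M"
    using compact_neighbourhood[OF K] by blast
  have cr: "completely_regular_space X"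
    using lc Haus locally_compact_regular_imp_completely_regular_space by blast
  have "closedin X (topspace X - (U \<inter> W))" "disjnt K (topspace X - (U \<inter> W))"
    using U W by (auto simp: disjnt_iff)
  from Urysohn_completely_regular_compact_closed[OF zero_le_one cr K this]
  obtain f :: "'a \<Rightarrow> real" where f: "continuous_map X (subtopology euclidean {0..1}) f"
      "f ` (topspace X - (U \<inter> W)) \<subseteq> {0}" "f ` K \<subseteq> {1}" .
  have fc: "continuous_map X euclideanreal f" and f01: "\<And>x. x \<in> topspace X \<Longrightarrow> f x \<le> 1"
    using f(1) by (auto simp: continuous_map_in_subtopology Pi_iff)
  \<comment> \<open>The Urysohn function f vanishes off \<open>U \<inter> W\<close>, but the closure
    of its nonzero set may leave that set. Keeping only the part of f above 1/2 gives a function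
    that vanishes off a closed set \<open>L\<close> inside \<open>U \<inter> W\<close>, hence inside
    the compact set \<open>M\<close>.\<close>
  define g where "g = (\<lambda>x. if x \<in> topspace X then max 0 (2 * f x - 1) else 0)"
  define L where "L = {x \<in> topspace X. f x \<in> {1/2..}}"
  have "closedin X L"
    unfolding L_def by (rule closedin_continuous_map_preimage[OF fc]) auto
  moreover have LUW: "L \<subseteq> U \<inter> W"
    using f(2) by (fastforce simp: L_def)
  ultimately have L: "compactin X L"
    using W closed_compactin[of X M L] by blast
  have gc: "continuous_map X euclidean (\<lambda>x. complex_of_real (g x))"
    using continuous_map_compose_continuous_on[OF fc, of "\<lambda>t. complex_of_real (max 0 (2 * t - 1))"]
    by (rule continuous_map_eq) (auto simp: g_def continuous_intros)
  have out: "g x = 0" if "x \<notin> L" for x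
    using that by (auto simp: g_def L_def)
  have "(\<lambda>x. of_real (g x)) \<in> Cc X"
    by (rule CcI(1)[OF gc L]) (simp add: out)
  moreover have "\<forall>x. 0 \<le> g x \<and> g x \<le> 1" "\<forall>x\<in>K. g x = 1"
    using f01 f(3) compactin_subset_topspace[OF K] by (auto simp: g_def)
  ultimately show ?thesis
    using L LUW out by (intro exI[of _ g] exI[of _ L]) auto
qed

lemma partition_of_unity:
  assumes K: "compactin X K" and U: "\<And>x. x \<in> K \<Longrightarrow> openin X (U x) \<and> x \<in> U x"
  obtains B p where "finite B" "B \<subseteq> K" "\<And>b. b \<in> B \<Longrightarrow> (\<lambda>x. of_real (p b x)) \<in> Cc X"
    "\<And>b. b \<in> B \<Longrightarrow> fun_support X (\<lambda>x. complex_of_real (p b x)) \<subseteq> U b"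
    "\<And>b x. 0 \<le> p b x" "\<And>x. (\<Sum>b\<in>B. p b x) \<le> 1" "\<And>x. x \<in> K \<Longrightarrow> (\<Sum>b\<in>B. p b x) = (1::real)"
proof -
  have Kt: "K \<subseteq> topspace X" using K by (rule compactin_subset_topspace)
  have "\<forall>x\<in>K. \<exists>h. (\<lambda>y. of_real (h y)) \<in> Cc X \<and> (\<forall>y. 0 \<le> h y) \<and> h x = (1::real) \<and>
      fun_support X (\<lambda>y. complex_of_real (h y)) \<subseteq> U x"
  proof
    fix x assume xK: "x \<in> K"
    have "compactin X {x}" using xK Kt by auto
    then obtain h L where "(\<lambda>y. of_real (h y)) \<in> Cc X" "\<forall>y. 0 \<le> h y \<and> h y \<le> (1::real)"
        "\<forall>y\<in>{x}. h y = 1" "compactin X L" "L \<subseteq> U x" "\<forall>y. y \<notin> L \<longrightarrow> h y = 0"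
      using Urysohn_cutoff[of "{x}" "U x"] U[OF xK] by blast
    then show "\<exists>h. (\<lambda>y. of_real (h y)) \<in> Cc X \<and> (\<forall>y. 0 \<le> h y) \<and> h x = (1::real) \<and>
        fun_support X (\<lambda>y. complex_of_real (h y)) \<subseteq> U x"
      using CcI(2)[of "\<lambda>y. complex_of_real (h y)" L] Cc_continuous[of "\<lambda>y. complex_of_real (h y)"]
      by (intro exI[of _ h]) auto
  qed
  from bchoice[OF this] obtain h where "\<forall>x\<in>K. (\<lambda>y. of_real (h x y)) \<in> Cc X \<and> (\<forall>y. 0 \<le> h x y) \<and>
      h x x = (1::real) \<and> fun_support X (\<lambda>y. complex_of_real (h x y)) \<subseteq> U x" ..
  then have h: "\<And>x. x \<in> K \<Longrightarrow> (\<lambda>y. of_real (h x y)) \<in> Cc X"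
      "\<And>x y. x \<in> K \<Longrightarrow> 0 \<le> h x y" "\<And>x. x \<in> K \<Longrightarrow> h x x = (1::real)"
      "\<And>x. x \<in> K \<Longrightarrow> fun_support X (\<lambda>y. complex_of_real (h x y)) \<subseteq> U x"
    by auto
  have hc: "continuous_map X euclideanreal (h x)" if "x \<in> K" for x
    using continuous_map_compose_continuous_on[OF Cc_continuous[OF h(1)[OF that]], of Re]
    by (simp add: continuous_intros)
  define V where "V = (\<lambda>x. {y \<in> topspace X. h x y \<in> {0<..}})"
  have V: "openin X (V x)" "x \<in> V x" if "x \<in> K" for x
    using that h(3)[OF that] Kt openin_continuous_map_preimage[OF hc[OF that], of "{0<..}"]
    by (auto simp: V_def)
  obtain B where B: "finite B" "B \<subseteq> K" "K \<subseteq> (\<Union>x\<in>B. V x)"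
    using compactin_finite_subcover[OF K, of V] V by auto
  define S where "S = (\<lambda>x. \<Sum>b\<in>B. h b x)"
  have Sc: "continuous_map X euclideanreal S"
    unfolding S_def using B hc by (intro continuous_map_sum) auto
  have S0: "0 \<le> S x" for x unfolding S_def using B h by (intro sum_nonneg) auto
  have Spos: "0 < S x" if xK: "x \<in> K" for x
  proof -
    obtain b where b: "b \<in> B" "h b x > 0" using B xK by (auto simp: V_def)
    show ?thesis
      unfolding S_def by (rule sum_pos2[OF B(1) b(1)]) (use b B h in auto)
  qed
  have S1: "openin X {x \<in> topspace X. S x \<in> {0<..}}"
    by (rule openin_continuous_map_preimage[OF Sc]) auto
  have S2: "K \<subseteq> {x \<in> topspace X. S x \<in> {0<..}}"
    using Spos Kt by auto
  \<comment> \<open>Normalising by \<open>S\<close> directly fails where \<open>S\<close> vanishes.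
    The cutoff \<open>u\<close> is 1 on \<open>K\<close> and supported where \<open>S\<close> is
    positive, so \<open>u / S\<close> is in C_c.\<close>
  obtain u L where u: "(\<lambda>x. of_real (u x)) \<in> Cc X"
    "\<forall>x. 0 \<le> u x \<and> u x \<le> (1::real)" "\<forall>x\<in>K. u x = 1" "compactin X L"
    "L \<subseteq> {x \<in> topspace X. S x \<in> {0<..}}" "\<forall>x. x \<notin> L \<longrightarrow> u x = 0"
    using Urysohn_cutoff[OF K S1 S2] by blast
  have suppL: "fun_support X (\<lambda>x. complex_of_real (u x)) \<subseteq> L"
    using CcI(2)[OF Cc_continuous[OF u(1)] u(4)] u(6) by simp
  have q: "(\<lambda>x. complex_of_real (u x) / complex_of_real (S x)) \<in> Cc X"
    using suppL u(5)
    by (intro Cc_divide u(1) continuous_map_compose_continuous_on[OF Sc]) (auto simp: continuous_intros)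
  define p where "p = (\<lambda>b x. if b \<in> B then h b x * (u x / S x) else 0)"
  \<comment> \<open>As division by 0 gives 0, \<open>S x / S x\<close> is 0 or 1. This form yields
    both the bound by 1 everywhere and equality to 1 on \<open>K\<close>.\<close>
  have sum_p: "(\<Sum>b\<in>B. p b x) = u x * (S x / S x)" for x
  proof -
    have "(\<Sum>b\<in>B. p b x) = (\<Sum>b\<in>B. h b x * (u x / S x))"
      by (rule sum.cong) (auto simp: p_def)
    also have "\<dots> = S x * (u x / S x)"
      unfolding S_def by (rule sum_distrib_right[symmetric])
    finally show ?thesis by simp
  qed
  show ?thesis
  proof (rule that[of B p])
    fix b assume b: "b \<in> B"
    then have bK: "b \<in> K" using B by auto
    show pc: "(\<lambda>x. of_real (p b x)) \<in> Cc X"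
      using b Cc_mult2[OF q h(1)[OF bK]] by (simp add: p_def)
    have "fun_support X (\<lambda>x. complex_of_real (p b x)) \<subseteq> fun_support X (\<lambda>x. complex_of_real (h b x))"
      unfolding fun_support_def by (rule closure_of_mono) (auto simp: p_def)
    then show "fun_support X (\<lambda>x. complex_of_real (p b x)) \<subseteq> U b"
      using h(4)[OF bK] by auto
  next
    show "0 \<le> p b x" for b x
      using h(2) B u(2) S0 by (auto simp: p_def)
    show "(\<Sum>b\<in>B. p b x) \<le> 1" for x
      unfolding sum_p using u(2) by (cases "S x = 0") auto
    show "(\<Sum>b\<in>B. p b x) = 1" if "x \<in> K" for x
      unfolding sum_p using u(3) Spos that by force
  qed (use B in auto)
qed

end

section \<open>Radon measures and their supports\<close>

lemma radon_add:
    "\<mu> \<in> radon_measures X \<Longrightarrow> f \<in> Cc X \<Longrightarrow> g \<in> Cc X \<Longrightarrow> \<mu> (\<lambda>x. f x + g x) = \<mu> f + \<mu> g"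
  and radon_scale: "\<mu> \<in> radon_measures X \<Longrightarrow> f \<in> Cc X \<Longrightarrow> \<mu> (\<lambda>x. c * f x) = c * \<mu> f"
  by (auto simp: radon_measures_def)

lemma closedin_measure_support: "closedin X (measure_support X \<mu>)"
  unfolding measure_support_def by (intro closedin_diff openin_Union) auto

lemma measure_support_subset_topspace: "measure_support X \<mu> \<subseteq> topspace X"
  by (auto simp: measure_support_def)

text \<open>A function supported in the complement of S vanishes on S, so the hypothesis makes this
  complement one of the open sets removed in \<open>measure_support\<close>. Testing on functions
  that merely vanish on S is easier in applications.\<close>

lemma measure_support_subset:
  assumes "closedin X S" "\<And>f. f \<in> Cc X \<Longrightarrow> (\<And>x. x \<in> S \<Longrightarrow> f x = 0) \<Longrightarrow> \<mu> f = 0"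
  shows "measure_support X \<mu> \<subseteq> S"
proof -
  have "\<mu> f = 0" if f: "f \<in> Cc X" "fun_support X f \<subseteq> topspace X - S" for f
    using f Cc_outside_support[OF f(1)] by (intro assms(2)) auto
  then have "topspace X - S \<in> {U. openin X U \<and> (\<forall>f\<in>Cc X. fun_support X f \<subseteq> U \<longrightarrow> \<mu> f = 0)}"
    using assms(1) by auto
  then show ?thesis
    unfolding measure_support_def by blast
qed

context locally_compact_Hausdorff begin

lemma radon_zero: "\<mu> \<in> radon_measures X \<Longrightarrow> \<mu> (\<lambda>x. 0) = 0"
  using radon_scale[OF _ Cc_zero, of \<mu> 0] by simp

lemma radon_diff:
  assumes "\<mu> \<in> radon_measures X" "f \<in> Cc X" "g \<in> Cc X"
  shows "\<mu> (\<lambda>x. f x - g x) = \<mu> f - \<mu> g"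
  using radon_add[OF assms(1,2) Cc_scale[OF assms(3), of "-1"]] radon_scale[OF assms(1,3), of "-1"]
  by simp

lemma radon_sum:
  assumes \<mu>: "\<mu> \<in> radon_measures X" and f: "\<And>i. i \<in> A \<Longrightarrow> f i \<in> Cc X"
  shows "\<mu> (\<lambda>x. \<Sum>i\<in>A. f i x) = (\<Sum>i\<in>A. \<mu> (f i))"
  using f
proof (induction A rule: infinite_finite_induct)
  case (insert a A)
  then show ?case
    using radon_add[OF \<mu>, of "f a" "\<lambda>x. \<Sum>i\<in>A. f i x"] Cc_sum[of A f] by simp
qed (simp_all add: radon_zero[OF \<mu>])

lemma radon_bound:
  assumes \<mu>: "\<mu> \<in> radon_measures X" and K: "compactin X K"
  shows "\<exists>C\<ge>0. \<forall>f B. f \<in> Cc X \<longrightarrow> (\<forall>x. x \<notin> K \<longrightarrow> f x = 0) \<longrightarrow> (\<forall>x. norm (f x) \<le> B) \<longrightarrow> norm (\<mu> f) \<le> C * B"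
proof -
  obtain C where C: "\<forall>f\<in>Cc X. fun_support X f \<subseteq> K \<longrightarrow> norm (\<mu> f) \<le> C * sup_norm f"
    using \<mu> K by (auto simp: radon_measures_def)
  \<comment> \<open>The constant C may be negative when 0 is the only function supported in K; the
    absolute value makes the bound monotone in the sup norm.\<close>
  have "norm (\<mu> f) \<le> \<bar>C\<bar> * B"
    if f: "f \<in> Cc X" and out: "\<forall>x. x \<notin> K \<longrightarrow> f x = 0" and B: "\<forall>x. norm (f x) \<le> B" for f B
  proof -
    have "fun_support X f \<subseteq> K"
      using CcI(2)[OF Cc_continuous[OF f] K] out by blast
    then have "norm (\<mu> f) \<le> C * sup_norm f" using C f by blast
    also have "\<dots> \<le> \<bar>C\<bar> * sup_norm f"
      using sup_norm_nonneg[OF f] by (intro mult_right_mono) auto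
    also have "\<dots> \<le> \<bar>C\<bar> * B"
      using sup_norm_le[of f B] B by (intro mult_left_mono) auto
    finally show ?thesis .
  qed
  then show ?thesis by (intro exI[of _ "\<bar>C\<bar>"]) auto
qed

text \<open>A partition of unity subordinate to the null open sets splits f into finitely many
  pieces, each of which \<mu> kills.\<close>

lemma radon_vanish_open_cover:
  assumes \<mu>: "\<mu> \<in> radon_measures X" and f: "f \<in> Cc X"
    and cover: "fun_support X f \<subseteq> \<Union>{U. openin X U \<and> (\<forall>g\<in>Cc X. fun_support X g \<subseteq> U \<longrightarrow> \<mu> g = 0)}"
  shows "\<mu> f = 0"
proof -
  have "\<forall>x\<in>fun_support X f. \<exists>U. x \<in> U \<and> openin X U \<and> (\<forall>g\<in>Cc X. fun_support X g \<subseteq> U \<longrightarrow> \<mu> g = 0)"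
    using cover by blast
  from bchoice[OF this] obtain U where U: "\<forall>x\<in>fun_support X f. x \<in> U x \<and> openin X (U x) \<and>
      (\<forall>g\<in>Cc X. fun_support X g \<subseteq> U x \<longrightarrow> \<mu> g = 0)" ..
  have U': "openin X (U x) \<and> x \<in> U x" if "x \<in> fun_support X f" for x
    using U that by blast
  obtain B p where B: "finite B" "B \<subseteq> fun_support X f"
      and p: "\<And>b. b \<in> B \<Longrightarrow> (\<lambda>x. of_real (p b x)) \<in> Cc X"
        "\<And>b. b \<in> B \<Longrightarrow> fun_support X (\<lambda>x. complex_of_real (p b x)) \<subseteq> U b"
      and p1: "\<And>x. x \<in> fun_support X f \<Longrightarrow> (\<Sum>b\<in>B. p b x) = (1::real)"
    using partition_of_unity[OF Cc_compact_support[OF f] U'] by metis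
  have "f = (\<lambda>x. \<Sum>b\<in>B. of_real (p b x) * f x)"
  proof
    fix x
    show "f x = (\<Sum>b\<in>B. of_real (p b x) * f x)"
    proof (cases "x \<in> fun_support X f")
      case True
      then have "(\<Sum>b\<in>B. complex_of_real (p b x)) = 1"
        by (metis p1 of_real_1 of_real_sum)
      then show ?thesis by (simp flip: sum_distrib_right)
    qed (simp add: Cc_outside_support[OF f])
  qed
  moreover have "\<mu> (\<lambda>x. of_real (p b x) * f x) = 0" if "b \<in> B" for b
  proof -
    have "fun_support X (\<lambda>x. of_real (p b x) * f x) \<subseteq> fun_support X (\<lambda>x. complex_of_real (p b x))"
      unfolding fun_support_def by (rule closure_of_mono) auto
    then have "fun_support X (\<lambda>x. of_real (p b x) * f x) \<subseteq> U b" using p(2)[OF that] by blast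
    then show ?thesis
      using U B(2) that Cc_mult2[OF f p(1)[OF that]] by blast
  qed
  ultimately show ?thesis
    using radon_sum[OF \<mu>, of B "\<lambda>b x. of_real (p b x) * f x"] Cc_mult2[OF f p(1)] by simp
qed

text \<open>The support of f may touch the support of \<mu> although f is 0 there. Cutting off the
  values of modulus below \<epsilon> moves the support of f away from that of \<mu>, and changes f
  by at most \<epsilon> on a fixed compact set.\<close>

lemma radon_vanish_on_support:
  assumes \<mu>: "\<mu> \<in> radon_measures X" and f: "f \<in> Cc X"
    and zero: "\<And>x. x \<in> measure_support X \<mu> \<Longrightarrow> f x = 0"
  shows "\<mu> f = 0"
proof -
  obtain C where C: "C \<ge> 0" "\<forall>g B. g \<in> Cc X \<longrightarrow> (\<forall>x. x \<notin> fun_support X f \<longrightarrow> g x = 0) \<longrightarrow>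
      (\<forall>x. norm (g x) \<le> B) \<longrightarrow> norm (\<mu> g) \<le> C * B"
    using radon_bound[OF \<mu> Cc_compact_support[OF f]] by blast
  have "norm (\<mu> f) \<le> C * \<epsilon>" if "\<epsilon> > 0" for \<epsilon> :: real
  proof -
    \<comment> \<open>Radial shrinking: h moves z towards 0 by \<epsilon>, or to 0 when the modulus
      is at most \<epsilon>. The maximum in the denominator avoids division by 0 without changing
      the value.\<close>
    define h where "h = (\<lambda>z::complex. z * complex_of_real (max 0 (norm z - \<epsilon>) / max (norm z) \<epsilon>))"
    have "max (norm z) \<epsilon> \<noteq> 0" for z :: complex using that by auto
    then have "continuous_on UNIV h"
      unfolding h_def by (intro continuous_intros) auto
    then have g: "(\<lambda>x. h (f x)) \<in> Cc X"
      by (rule Cc_compose[OF f]) (simp add: h_def)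
    have h_close: "norm (z - h z) \<le> \<epsilon>" for z
    proof (cases "norm z \<le> \<epsilon>")
      case True then show ?thesis by (simp add: h_def)
    next
      case False
      then have "max 0 (norm z - \<epsilon>) / max (norm z) \<epsilon> = 1 - \<epsilon> / norm z"
        using that by (auto simp: diff_divide_distrib)
      then have "h z = z * (1 - complex_of_real (\<epsilon> / norm z))"
        unfolding h_def by (simp only: of_real_diff of_real_1)
      then have "z - h z = z * complex_of_real (\<epsilon> / norm z)"
        by (simp only: right_diff_distrib) simp
      then have "norm (z - h z) = norm z * (\<epsilon> / norm z)"
        using that by (simp add: norm_mult norm_divide)
      then show ?thesis using that by simp
    qed
    let ?A = "{x \<in> topspace X. norm (f x) \<in> {\<epsilon>..}}"
    have "closedin X ?A"
      by (rule closedin_continuous_map_preimage[OF continuous_map_norm[OF Cc_continuous[OF f]]]) auto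
    then have "fun_support X (\<lambda>x. h (f x)) \<subseteq> ?A"
      by (rule fun_support_subset) (auto simp: h_def)
    moreover have "?A \<inter> measure_support X \<mu> = {}"
      using zero that by auto
    ultimately have "fun_support X (\<lambda>x. h (f x)) \<subseteq>
        \<Union>{U. openin X U \<and> (\<forall>g\<in>Cc X. fun_support X g \<subseteq> U \<longrightarrow> \<mu> g = 0)}"
      unfolding measure_support_def by blast
    then have "\<mu> (\<lambda>x. h (f x)) = 0"
      by (rule radon_vanish_open_cover[OF \<mu> g])
    then have "\<mu> f = \<mu> (\<lambda>x. f x - h (f x))"
      using radon_diff[OF \<mu> f g] by simp
    also have "norm \<dots> \<le> C * \<epsilon>"
      using C(2) Cc_diff[OF f g] h_close Cc_outside_support[OF f] by (simp add: h_def)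
    finally show ?thesis .
  qed
  then have "norm (\<mu> f) \<le> 0"
    by (rule le_limit_at_right_0[rotated]) (auto intro!: tendsto_eq_intros)
  then show ?thesis by simp
qed

lemma radon_cong_support:
  assumes "\<mu> \<in> radon_measures X" "f \<in> Cc X" "g \<in> Cc X"
    "\<And>x. x \<in> measure_support X \<mu> \<Longrightarrow> f x = g x"
  shows "\<mu> f = \<mu> g"
  using radon_vanish_on_support[OF assms(1) Cc_diff[OF assms(2,3)]] radon_diff[OF assms(1-3)] assms(4)
  by simp

end

section \<open>Pushforward along proper maps\<close>

lemma proper_continuous_map_subtopology_iff:
  "proper_continuous_map (subtopology X S) Y p \<longleftrightarrow>
     continuous_map (subtopology X S) Y p \<and>
     (\<forall>K. compactin Y K \<longrightarrow> compactin X {x \<in> topspace X. x \<in> S \<and> p x \<in> K})"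
proof -
  have "{x \<in> topspace (subtopology X S). p x \<in> K} = {x \<in> topspace X. x \<in> S \<and> p x \<in> K}" for K
    by auto
  then show ?thesis
    unfolding proper_continuous_map_def by (simp add: compactin_subtopology subset_iff)
qed

lemma proper_continuous_map_closed_subset:
  assumes p: "proper_continuous_map (subtopology X S) Y p" and S': "closedin X S'" "S' \<subseteq> S"
  shows "proper_continuous_map (subtopology X S') Y p"
  unfolding proper_continuous_map_subtopology_iff
proof (intro conjI allI impI)
  show "continuous_map (subtopology X S') Y p"
    using p S'(2) continuous_map_from_subtopology_mono unfolding proper_continuous_map_def by blast
  fix K assume "compactin Y K"
  then have "compactin X {x \<in> topspace X. x \<in> S \<and> p x \<in> K}"
    using p unfolding proper_continuous_map_subtopology_iff by blast
  from closed_Int_compactin[OF S'(1) this]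
  have "compactin X (S' \<inter> {x \<in> topspace X. x \<in> S \<and> p x \<in> K})" .
  also have "S' \<inter> {x \<in> topspace X. x \<in> S \<and> p x \<in> K} = {x \<in> topspace X. x \<in> S' \<and> p x \<in> K}"
    using S' by auto
  finally show "compactin X {x \<in> topspace X. x \<in> S' \<and> p x \<in> K}" .
qed

text \<open>Compact preimages force the map to be closed because the target is a k-space whose
  compact sets are closed. The closed image will serve as an upper bound for the support of a
  pushforward or of an averaged density.\<close>

lemma proper_continuous_map_closed_image:
  assumes Y: "locally_compact_Hausdorff Y" and p: "proper_continuous_map (subtopology X S) Y p"
    and S: "S \<subseteq> topspace X"
  shows "closedin Y (p ` S)"
proof -
  interpret Y: locally_compact_Hausdorff Y by fact
  have "proper_map (subtopology X S) Y p"
  proof (rule compact_imp_proper_map)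
    show "k_space Y" using Y.lc by (rule locally_compact_imp_k_space)
    show "kc_space Y" using Y.Haus by (rule Hausdorff_imp_kc_space)
  qed (use p in \<open>auto simp: proper_continuous_map_def continuous_map_def\<close>)
  then have "closedin Y (p ` topspace (subtopology X S))"
    by (simp add: proper_map_def closed_map_def del: topspace_subtopology)
  then show ?thesis using S by (simp add: Int_absorb1)
qed

text \<open>For compact K in Y, the preimage under p within S is closed in the compact preimage of
  q(K) under \<open>q \<circ> p\<close>. For compact K in Z, the points of p(S) over K are the
  p-image of the points of S over K.\<close>

lemma proper_continuous_map_compose_left:
  assumes Y: "Hausdorff_space Y" and p: "continuous_map X Y p" and q: "continuous_map Y Z q"
    and S: "closedin X S" and qp: "proper_continuous_map (subtopology X S) Z (q \<circ> p)"
  shows "proper_continuous_map (subtopology X S) Y p"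
    and "proper_continuous_map (subtopology Y (p ` S)) Z q"
proof -
  have pre: "compactin X {x \<in> topspace X. x \<in> S \<and> q (p x) \<in> K}" if "compactin Z K" for K
    using qp that unfolding proper_continuous_map_subtopology_iff by simp
  show "proper_continuous_map (subtopology X S) Y p"
    unfolding proper_continuous_map_subtopology_iff
  proof (intro conjI allI impI)
    show "continuous_map (subtopology X S) Y p"
      using p by (rule continuous_map_from_subtopology)
    fix K assume K: "compactin Y K"
    then have "closedin X {x \<in> topspace X. p x \<in> K}"
      using Y compactin_imp_closedin closedin_continuous_map_preimage[OF p] by blast
    from closed_Int_compactin[OF this pre[OF image_compactin[OF K q]]]
    have "compactin X ({x \<in> topspace X. p x \<in> K} \<inter> {x \<in> topspace X. x \<in> S \<and> q (p x) \<in> q ` K})" .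
    also have "{x \<in> topspace X. p x \<in> K} \<inter> {x \<in> topspace X. x \<in> S \<and> q (p x) \<in> q ` K} =
        {x \<in> topspace X. x \<in> S \<and> p x \<in> K}"
      by auto
    finally show "compactin X {x \<in> topspace X. x \<in> S \<and> p x \<in> K}" .
  qed
  show "proper_continuous_map (subtopology Y (p ` S)) Z q"
    unfolding proper_continuous_map_subtopology_iff
  proof (intro conjI allI impI)
    show "continuous_map (subtopology Y (p ` S)) Z q"
      using q by (rule continuous_map_from_subtopology)
    fix K assume "compactin Z K"
    from image_compactin[OF pre[OF this] p]
    have "compactin Y (p ` {x \<in> topspace X. x \<in> S \<and> q (p x) \<in> K})" .
    also have "p ` {x \<in> topspace X. x \<in> S \<and> q (p x) \<in> K} = {y \<in> topspace Y. y \<in> p ` S \<and> q y \<in> K}"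
      using closedin_subset[OF S] continuous_map_funspace[OF p] by auto
    finally show "compactin Y {y \<in> topspace Y. y \<in> p ` S \<and> q y \<in> K}" .
  qed
qed

context locally_compact_Hausdorff begin

text \<open>Multiply \<open>\<alpha> \<circ> p\<close> by a cutoff that is 1 on the compact set of
  points of S over K. As L depends on K only, one constant bounds the measure on all lifts of
  functions vanishing off K, which makes the pushforward a Radon measure.\<close>

lemma proper_lift_cutoff:
  assumes p: "continuous_map X Y p" and proper: "proper_continuous_map (subtopology X S) Y p"
    and K: "compactin Y K" and Y: "Hausdorff_space Y"
  shows "\<exists>L. compactin X L \<and> (\<forall>\<alpha>\<in>Cc Y. (\<forall>y. y \<notin> K \<longrightarrow> \<alpha> y = 0) \<longrightarrow>
    (\<exists>\<beta>\<in>Cc X. (\<forall>x. x \<notin> L \<longrightarrow> \<beta> x = 0) \<and> (\<forall>x\<in>topspace X \<inter> S. \<beta> x = \<alpha> (p x)) \<and>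
       (\<forall>x. norm (\<beta> x) \<le> norm (\<alpha> (p x)))))"
proof -
  have "compactin X {x \<in> topspace X. x \<in> S \<and> p x \<in> K}"
    using proper K unfolding proper_continuous_map_subtopology_iff by blast
  from Urysohn_cutoff[OF this openin_topspace] obtain u L where u:
      "(\<lambda>x. of_real (u x)) \<in> Cc X" "\<forall>x. 0 \<le> u x \<and> u x \<le> (1::real)"
      "\<forall>x\<in>{x \<in> topspace X. x \<in> S \<and> p x \<in> K}. u x = 1"
      and L: "compactin X L" "\<forall>x. x \<notin> L \<longrightarrow> u x = 0"
    by auto
  have "\<exists>\<beta>\<in>Cc X. (\<forall>x. x \<notin> L \<longrightarrow> \<beta> x = 0) \<and> (\<forall>x\<in>topspace X \<inter> S. \<beta> x = \<alpha> (p x)) \<and>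
       (\<forall>x. norm (\<beta> x) \<le> norm (\<alpha> (p x)))"
    if \<alpha>: "\<alpha> \<in> Cc Y" "\<forall>y. y \<notin> K \<longrightarrow> \<alpha> y = 0" for \<alpha>
  proof (intro bexI conjI)
    let ?\<beta> = "\<lambda>x. \<alpha> (p x) * complex_of_real (u x)"
    show "?\<beta> \<in> Cc X"
      using continuous_map_compose[OF p Cc_continuous[OF \<alpha>(1)]] by (intro Cc_mult u) (simp add: o_def)
    show "\<forall>x\<in>topspace X \<inter> S. ?\<beta> x = \<alpha> (p x)"
      using u(3) \<alpha>(2) by (metis (mono_tags, lifting) IntE mem_Collect_eq mult.right_neutral mult_zero_left of_real_1)
    show "\<forall>x. norm (?\<beta> x) \<le> norm (\<alpha> (p x))"
      using u(2) by (auto simp: norm_mult mult_left_le)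
  qed (use L in auto)
  then show ?thesis using L(1) by blast
qed

end

lemma pushable_measuresD:
  assumes "\<mu> \<in> pushable_measures X Y p"
  shows "\<mu> \<in> radon_measures X" "continuous_map X Y p"
    "proper_continuous_map (subtopology X (measure_support X \<mu>)) Y p"
  using assms by (auto simp: pushable_measures_def)

locale proper_pushforward =
  X: locally_compact_Hausdorff X + Y: locally_compact_Hausdorff Y
  for X :: "'a topology" and Y :: "'b topology" +
  fixes p :: "'a \<Rightarrow> 'b" and \<mu> :: "('a \<Rightarrow> complex) \<Rightarrow> complex"
  assumes pushable: "\<mu> \<in> pushable_measures X Y p"
begin

lemmas pushableD = pushable_measuresD[OF pushable]

lemma lift_exists:
  assumes "\<alpha> \<in> Cc Y"
  shows "\<exists>\<beta>\<in>Cc X. \<forall>x\<in>measure_support X \<mu>. \<beta> x = \<alpha> (p x)"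
proof -
  have "\<forall>y. y \<notin> fun_support Y \<alpha> \<longrightarrow> \<alpha> y = 0" using Cc_outside_support[OF assms] by blast
  then obtain \<beta> where "\<beta> \<in> Cc X" "\<forall>x\<in>topspace X \<inter> measure_support X \<mu>. \<beta> x = \<alpha> (p x)"
    using X.proper_lift_cutoff[OF pushableD(2,3) Cc_compact_support[OF assms] Y.Haus] assms by blast
  then show ?thesis using measure_support_subset_topspace[of X \<mu>] by blast
qed

text \<open>Two lifts agree on the support of \<mu>, so \<open>radon_cong_support\<close> makes the
  \<open>SOME\<close> in the definition harmless.\<close>

lemma pushforward_eq:
  assumes \<alpha>: "\<alpha> \<in> Cc Y" and \<beta>: "\<beta> \<in> Cc X" "\<forall>x\<in>measure_support X \<mu>. \<beta> x = \<alpha> (p x)"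
  shows "pushforward X Y p \<mu> \<alpha> = \<mu> \<beta>"
proof -
  let ?P = "\<lambda>\<beta>. \<beta> \<in> Cc X \<and> (\<forall>x\<in>measure_support X \<mu>. \<beta> x = \<alpha> (p x))"
  have P: "?P (SOME \<beta>. ?P \<beta>)"
    by (rule someI[of ?P \<beta>]) (simp add: \<beta>)
  have "pushforward X Y p \<mu> \<alpha> = \<mu> (SOME \<beta>. ?P \<beta>)"
    using \<alpha> by (simp add: pushforward_def)
  also have "\<dots> = \<mu> \<beta>"
    by (rule X.radon_cong_support[OF pushableD(1) conjunct1[OF P] \<beta>(1)]) (simp add: P \<beta>(2))
  finally show ?thesis .
qed

lemma pushforward_radon: "pushforward X Y p \<mu> \<in> radon_measures Y"
proof -
  let ?\<nu> = "pushforward X Y p \<mu>"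
  have "?\<nu> (\<lambda>y. f y + g y) = ?\<nu> f + ?\<nu> g" if f: "f \<in> Cc Y" and g: "g \<in> Cc Y" for f g
  proof -
    obtain f' where f': "f' \<in> Cc X" "\<forall>x\<in>measure_support X \<mu>. f' x = f (p x)"
      using lift_exists[OF f] by blast
    obtain g' where g': "g' \<in> Cc X" "\<forall>x\<in>measure_support X \<mu>. g' x = g (p x)"
      using lift_exists[OF g] by blast
    show ?thesis
      using pushforward_eq[OF f f'] pushforward_eq[OF g g'] radon_add[OF pushableD(1) f'(1) g'(1)]
        pushforward_eq[OF Y.Cc_add[OF f g] X.Cc_add[OF f'(1) g'(1)]] f'(2) g'(2) by simp
  qed
  moreover have "?\<nu> (\<lambda>y. c * f y) = c * ?\<nu> f" if f: "f \<in> Cc Y" for c f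
  proof -
    obtain f' where f': "f' \<in> Cc X" "\<forall>x\<in>measure_support X \<mu>. f' x = f (p x)"
      using lift_exists[OF f] by blast
    show ?thesis
      using pushforward_eq[OF f f'] radon_scale[OF pushableD(1) f'(1)]
        pushforward_eq[OF Y.Cc_scale[OF f] X.Cc_scale[OF f'(1)]] f'(2) by simp
  qed
  moreover have "\<exists>C. \<forall>f\<in>Cc Y. fun_support Y f \<subseteq> K \<longrightarrow> norm (?\<nu> f) \<le> C * sup_norm f" if K: "compactin Y K" for K
  proof -
    obtain L where L: "compactin X L" "\<And>\<alpha>. \<alpha>\<in>Cc Y \<Longrightarrow> \<forall>y. y \<notin> K \<longrightarrow> \<alpha> y = 0 \<Longrightarrow>
        \<exists>\<beta>\<in>Cc X. (\<forall>x. x \<notin> L \<longrightarrow> \<beta> x = 0) \<and> (\<forall>x\<in>topspace X \<inter> measure_support X \<mu>. \<beta> x = \<alpha> (p x)) \<and>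
          (\<forall>x. norm (\<beta> x) \<le> norm (\<alpha> (p x)))"
      using X.proper_lift_cutoff[OF pushableD(2,3) K Y.Haus] by metis
    obtain C where C: "C \<ge> 0" "\<forall>f B. f \<in> Cc X \<longrightarrow> (\<forall>x. x \<notin> L \<longrightarrow> f x = 0) \<longrightarrow>
        (\<forall>x. norm (f x) \<le> B) \<longrightarrow> norm (\<mu> f) \<le> C * B"
      using X.radon_bound[OF pushableD(1) L(1)] by blast
    have "norm (?\<nu> f) \<le> C * sup_norm f" if f: "f \<in> Cc Y" "fun_support Y f \<subseteq> K" for f
    proof -
      have "\<forall>y. y \<notin> K \<longrightarrow> f y = 0" using f Cc_outside_support[OF f(1)] by blast
      from L(2)[OF f(1) this] obtain \<beta> where \<beta>: "\<beta> \<in> Cc X" "\<forall>x. x \<notin> L \<longrightarrow> \<beta> x = 0"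
          "\<forall>x\<in>topspace X \<inter> measure_support X \<mu>. \<beta> x = f (p x)" "\<forall>x. norm (\<beta> x) \<le> norm (f (p x))"
        by blast
      have "?\<nu> f = \<mu> \<beta>"
        using \<beta>(3) measure_support_subset_topspace[of X \<mu>] by (intro pushforward_eq f \<beta>(1)) auto
      moreover have "\<forall>x. norm (\<beta> x) \<le> sup_norm f"
        using \<beta>(4) norm_le_sup_norm[OF f(1)] order_trans by blast
      ultimately show ?thesis using C(2) \<beta>(1,2) by simp
    qed
    then show ?thesis by blast
  qed
  moreover have "?\<nu> \<in> extensional (Cc Y)" by (simp add: pushforward_def)
  ultimately show ?thesis unfolding radon_measures_def by blast
qed

text \<open>A function that vanishes on the closed set p(supp \<mu>) has the lift 0. The inclusion
  can be strict, since masses may cancel under p.\<close>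

lemma measure_support_pushforward:
  "measure_support Y (pushforward X Y p \<mu>) \<subseteq> p ` measure_support X \<mu>"
proof (rule measure_support_subset)
  show "closedin Y (p ` measure_support X \<mu>)"
    by (rule proper_continuous_map_closed_image[OF Y.locally_compact_Hausdorff_axioms pushableD(3)
          measure_support_subset_topspace])
  fix f assume f: "f \<in> Cc Y" "\<And>y. y \<in> p ` measure_support X \<mu> \<Longrightarrow> f y = 0"
  have "pushforward X Y p \<mu> f = \<mu> (\<lambda>x. 0)"
    by (rule pushforward_eq[OF f(1) X.Cc_zero]) (simp add: f(2))
  then show "pushforward X Y p \<mu> f = 0"
    by (simp add: X.radon_zero[OF pushableD(1)])
qed

end

lemma pushforward_compose:
  assumes X: "locally_compact_Hausdorff X" and Y: "locally_compact_Hausdorff Y"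
    and Z: "locally_compact_Hausdorff Z"
    and p: "continuous_map X Y p" and q: "continuous_map Y Z q"
    and \<mu>: "\<mu> \<in> pushable_measures X Z (q \<circ> p)"
  shows "\<mu> \<in> pushable_measures X Y p"
    and "pushforward X Y p \<mu> \<in> pushable_measures Y Z q"
    and "pushforward X Z (q \<circ> p) \<mu> = pushforward Y Z q (pushforward X Y p \<mu>)"
proof -
  interpret XZ: proper_pushforward X Z "q \<circ> p" \<mu>
    using X Z \<mu> by (simp add: proper_pushforward_def proper_pushforward_axioms_def)
  interpret Y: locally_compact_Hausdorff Y by fact
  note proper = proper_continuous_map_compose_left[OF Y.Haus p q closedin_measure_support XZ.pushableD(3)]
  show pushX: "\<mu> \<in> pushable_measures X Y p"
    using XZ.pushableD(1) p proper(1) by (simp add: pushable_measures_def)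
  interpret XY: proper_pushforward X Y p \<mu>
    using X Y pushX by (simp add: proper_pushforward_def proper_pushforward_axioms_def)
  show pushY: "pushforward X Y p \<mu> \<in> pushable_measures Y Z q"
    unfolding pushable_measures_def
    using XY.pushforward_radon q proper_continuous_map_closed_subset[OF proper(2)
        closedin_measure_support XY.measure_support_pushforward] by simp
  interpret YZ: proper_pushforward Y Z q "pushforward X Y p \<mu>"
    using Y Z pushY by (simp add: proper_pushforward_def proper_pushforward_axioms_def)
  show "pushforward X Z (q \<circ> p) \<mu> = pushforward Y Z q (pushforward X Y p \<mu>)"
  proof
    fix \<alpha>
    show "pushforward X Z (q \<circ> p) \<mu> \<alpha> = pushforward Y Z q (pushforward X Y p \<mu>) \<alpha>"
    proof (cases "\<alpha> \<in> Cc Z")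
      case \<alpha>: True
      have "\<forall>z. z \<notin> fun_support Z \<alpha> \<longrightarrow> \<alpha> z = 0" using Cc_outside_support[OF \<alpha>] by blast
      \<comment> \<open>The lift is taken on all of p(supp \<mu>), not only on the possibly smaller
        support of the pushforward. Hence a lift of \<beta> along p is at the same time a lift of
        \<alpha> along \<open>q \<circ> p\<close>.\<close>
      then obtain \<beta> where \<beta>: "\<beta> \<in> Cc Y" "\<forall>y\<in>topspace Y \<inter> p ` measure_support X \<mu>. \<beta> y = \<alpha> (q y)"
        using Y.proper_lift_cutoff[OF q proper(2) Cc_compact_support[OF \<alpha>] XZ.Y.Haus] \<alpha> by blast
      have \<beta>': "\<beta> (p x) = \<alpha> (q (p x))" if "x \<in> measure_support X \<mu>" for x
        using \<beta>(2) that measure_support_subset_topspace[of X \<mu>] continuous_map_funspace[OF p] by blast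
      obtain \<gamma> where \<gamma>: "\<gamma> \<in> Cc X" "\<forall>x\<in>measure_support X \<mu>. \<gamma> x = \<beta> (p x)"
        using XY.lift_exists[OF \<beta>(1)] by blast
      have "pushforward X Z (q \<circ> p) \<mu> \<alpha> = \<mu> \<gamma>"
        using \<gamma> \<beta>' by (intro XZ.pushforward_eq \<alpha>) auto
      also have "\<dots> = pushforward X Y p \<mu> \<beta>"
        using XY.pushforward_eq[OF \<beta>(1) \<gamma>] by simp
      also have "\<dots> = pushforward Y Z q (pushforward X Y p \<mu>) \<alpha>"
        using \<beta>' XY.measure_support_pushforward
        by (intro YZ.pushforward_eq[OF \<alpha> \<beta>(1), symmetric]) auto
      finally show ?thesis .
    qed (simp add: pushforward_def)
  qed
qed

section \<open>Coset spaces\<close>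

context group begin

lemma coset_proj_eq_iff:
  assumes "subgroup H G" "x \<in> carrier G" "y \<in> carrier G"
  shows "coset_proj G H x = coset_proj G H y \<longleftrightarrow> inv x \<otimes> y \<in> H"
proof -
  interpret H: subgroup H G by fact
  show ?thesis
  proof
    assume "coset_proj G H x = coset_proj G H y"
    moreover have "y \<otimes> \<one> \<in> coset_proj G H y"
      unfolding coset_proj_def l_coset_def using H.one_closed by blast
    ultimately have "y \<in> coset_proj G H x"
      using assms(3) by simp
    then obtain h where "h \<in> H" "y = x \<otimes> h"
      by (auto simp: coset_proj_def l_coset_def)
    then show "inv x \<otimes> y \<in> H"
      using assms by (simp flip: m_assoc)
  next
    assume h: "inv x \<otimes> y \<in> H"
    have "coset_proj G H y = x <# ((inv x \<otimes> y) <# H)"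
      using assms h H.subset by (simp add: coset_proj_def lcos_m_assoc) (simp flip: m_assoc)
    also have "(inv x \<otimes> y) <# H = H"
      using h coset_join3[OF _ assms(1)] by simp
    finally show "coset_proj G H x = coset_proj G H y"
      by (simp add: coset_proj_def)
  qed
qed

lemma coset_proj_mult_right:
  assumes "subgroup H G" "x \<in> carrier G" "h \<in> H"
  shows "coset_proj G H (x \<otimes> h) = coset_proj G H x"
proof -
  interpret H: subgroup H G by fact
  have "coset_proj G H x = coset_proj G H (x \<otimes> h)"
    using assms by (subst coset_proj_eq_iff) (auto simp flip: m_assoc)
  then show ?thesis by simp
qed

lemma coset_proj_normal_mult:
  assumes "N \<lhd> G" "x \<in> carrier G" "y \<in> carrier G"
  shows "coset_proj G N x \<otimes>\<^bsub>G Mod N\<^esub> coset_proj G N y = coset_proj G N (x \<otimes> y)"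
proof -
  interpret N: normal N G by fact
  show ?thesis
    using N.rcos_sum[OF assms(2,3)] N.coset_eq assms by (simp add: coset_proj_def FactGroup_def)
qed

lemma carrier_Mod_normal: "N \<lhd> G \<Longrightarrow> carrier (G Mod N) = coset_proj G N ` carrier G"
  using normal.coset_eq[of N G] by (auto simp: coset_proj_def carrier_FactGroup)

lemma coset_proj_normal_hom:
  assumes "N \<lhd> G" shows "group_hom G (G Mod N) (coset_proj G N)"
proof -
  have "coset_proj G N \<in> hom G (G Mod N)"
    using carrier_Mod_normal[OF assms] coset_proj_normal_mult[OF assms] by (auto simp: hom_def)
  then show ?thesis
    using normal.factorgroup_is_group[OF assms] is_group by (simp add: group_hom_def group_hom_axioms_def)
qed

text \<open>A coset of H/N in G/N is a set of cosets of N, and these partition a coset of H. Thus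
  \<open>Union\<close> is an explicit inverse of \<open>quotient_coset_map\<close>.\<close>

lemma Union_coset_proj_quotient:
  assumes "N \<lhd> G" "subgroup H G" "N \<subseteq> H" "g \<in> carrier G"
  shows "\<Union>(coset_proj (G Mod N) (quotient_subgroup G N H) (coset_proj G N g)) = coset_proj G H g"
proof -
  interpret H: subgroup H G by fact
  interpret N: normal N G by fact
  have "\<Union>(coset_proj G N ` coset_proj G H g) = coset_proj G H g"
  proof
    show "\<Union>(coset_proj G N ` coset_proj G H g) \<subseteq> coset_proj G H g"
    proof
      fix x assume "x \<in> \<Union>(coset_proj G N ` coset_proj G H g)"
      then obtain h n where hn: "h \<in> H" "n \<in> N" "x = g \<otimes> h \<otimes> n"
        by (auto simp: coset_proj_def l_coset_def)
      then have "x = g \<otimes> (h \<otimes> n)" "h \<otimes> n \<in> H"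
        using assms by (auto simp: m_assoc)
      then show "x \<in> coset_proj G H g" by (auto simp: coset_proj_def l_coset_def)
    qed
    show "coset_proj G H g \<subseteq> \<Union>(coset_proj G N ` coset_proj G H g)"
    proof
      fix x assume x: "x \<in> coset_proj G H g"
      then have "x \<in> carrier G" using assms by (auto simp: coset_proj_def l_coset_def)
      then have "x \<otimes> \<one> = x" by simp
      then have "x \<in> coset_proj G N x"
        unfolding coset_proj_def l_coset_def using N.one_closed by blast
      then show "x \<in> \<Union>(coset_proj G N ` coset_proj G H g)" using x by blast
    qed
  qed
  then show ?thesis
    using quotient_coset_map_coset_proj[OF assms(1,2,4)] by (simp add: quotient_coset_map_def)
qed

end

section \<open>Topology of coset spaces and quotient groups\<close>

context locally_compact_group begin

sublocale locally_compact_Hausdorff T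
  by unfold_locales (rule locally_compact, rule Hausdorff)

lemma continuous_map_group_mult:
  assumes "continuous_map X T f" "continuous_map X T h"
  shows "continuous_map X T (\<lambda>x. f x \<otimes> h x)"
  using continuous_map_compose[OF continuous_map_pairedI[OF assms] continuous_mult]
  by (simp add: o_def)

lemma continuous_map_group_inv:
  assumes "continuous_map X T f"
  shows "continuous_map X T (\<lambda>x. inv (f x))"
  using continuous_map_compose[OF assms continuous_inv] by (simp add: o_def)

lemma continuous_map_left_mult: "g \<in> carrier G \<Longrightarrow> continuous_map T T (\<lambda>x. g \<otimes> x)"
  and continuous_map_right_mult: "g \<in> carrier G \<Longrightarrow> continuous_map T T (\<lambda>x. x \<otimes> g)"
  by (auto intro!: continuous_map_group_mult simp: topspace_eq)

lemma topspace_coset_space: "topspace (coset_space G T H) = coset_proj G H ` carrier G"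
  by (simp add: coset_space_def topspace_eq)

lemma quotient_map_coset_proj: "quotient_map T (coset_space G T H) (coset_proj G H)"
  unfolding coset_space_def by (rule quotient_map_quotient_topology)

lemma continuous_map_coset_proj: "continuous_map T (coset_space G T H) (coset_proj G H)"
  by (rule quotient_imp_continuous_map[OF quotient_map_coset_proj])

text \<open>The preimage of the image of an open set U is a union of right translates of U by
  elements of H.\<close>

lemma open_map_coset_proj:
  assumes "subgroup H G" shows "open_map T (coset_space G T H) (coset_proj G H)"
  unfolding open_map_def
proof (intro allI impI)
  interpret H: subgroup H G by fact
  fix U assume U: "openin T U"
  then have Uc: "U \<subseteq> carrier G" using openin_subset topspace_eq by blast
  have "{x \<in> topspace T. coset_proj G H x \<in> coset_proj G H ` U} = (\<Union>h\<in>H. {x \<in> topspace T. x \<otimes> h \<in> U})"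
  proof (intro equalityI subsetI)
    fix x assume "x \<in> {x \<in> topspace T. coset_proj G H x \<in> coset_proj G H ` U}"
    then obtain u where u: "x \<in> carrier G" "u \<in> U" "coset_proj G H x = coset_proj G H u"
      by (auto simp: topspace_eq)
    then have "inv x \<otimes> u \<in> H" using coset_proj_eq_iff[OF assms] Uc by blast
    moreover have "x \<otimes> (inv x \<otimes> u) = u" using u Uc by (auto simp flip: m_assoc)
    ultimately show "x \<in> (\<Union>h\<in>H. {x \<in> topspace T. x \<otimes> h \<in> U})"
      using u by (auto simp: topspace_eq intro!: bexI[of _ "inv x \<otimes> u"])
  next
    fix x assume "x \<in> (\<Union>h\<in>H. {x \<in> topspace T. x \<otimes> h \<in> U})"
    then obtain h where "h \<in> H" "x \<in> carrier G" "x \<otimes> h \<in> U" by (auto simp: topspace_eq)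
    then show "x \<in> {x \<in> topspace T. coset_proj G H x \<in> coset_proj G H ` U}"
      using coset_proj_mult_right[OF assms, of x h] by (auto simp: topspace_eq intro!: image_eqI[of _ _ "x \<otimes> h"])
  qed
  moreover have "openin T {x \<in> topspace T. x \<otimes> h \<in> U}" if "h \<in> H" for h
    by (rule openin_continuous_map_preimage[OF continuous_map_right_mult[OF H.mem_carrier[OF that]] U])
  ultimately have "openin T {x \<in> topspace T. coset_proj G H x \<in> coset_proj G H ` U}"
    by (auto intro!: openin_Union)
  then show "openin (coset_space G T H) (coset_proj G H ` U)"
    unfolding coset_space_def openin_quotient_topology using Uc by (auto simp: topspace_eq)
qed

text \<open>As H is closed, the pairs with \<open>inv x \<otimes> y\<close> outside H form an open
  subset of the product. A box in it around (x, y) has sides whose images are disjoint, and they are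
  open because the projection is an open map.\<close>

lemma Hausdorff_coset_space:
  assumes "closed_subgroup H G T" shows "Hausdorff_space (coset_space G T H)"
  unfolding Hausdorff_space_def
proof (intro allI impI)
  fix a b assume "a \<in> topspace (coset_space G T H) \<and> b \<in> topspace (coset_space G T H) \<and> a \<noteq> b"
  then obtain x y where xy: "x \<in> carrier G" "y \<in> carrier G" "a = coset_proj G H x" "b = coset_proj G H y" "a \<noteq> b"
    by (auto simp: topspace_coset_space)
  have H: "subgroup H G" "closedin T H" using assms by (auto simp: closed_subgroup_def)
  let ?f = "\<lambda>z. inv (fst z) \<otimes> snd z"
  have "continuous_map (prod_topology T T) T ?f"
    by (intro continuous_map_group_mult continuous_map_group_inv continuous_map_fst continuous_map_snd)
  then have W: "openin (prod_topology T T) {z \<in> topspace (prod_topology T T). ?f z \<in> topspace T - H}"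
    by (rule openin_continuous_map_preimage) (use H in auto)
  have xyW: "(x, y) \<in> {z \<in> topspace (prod_topology T T). ?f z \<in> topspace T - H}"
    using xy coset_proj_eq_iff[OF H(1)] by (auto simp: topspace_eq)
  from W[unfolded openin_prod_topology_alt, rule_format, OF xyW]
  obtain U V where UV: "openin T U" "openin T V" "x \<in> U" "y \<in> V"
      "U \<times> V \<subseteq> {z \<in> topspace (prod_topology T T). ?f z \<in> topspace T - H}"
    by (elim exE conjE) (rule that)
  have "disjnt (coset_proj G H ` U) (coset_proj G H ` V)"
  proof -
    have "coset_proj G H u \<noteq> coset_proj G H v" if "u \<in> U" "v \<in> V" for u v
    proof -
      have "(u, v) \<in> {z \<in> topspace (prod_topology T T). ?f z \<in> topspace T - H}"
        using UV(5) that by blast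
      then show ?thesis using coset_proj_eq_iff[OF H(1), of u v] by (simp add: topspace_eq)
    qed
    then show ?thesis by (auto simp: disjnt_iff)
  qed
  then show "\<exists>U V. openin (coset_space G T H) U \<and> openin (coset_space G T H) V \<and> a \<in> U \<and> b \<in> V \<and> disjnt U V"
    using UV xy open_map_coset_proj[OF H(1)] unfolding open_map_def by blast
qed

lemma locally_compact_Hausdorff_coset_space:
  assumes "closed_subgroup H G T" shows "locally_compact_Hausdorff (coset_space G T H)"
proof
  show "locally_compact_space (coset_space G T H)"
    by (rule locally_compact_space_continuous_open_map_image[OF continuous_map_coset_proj open_map_coset_proj])
      (use assms in \<open>auto simp: closed_subgroup_def topspace_coset_space topspace_eq locally_compact\<close>)
qed (rule Hausdorff_coset_space[OF assms])

lemma continuous_map_coset_map: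
  assumes "subgroup N G" "subgroup H G" "N \<subseteq> H"
  shows "continuous_map (coset_space G T N) (coset_space G T H) (coset_map G H)"
proof (rule continuous_compose_quotient_map[OF quotient_map_coset_proj])
  show "continuous_map T (coset_space G T H) (coset_map G H \<circ> coset_proj G N)"
    by (rule continuous_map_eq[OF continuous_map_coset_proj])
      (simp add: coset_map_coset_proj[OF assms] topspace_eq)
qed

lemma locally_compact_group_quotient:
  assumes N: "N \<lhd> G" and closed: "closed_subgroup N G T"
  shows "locally_compact_group (G Mod N) (coset_space G T N)"
proof -
  let ?Q = "coset_space G T N" and ?p = "coset_proj G N"
  interpret Q: group "G Mod N" by (rule normal.factorgroup_is_group[OF N])
  interpret p: group_hom G "G Mod N" ?p by (rule coset_proj_normal_hom[OF N])
  interpret QL: locally_compact_Hausdorff ?Q by (rule locally_compact_Hausdorff_coset_space[OF closed])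
  have cont: "continuous_map T ?Q ?p" by (rule continuous_map_coset_proj)
  \<comment> \<open>A product of quotient maps need not be a quotient map in general. Here p is
    applied to one coordinate at a time, while the other factor is locally compact
    Hausdorff.\<close>
  have quot: "quotient_map (prod_topology T T) (prod_topology ?Q ?Q)
      ((\<lambda>(x, y). (x, ?p y)) \<circ> (\<lambda>(x, y). (?p x, y)))"
    by (rule quotient_map_compose[OF quotient_map_prod_left quotient_map_prod_right])
      (simp_all add: lc Haus QL.lc QL.Haus quotient_map_coset_proj)
  show ?thesis
  proof
    show "topspace ?Q = carrier (G Mod N)"
      by (rule topspace_coset_space_normal[OF N])
    show "continuous_map (prod_topology ?Q ?Q) ?Q (\<lambda>(x, y). x \<otimes>\<^bsub>G Mod N\<^esub> y)"
    proof (rule continuous_compose_quotient_map[OF quot])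
      have "continuous_map (prod_topology T T) ?Q (\<lambda>z. ?p (fst z \<otimes> snd z))"
        using continuous_map_compose[OF continuous_mult cont] by (simp add: o_def case_prod_unfold)
      then show "continuous_map (prod_topology T T) ?Q
          ((\<lambda>(x, y). x \<otimes>\<^bsub>G Mod N\<^esub> y) \<circ> ((\<lambda>(x, y). (x, ?p y)) \<circ> (\<lambda>(x, y). (?p x, y))))"
        by (rule continuous_map_eq) (auto simp: topspace_eq)
    qed
    show "continuous_map ?Q ?Q (\<lambda>x. inv\<^bsub>G Mod N\<^esub> x)"
    proof (rule continuous_compose_quotient_map[OF quotient_map_coset_proj])
      show "continuous_map T ?Q ((\<lambda>x. inv\<^bsub>G Mod N\<^esub> x) \<circ> ?p)"
        by (rule continuous_map_eq[OF continuous_map_compose[OF continuous_inv cont]])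
          (simp add: topspace_eq)
    qed
  qed (rule QL.lc, rule QL.Haus)
qed

lemma closed_subgroup_quotient:
  assumes N: "N \<lhd> G" and H: "closed_subgroup H G T" and NH: "N \<subseteq> H"
  shows "closed_subgroup (quotient_subgroup G N H) (G Mod N) (coset_space G T N)"
  unfolding closed_subgroup_def
proof
  interpret p: group_hom G "G Mod N" "coset_proj G N" by (rule coset_proj_normal_hom[OF N])
  have sub: "subgroup H G" "closedin T H" using H by (auto simp: closed_subgroup_def)
  interpret H: subgroup H G by fact
  have N': "subgroup N G" using N by (simp add: normal_imp_subgroup)
  show "subgroup (quotient_subgroup G N H) (G Mod N)"
    unfolding quotient_subgroup_def by (rule p.subgroup_img_is_subgroup[OF sub(1)])
  \<comment> \<open>H is a union of cosets of N because N lies in H; closedness in the quotient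
    topology is then closedness of H in G.\<close>
  have preimage: "{x \<in> topspace T. coset_proj G N x \<in> quotient_subgroup G N H} = H"
  proof (intro equalityI subsetI)
    fix x assume "x \<in> {x \<in> topspace T. coset_proj G N x \<in> quotient_subgroup G N H}"
    then obtain h where h: "x \<in> carrier G" "h \<in> H" "coset_proj G N h = coset_proj G N x"
      by (auto simp: topspace_eq quotient_subgroup_def)
    then have hc: "h \<in> carrier G" by simp
    have "inv h \<otimes> x \<in> H"
      using coset_proj_eq_iff[OF N' hc h(1)] h(3) NH by auto
    then have "h \<otimes> (inv h \<otimes> x) \<in> H" by (rule H.m_closed[OF h(2)])
    then show "x \<in> H" using h(1) hc by (simp flip: m_assoc)
  qed (auto simp: topspace_eq quotient_subgroup_def)
  have "quotient_subgroup G N H \<subseteq> topspace (coset_space G T N)"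
    by (auto simp: topspace_coset_space quotient_subgroup_def)
  from quotient_map_coset_proj[of N, unfolded quotient_map_closedin, THEN conjunct2, rule_format, OF this]
  show "closedin (coset_space G T N) (quotient_subgroup G N H)"
    using sub(2) preimage by simp
qed

lemma locally_compact_group_subgroup:
  assumes "closed_subgroup N G T"
  shows "locally_compact_group (G\<lparr>carrier := N\<rparr>) (subtopology T N)"
proof -
  have N: "subgroup N G" "closedin T N" using assms by (auto simp: closed_subgroup_def)
  interpret N: subgroup N G by fact
  interpret NG: group "G\<lparr>carrier := N\<rparr>" by (rule subgroup_imp_group[OF N(1)])
  have Nt: "N \<subseteq> topspace T" using N(2) closedin_subset by blast
  have inclusion: "continuous_map (subtopology T N) T (\<lambda>x. x)"
    by (rule continuous_map_from_subtopology) simp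
  show ?thesis
  proof
    show "topspace (subtopology T N) = carrier (G\<lparr>carrier := N\<rparr>)" using Nt by auto
    have "continuous_map (prod_topology (subtopology T N) (subtopology T N)) T (\<lambda>z. fst z \<otimes> snd z)"
      by (intro continuous_map_group_mult continuous_map_of_fst[THEN iffD2] continuous_map_of_snd[THEN iffD2]
         disjI2 continuous_map_compose[OF continuous_map_fst inclusion, unfolded o_def]
         continuous_map_compose[OF continuous_map_snd inclusion, unfolded o_def])
    then show "continuous_map (prod_topology (subtopology T N) (subtopology T N)) (subtopology T N)
        (\<lambda>(x, y). x \<otimes>\<^bsub>G\<lparr>carrier := N\<rparr>\<^esub> y)"
      by (auto simp: continuous_map_in_subtopology case_prod_unfold)
    have "continuous_map (subtopology T N) (subtopology T N) (\<lambda>x. inv x)"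
      using continuous_map_group_inv[OF inclusion] by (auto simp: continuous_map_in_subtopology)
    then show "continuous_map (subtopology T N) (subtopology T N) (\<lambda>x. inv\<^bsub>G\<lparr>carrier := N\<rparr>\<^esub> x)"
      by (rule continuous_map_eq) (use m_inv_consistent[OF N(1)] in auto)
  qed (rule locally_compact_space_closed_subset[OF lc N(2)], rule Hausdorff_space_subtopology[OF Haus])
qed

text \<open>Both spaces carry the quotient topology of a projection from G, and the two maps
  intertwine these projections. Continuity in either direction can therefore be tested on G.\<close>

lemma homeomorphic_maps_quotient_coset_map:
  assumes N: "N \<lhd> G" and H: "subgroup H G" and NH: "N \<subseteq> H"
  shows "homeomorphic_maps (coset_space G T H)
    (coset_space (G Mod N) (coset_space G T N) (quotient_subgroup G N H)) (quotient_coset_map G N) Union"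
proof -
  let ?q = "coset_proj (G Mod N) (quotient_subgroup G N H)"
  let ?Z = "coset_space (G Mod N) (coset_space G T N) (quotient_subgroup G N H)"
  have quot: "quotient_map T ?Z (?q \<circ> coset_proj G N)"
    using quotient_map_compose[OF quotient_map_coset_proj[of N]]
      quotient_map_quotient_topology[of "coset_space G T N" ?q] unfolding coset_space_def by blast
  have eq1: "quotient_coset_map G N (coset_proj G H g) = ?q (coset_proj G N g)" if "g \<in> carrier G" for g
    using quotient_coset_map_coset_proj[OF N H that] .
  have eq2: "\<Union>(?q (coset_proj G N g)) = coset_proj G H g" if "g \<in> carrier G" for g
    using Union_coset_proj_quotient[OF N H NH that] .
  have top: "topspace ?Z = (?q \<circ> coset_proj G N) ` carrier G"
    using quotient_imp_surjective_map[OF quot] by (simp add: topspace_eq)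
  show ?thesis
    unfolding homeomorphic_maps_def
  proof (intro conjI)
    show "continuous_map (coset_space G T H) ?Z (quotient_coset_map G N)"
      by (rule continuous_compose_quotient_map[OF quotient_map_coset_proj],
          rule continuous_map_eq[OF quotient_imp_continuous_map[OF quot]])
        (simp add: eq1 topspace_eq)
    show "continuous_map ?Z (coset_space G T H) Union"
      by (rule continuous_compose_quotient_map[OF quot], rule continuous_map_eq[OF continuous_map_coset_proj])
        (simp add: eq2 topspace_eq)
  qed (auto simp: topspace_coset_space top eq1 eq2)
qed

end

lemma proper_continuous_map_compose_homeomorphic:
  assumes p: "proper_continuous_map (subtopology X S) Y p" and q: "homeomorphic_maps Y Z q r"
  shows "proper_continuous_map (subtopology X S) Z (q \<circ> p)"
  unfolding proper_continuous_map_subtopology_iff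
proof (intro conjI allI impI)
  have q': "continuous_map Y Z q" "continuous_map Z Y r" "\<And>y. y \<in> topspace Y \<Longrightarrow> r (q y) = y"
      "\<And>z. z \<in> topspace Z \<Longrightarrow> q (r z) = z"
    using q by (auto simp: homeomorphic_maps_def)
  have p': "continuous_map (subtopology X S) Y p" using p by (simp add: proper_continuous_map_def)
  then show "continuous_map (subtopology X S) Z (q \<circ> p)"
    using q'(1) by (rule continuous_map_compose)
  fix K assume K: "compactin Z K"
  have "compactin X {x \<in> topspace X. x \<in> S \<and> p x \<in> r ` K}"
    using p image_compactin[OF K q'(2)] unfolding proper_continuous_map_subtopology_iff by blast
  also have "{x \<in> topspace X. x \<in> S \<and> p x \<in> r ` K} = {x \<in> topspace X. x \<in> S \<and> (q \<circ> p) x \<in> K}"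
    using compactin_subset_topspace[OF K] q'(3,4) continuous_map_funspace[OF p'] by (force simp: image_iff)
  finally show "compactin X {x \<in> topspace X. x \<in> S \<and> (q \<circ> p) x \<in> K}" .
qed

section \<open>Iterated integration and uniqueness of Haar measure\<close>

text \<open>The tube lemma turns joint continuity into continuity in x that is uniform for y in the
  compact set L.\<close>

lemma uniform_slice:
  fixes F :: "'a \<Rightarrow> 'b \<Rightarrow> complex"
  assumes F: "continuous_map (prod_topology X Y) euclidean (\<lambda>z. F (fst z) (snd z))"
    and L: "compactin Y L" and x: "x \<in> topspace X" and \<epsilon>: "0 < \<epsilon>"
  shows "\<exists>U. openin X U \<and> x \<in> U \<and> (\<forall>x'\<in>U. \<forall>y\<in>L. norm (F x' y - F x y) \<le> \<epsilon>)"
proof -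
  let ?h = "\<lambda>z. norm (F (fst z) (snd z) - F x (snd z))"
  let ?W = "{z \<in> topspace (prod_topology X Y). ?h z \<in> {..<\<epsilon>}}"
  have "continuous_map (prod_topology X Y) (prod_topology X Y) (\<lambda>z. (x, snd z))"
    by (intro continuous_map_pairedI continuous_map_snd) (simp add: x)
  from continuous_map_compose[OF this F]
  have "continuous_map (prod_topology X Y) euclidean (\<lambda>z. F x (snd z))"
    by (simp add: o_def)
  then have "continuous_map (prod_topology X Y) euclideanreal ?h"
    by (intro continuous_map_norm continuous_map_diff F)
  then have W: "openin (prod_topology X Y) ?W"
    by (rule openin_continuous_map_preimage) auto
  have "{x} \<times> L \<subseteq> ?W"
    using compactin_subset_topspace[OF L] x \<epsilon> by auto
  from tube_lemma_right[OF W L x this] obtain U V where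
    "openin X U" "x \<in> U" "L \<subseteq> V" "U \<times> V \<subseteq> ?W" by (elim exE conjE) (rule that)
  moreover have "norm (F x' y - F x y) \<le> \<epsilon>" if "x' \<in> U" "y \<in> L" for x' y
  proof -
    have "(x', y) \<in> ?W" using calculation that by blast
    then show ?thesis by simp
  qed
  ultimately show ?thesis by blast
qed

lemma (in locally_compact_Hausdorff) continuous_map_slice_Cc:
  fixes F :: "'b \<Rightarrow> 'a \<Rightarrow> complex"
  assumes F: "continuous_map (prod_topology Z X) euclidean (\<lambda>z. F (fst z) (snd z))"
    and L: "compactin X L" "\<And>y. y \<notin> L \<Longrightarrow> F x y = 0" and x: "x \<in> topspace Z"
  shows "F x \<in> Cc X"
proof (rule CcI(1)[OF _ L])
  have "continuous_map X (prod_topology Z X) (\<lambda>y. (x, y))"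
    by (intro continuous_map_pairedI) (simp_all add: x)
  from continuous_map_compose[OF this F] show "continuous_map X euclidean (F x)"
    by (simp add: o_def)
qed

lemma (in locally_compact_Hausdorff) radon_parametric_continuous:
  fixes F :: "'b \<Rightarrow> 'a \<Rightarrow> complex"
  assumes m: "m \<in> radon_measures X"
    and F: "continuous_map (prod_topology Z X) euclidean (\<lambda>z. F (fst z) (snd z))"
    and L: "compactin X L" "\<And>x y. x \<in> topspace Z \<Longrightarrow> y \<notin> L \<Longrightarrow> F x y = 0"
  shows "continuous_map Z euclidean (\<lambda>x. m (F x))"
proof (rule continuous_map_complexI)
  fix x and \<epsilon> :: real assume x: "x \<in> topspace Z" and \<epsilon>: "0 < \<epsilon>"
  obtain C where C: "C \<ge> 0" "\<forall>g B. g \<in> Cc X \<longrightarrow> (\<forall>x. x \<notin> L \<longrightarrow> g x = 0) \<longrightarrow>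
      (\<forall>x. norm (g x) \<le> B) \<longrightarrow> norm (m g) \<le> C * B"
    using radon_bound[OF m L(1)] by blast
  have slice: "F x' \<in> Cc X" if "x' \<in> topspace Z" for x'
    by (rule continuous_map_slice_Cc[OF F L(1) L(2) that]) (use that in auto)
  \<comment> \<open>The summand 1 covers the case C = 0.\<close>
  have "0 < \<epsilon> / (C + 1)" using \<epsilon> C(1) by simp
  from uniform_slice[OF F L(1) x this] obtain U where U: "openin Z U" "x \<in> U"
      "\<forall>x'\<in>U. \<forall>y\<in>L. norm (F x' y - F x y) \<le> \<epsilon> / (C + 1)" by blast
  have "norm (m (F x') - m (F x)) \<le> \<epsilon>" if x': "x' \<in> U" for x'
  proof -
    have x'Z: "x' \<in> topspace Z" using U(1) x' openin_subset by blast
    have "norm (F x' y - F x y) \<le> \<epsilon> / (C + 1)" for y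
      using U(3) x' L(2)[OF x] L(2)[OF x'Z] \<epsilon> C(1) by (cases "y \<in> L") auto
    moreover have "(\<lambda>y. F x' y - F x y) \<in> Cc X" by (intro Cc_diff slice x x'Z)
    ultimately have "norm (m (\<lambda>y. F x' y - F x y)) \<le> C * (\<epsilon> / (C + 1))"
      using L(2)[OF x] L(2)[OF x'Z] by (intro C(2)[rule_format]) auto
    also have "\<dots> \<le> \<epsilon>" using C(1) \<epsilon> by (simp add: field_simps)
    finally show ?thesis using radon_diff[OF m slice[OF x'Z] slice[OF x]] by simp
  qed
  then show "\<exists>U. openin Z U \<and> x \<in> U \<and> (\<forall>x'\<in>U. norm (m (F x') - m (F x)) \<le> \<epsilon>)"
    using U by blast
qed

locale radon_product = X: locally_compact_Hausdorff X + Y: locally_compact_Hausdorff Y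
  for X :: "'a topology" and Y :: "'b topology" +
  fixes I J and F :: "'a \<Rightarrow> 'b \<Rightarrow> complex" and K L
  assumes I: "I \<in> radon_measures X" and J: "J \<in> radon_measures Y"
    and F: "continuous_map (prod_topology X Y) euclidean (\<lambda>z. F (fst z) (snd z))"
    and K: "compactin X K" and L: "compactin Y L"
    and F0: "\<And>x y. x \<notin> K \<or> y \<notin> L \<Longrightarrow> F x y = 0"
begin

lemma slice_Y: "F x \<in> Cc Y"
proof (cases "x \<in> topspace X")
  case True
  show ?thesis by (rule Y.continuous_map_slice_Cc[OF F L _ True]) (simp add: F0)
next
  case False
  then have "x \<notin> K" using compactin_subset_topspace[OF K] by blast
  then have "F x = (\<lambda>y. 0)" using F0 by auto
  then show ?thesis using Y.Cc_zero by simp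
qed

lemma integral_Y_Cc: "(\<lambda>x. J (F x)) \<in> Cc X"
proof (rule X.CcI(1)[OF _ K])
  show "continuous_map X euclidean (\<lambda>x. J (F x))"
    by (rule Y.radon_parametric_continuous[OF J F L]) (simp add: F0)
  fix x assume "x \<notin> K"
  then have "F x = (\<lambda>y. 0)" using F0 by auto
  then show "J (F x) = 0" using Y.radon_zero[OF J] by simp
qed

lemma swap: "radon_product Y X J I (\<lambda>y x. F x y) L K"
proof
  have "continuous_map (prod_topology Y X) (prod_topology X Y) (\<lambda>z. (snd z, fst z))"
    by (intro continuous_map_pairedI continuous_map_fst continuous_map_snd)
  from continuous_map_compose[OF this F]
  show "continuous_map (prod_topology Y X) euclidean (\<lambda>z. F (snd z) (fst z))"
    by (simp add: o_def)
qed (use I J K L F0 in auto)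

text \<open>F is uniformly close to finite sums of products of a function of x and a function of y,
  for which the interchange is linearity. Each iterated integral changes by at most
  \<open>C * D * \<epsilon>\<close>.\<close>

lemma Fubini: "I (\<lambda>x. J (F x)) = J (\<lambda>y. I (\<lambda>x. F x y))"
proof -
  interpret S: radon_product Y X J I "\<lambda>y x. F x y" L K by (rule swap)
  \<comment> \<open>The partition functions may be nonzero slightly outside K. Keeping them inside
    M, fixed before \<epsilon>, makes C independent of \<epsilon>.\<close>
  obtain W M where W: "openin X W" "compactin X M" "K \<subseteq> W" "W \<subseteq> M"
    using X.compact_neighbourhood[OF K] by blast
  obtain C where C: "C \<ge> 0" "\<forall>g B. g \<in> Cc X \<longrightarrow> (\<forall>x. x \<notin> M \<longrightarrow> g x = 0) \<longrightarrow>
      (\<forall>x. norm (g x) \<le> B) \<longrightarrow> norm (I g) \<le> C * B"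
    using X.radon_bound[OF I W(2)] by blast
  obtain D where D: "D \<ge> 0" "\<forall>g B. g \<in> Cc Y \<longrightarrow> (\<forall>x. x \<notin> L \<longrightarrow> g x = 0) \<longrightarrow>
      (\<forall>x. norm (g x) \<le> B) \<longrightarrow> norm (J g) \<le> D * B"
    using Y.radon_bound[OF J L] by blast
  have "norm (I (\<lambda>x. J (F x)) - J (\<lambda>y. I (\<lambda>x. F x y))) \<le> 2 * (C * D) * \<epsilon>" if \<epsilon>: "0 < \<epsilon>" for \<epsilon>
  proof -
    have "\<forall>x\<in>K. \<exists>U. openin X U \<and> x \<in> U \<and> U \<subseteq> W \<and> (\<forall>x'\<in>U. \<forall>y\<in>L. norm (F x' y - F x y) \<le> \<epsilon>)"
    proof
      fix x assume x: "x \<in> K"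
      then have "x \<in> topspace X" using compactin_subset_topspace[OF K] by blast
      from uniform_slice[OF F L this \<epsilon>] obtain U where
        "openin X U" "x \<in> U" "\<forall>x'\<in>U. \<forall>y\<in>L. norm (F x' y - F x y) \<le> \<epsilon>" by blast
      then show "\<exists>U. openin X U \<and> x \<in> U \<and> U \<subseteq> W \<and> (\<forall>x'\<in>U. \<forall>y\<in>L. norm (F x' y - F x y) \<le> \<epsilon>)"
        using W x by (intro exI[of _ "U \<inter> W"]) auto
    qed
    from bchoice[OF this] obtain U where U: "\<forall>x\<in>K. openin X (U x) \<and> x \<in> U x \<and> U x \<subseteq> W \<and>
        (\<forall>x'\<in>U x. \<forall>y\<in>L. norm (F x' y - F x y) \<le> \<epsilon>)" ..
    then have U': "openin X (U x) \<and> x \<in> U x" if "x \<in> K" for x using that by blast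
    obtain B p where B: "finite B" "B \<subseteq> K"
      and p: "\<And>b. b \<in> B \<Longrightarrow> (\<lambda>x. of_real (p b x)) \<in> Cc X"
        "\<And>b. b \<in> B \<Longrightarrow> fun_support X (\<lambda>x. complex_of_real (p b x)) \<subseteq> U b"
        "\<And>b x. 0 \<le> p b x" "\<And>x. (\<Sum>b\<in>B. p b x) \<le> (1::real)" "\<And>x. x \<in> K \<Longrightarrow> (\<Sum>b\<in>B. p b x) = (1::real)"
      using X.partition_of_unity[OF K U'] by metis
    \<comment> \<open>Where \<open>p b x\<close> is nonzero, x lies in \<open>U b\<close>, so the
      slice of F at x is within \<epsilon> of the slice at b. The sum averages such slices with
      weights that add up to 1 on K.\<close>
    define G where "G = (\<lambda>x y. \<Sum>b\<in>B. complex_of_real (p b x) * F b y)"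
    have p0: "p b x = 0" if "b \<in> B" "x \<notin> U b" for b x
      using Cc_outside_support[OF p(1)[OF that(1)]] p(2)[OF that(1)] that(2) by force
    have close: "norm (F x y - G x y) \<le> \<epsilon>" for x y
    proof -
      have "F x y = (\<Sum>b\<in>B. complex_of_real (p b x) * F x y)"
      proof (cases "x \<in> K")
        case True
        then have "(\<Sum>b\<in>B. complex_of_real (p b x)) = 1"
          by (metis p(5) of_real_1 of_real_sum)
        then show ?thesis by (simp flip: sum_distrib_right)
      qed (simp add: F0)
      then have "F x y - G x y = (\<Sum>b\<in>B. complex_of_real (p b x) * (F x y - F b y))"
        by (simp add: G_def right_diff_distrib sum_subtractf)
      also have "norm \<dots> \<le> (\<Sum>b\<in>B. p b x * \<epsilon>)"
      proof (rule sum_norm_le)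
        fix b assume b: "b \<in> B"
        show "norm (complex_of_real (p b x) * (F x y - F b y)) \<le> p b x * \<epsilon>"
        proof (cases "x \<in> U b \<and> y \<in> L")
          case True
          then have "norm (F x y - F b y) \<le> \<epsilon>" using U B b by blast
          then show ?thesis using p(3)[of b x] by (simp add: norm_mult mult_left_mono)
        next
          case False
          then show ?thesis using p0[OF b] F0 p(3)[of b x] \<epsilon> by auto
        qed
      qed
      also have "\<dots> = (\<Sum>b\<in>B. p b x) * \<epsilon>" by (rule sum_distrib_right[symmetric])
      also have "\<dots> \<le> \<epsilon>" using p(4)[of x] \<epsilon> by (simp add: mult_left_le_one_le sum_nonneg p(3))
      finally show ?thesis .
    qed
    have zero: "F x y - G x y = 0" if "x \<notin> M \<or> y \<notin> L" for x y
    proof (cases "y \<in> L")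
      case True
      then have xM: "x \<notin> M" using that by blast
      have "p b x = 0" if "b \<in> B" for b
        using xM U W(4) B(2) that by (intro p0) blast+
      moreover have "x \<notin> K" using xM W by blast
      ultimately show ?thesis by (simp add: G_def F0)
    qed (simp add: G_def F0)
    have sliceX: "(\<lambda>x. F x y) \<in> Cc X" for y by (rule S.slice_Y)
    have G1: "G x \<in> Cc Y" "J (G x) = (\<Sum>b\<in>B. J (F b) * complex_of_real (p b x))" for x
    proof -
      show "G x \<in> Cc Y" unfolding G_def by (intro Y.Cc_sum Y.Cc_scale slice_Y)
      show "J (G x) = (\<Sum>b\<in>B. J (F b) * complex_of_real (p b x))"
        unfolding G_def
        by (subst Y.radon_sum[OF J]) (simp_all add: Y.Cc_scale slice_Y radon_scale[OF J] mult.commute[of "J _"])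
    qed
    have G2: "(\<lambda>x. G x y) \<in> Cc X" "I (\<lambda>x. G x y) = (\<Sum>b\<in>B. I (\<lambda>x. complex_of_real (p b x)) * F b y)" for y
    proof -
      have *: "G x y = (\<Sum>b\<in>B. F b y * complex_of_real (p b x))" for x
        by (simp add: G_def mult.commute)
      show "(\<lambda>x. G x y) \<in> Cc X" unfolding * by (intro X.Cc_sum X.Cc_scale p(1))
      show "I (\<lambda>x. G x y) = (\<Sum>b\<in>B. I (\<lambda>x. complex_of_real (p b x)) * F b y)"
        unfolding * by (subst X.radon_sum[OF I]) (simp_all add: X.Cc_scale p(1) radon_scale[OF I] mult.commute[of "I _"])
    qed
    have G3: "(\<lambda>x. J (G x)) \<in> Cc X" "(\<lambda>y. I (\<lambda>x. G x y)) \<in> Cc Y"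
      unfolding G1 G2 by (intro X.Cc_sum X.Cc_scale p(1) Y.Cc_sum Y.Cc_scale slice_Y; assumption)+
    have "I (\<lambda>x. J (G x)) = (\<Sum>b\<in>B. J (F b) * I (\<lambda>x. complex_of_real (p b x)))"
      unfolding G1 by (subst X.radon_sum[OF I]) (simp_all add: X.Cc_scale p(1) radon_scale[OF I])
    moreover have "J (\<lambda>y. I (\<lambda>x. G x y)) = (\<Sum>b\<in>B. I (\<lambda>x. complex_of_real (p b x)) * J (F b))"
      unfolding G2 by (subst Y.radon_sum[OF J]) (simp_all add: Y.Cc_scale slice_Y radon_scale[OF J])
    ultimately have eqG: "I (\<lambda>x. J (G x)) = J (\<lambda>y. I (\<lambda>x. G x y))"
      by (simp add: mult.commute)
    have JD: "J (\<lambda>y. F x y - G x y) = J (F x) - J (G x)" for x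
      by (rule Y.radon_diff[OF J slice_Y G1(1)])
    have ID: "I (\<lambda>x. F x y - G x y) = I (\<lambda>x. F x y) - I (\<lambda>x. G x y)" for y
      by (rule X.radon_diff[OF I sliceX G2(1)])
    have "norm (J (\<lambda>y. F x y - G x y)) \<le> D * \<epsilon>" for x
      using D(2) Y.Cc_diff[OF slice_Y G1(1)] close zero by blast
    moreover have "J (\<lambda>y. F x y - G x y) = 0" if "x \<notin> M" for x
      using zero[of x] that Y.radon_zero[OF J] by simp
    moreover have "(\<lambda>x. J (\<lambda>y. F x y - G x y)) \<in> Cc X"
      unfolding JD by (rule X.Cc_diff[OF integral_Y_Cc G3(1)])
    ultimately have "norm (I (\<lambda>x. J (\<lambda>y. F x y - G x y))) \<le> C * (D * \<epsilon>)"
      using C(2) by blast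
    then have 1: "norm (I (\<lambda>x. J (F x)) - I (\<lambda>x. J (G x))) \<le> C * (D * \<epsilon>)"
      unfolding JD X.radon_diff[OF I integral_Y_Cc G3(1)] .
    have "norm (I (\<lambda>x. F x y - G x y)) \<le> C * \<epsilon>" for y
      using C(2) X.Cc_diff[OF sliceX G2(1)] close zero by blast
    moreover have "I (\<lambda>x. F x y - G x y) = 0" if "y \<notin> L" for y
      using zero[of _ y] that X.radon_zero[OF I] by simp
    moreover have "(\<lambda>y. I (\<lambda>x. F x y - G x y)) \<in> Cc Y"
      unfolding ID by (rule Y.Cc_diff[OF S.integral_Y_Cc G3(2)])
    ultimately have "norm (J (\<lambda>y. I (\<lambda>x. F x y - G x y))) \<le> D * (C * \<epsilon>)"
      using D(2) by blast
    then have 2: "norm (J (\<lambda>y. I (\<lambda>x. F x y)) - J (\<lambda>y. I (\<lambda>x. G x y))) \<le> D * (C * \<epsilon>)"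
      unfolding ID Y.radon_diff[OF J S.integral_Y_Cc G3(2)] .
    have "norm (I (\<lambda>x. J (F x)) - J (\<lambda>y. I (\<lambda>x. F x y))) =
        norm ((I (\<lambda>x. J (F x)) - I (\<lambda>x. J (G x))) - (J (\<lambda>y. I (\<lambda>x. F x y)) - J (\<lambda>y. I (\<lambda>x. G x y))))"
      using eqG by simp
    also have "\<dots> \<le> C * (D * \<epsilon>) + D * (C * \<epsilon>)"
      using norm_triangle_ineq4 1 2 by (rule order_trans[OF _ add_mono])
    finally show ?thesis by (simp add: algebra_simps)
  qed
  then have "norm (I (\<lambda>x. J (F x)) - J (\<lambda>y. I (\<lambda>x. F x y))) \<le> 0"
    by (rule le_limit_at_right_0[rotated]) (auto intro!: tendsto_eq_intros)
  then show ?thesis by simp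
qed

end

section \<open>A local test for continuity, positive linear forms, and the cone of nonnegative
  functions\<close>

context locally_compact_Hausdorff begin

text \<open>Near each point some cutoff u is 1. For an integral with parameter x, the factor u
  confines x to a compact set, so that the integrands live on one compact set, as
  \<open>radon_parametric_continuous\<close> requires.\<close>

lemma continuous_map_if_Cc_mult:
  fixes h :: "'a \<Rightarrow> complex"
  assumes "\<And>u. u \<in> Cc X \<Longrightarrow> continuous_map X euclidean (\<lambda>x. u x * h x)"
  shows "continuous_map X euclidean h"
proof (rule continuous_map_local)
  fix x assume x: "x \<in> topspace X"
  then have "compactin X {x}" by simp
  from compact_neighbourhood[OF this] obtain W L where W: "openin X W" "compactin X L" "{x} \<subseteq> W" "W \<subseteq> L"
    by blast
  from Urysohn_cutoff[OF W(2) openin_topspace compactin_subset_topspace[OF W(2)]]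
  obtain u where u: "(\<lambda>x. of_real (u x)) \<in> Cc X" "\<forall>x\<in>L. u x = (1::real)"
    by (elim exE conjE) (rule that)
  show "\<exists>U g. openin X U \<and> x \<in> U \<and> continuous_map X euclidean g \<and> (\<forall>y\<in>U. h y = g y)"
    using W u(2) by (intro exI[of _ W] exI[of _ "\<lambda>y. complex_of_real (u y) * h y"] conjI assms[OF u(1)]) auto
qed

lemma nonneg_bump:
  assumes "x \<in> topspace X"
  shows "\<exists>g\<in>Cc X. (\<forall>y. g y \<in> \<real>\<^sub>\<ge>\<^sub>0) \<and> g x = 1"
proof -
  have "compactin X {x}" "{x} \<subseteq> topspace X" using assms by auto
  from Urysohn_cutoff[OF this(1) openin_topspace this(2)] obtain f where
    "(\<lambda>y. of_real (f y)) \<in> Cc X" "\<forall>y. 0 \<le> f y \<and> f y \<le> (1::real)" "\<forall>y\<in>{x}. f y = 1"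
    by (elim exE conjE) (rule that)
  then show ?thesis by (intro bexI[of _ "\<lambda>y. complex_of_real (f y)"]) auto
qed

text \<open>For real r with modulus at most s, vanishing off K, and a cutoff u that is 1 on K, both
  \<open>s u + r\<close> and \<open>s u - r\<close> are nonnegative. Positivity thus bounds m at r
  by s times m at u. The factor 2 in the constant comes from the real and imaginary parts.\<close>

lemma positive_form_radon:
  assumes ext: "m \<in> extensional (Cc X)"
    and add: "\<And>f g. f \<in> Cc X \<Longrightarrow> g \<in> Cc X \<Longrightarrow> m (\<lambda>x. f x + g x) = m f + m g"
    and scale: "\<And>c f. f \<in> Cc X \<Longrightarrow> m (\<lambda>x. c * f x) = c * m f"
    and pos: "\<And>f. f \<in> Cc X \<Longrightarrow> (\<And>x. f x \<in> \<real>\<^sub>\<ge>\<^sub>0) \<Longrightarrow> m f \<in> \<real>\<^sub>\<ge>\<^sub>0"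
  shows "m \<in> radon_measures X"
proof -
  have "\<exists>C. \<forall>f\<in>Cc X. fun_support X f \<subseteq> K \<longrightarrow> norm (m f) \<le> C * sup_norm f" if K: "compactin X K" for K
  proof -
    from Urysohn_cutoff[OF K openin_topspace compactin_subset_topspace[OF K]] obtain u where
      u: "(\<lambda>x. of_real (u x)) \<in> Cc X" "\<forall>x. 0 \<le> u x \<and> u x \<le> (1::real)" "\<forall>x\<in>K. u x = 1"
      by (elim exE conjE) (rule that)
    let ?u = "\<lambda>x. complex_of_real (u x)"
    have real_bound: "norm (m (\<lambda>x. complex_of_real (r x))) \<le> s * Re (m ?u)"
      if r: "(\<lambda>x. of_real (r x)) \<in> Cc X" and s: "\<And>x. \<bar>r x\<bar> \<le> s" "\<And>x. x \<notin> K \<Longrightarrow> r x = 0" for r s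
    proof -
      have s0: "0 \<le> s" using s(1)[of undefined] by linarith
      have *: "m (\<lambda>x. complex_of_real s * ?u x + c * complex_of_real (r x)) =
          complex_of_real s * m ?u + c * m (\<lambda>x. complex_of_real (r x))" for c
        by (simp add: add scale Cc_scale u r)
      have **: "complex_of_real s * m ?u + c * m (\<lambda>x. complex_of_real (r x)) \<in> \<real>\<^sub>\<ge>\<^sub>0"
        if c: "c = 1 \<or> c = -1" for c
      proof -
        have "complex_of_real s * ?u x + c * complex_of_real (r x) \<in> \<real>\<^sub>\<ge>\<^sub>0" for x
          using s(1)[of x] s(2)[of x] u(2,3) s0 c by (cases "x \<in> K") (auto simp: complex_nonneg_Reals_iff abs_le_iff)
        then show ?thesis
          unfolding *[symmetric] by (intro pos Cc_add Cc_scale u r) auto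
      qed
      show ?thesis
        using **[of 1] **[of "-1"] by (auto simp: complex_nonneg_Reals_iff cmod_eq_Re abs_le_iff)
    qed
    have "norm (m f) \<le> (2 * Re (m ?u)) * sup_norm f" if f: "f \<in> Cc X" "fun_support X f \<subseteq> K" for f
    proof -
      note part = Cc_Re[OF f(1)] Cc_Im[OF f(1)]
      have out: "f x = 0" if "x \<notin> K" for x using Cc_outside_support[OF f(1)] f(2) that by blast
      have "m f = m (\<lambda>x. complex_of_real (Re (f x)) + \<i> * complex_of_real (Im (f x)))"
        by (simp flip: complex_eq)
      also have "\<dots> = m (\<lambda>x. complex_of_real (Re (f x))) + \<i> * m (\<lambda>x. complex_of_real (Im (f x)))"
        by (simp add: add scale Cc_scale part)
      also have "norm \<dots> \<le> sup_norm f * Re (m ?u) + sup_norm f * Re (m ?u)"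
      proof (rule norm_triangle_mono)
        show "norm (m (\<lambda>x. complex_of_real (Re (f x)))) \<le> sup_norm f * Re (m ?u)"
          using norm_le_sup_norm[OF f(1)] abs_Re_le_cmod order_trans out
          by (intro real_bound part) (blast, simp)
        have "norm (m (\<lambda>x. complex_of_real (Im (f x)))) \<le> sup_norm f * Re (m ?u)"
          using norm_le_sup_norm[OF f(1)] abs_Im_le_cmod order_trans out
          by (intro real_bound part) (blast, simp)
        then show "norm (\<i> * m (\<lambda>x. complex_of_real (Im (f x)))) \<le> sup_norm f * Re (m ?u)"
          by (simp add: norm_mult)
      qed
      finally show ?thesis by (simp add: algebra_simps)
    qed
    then show ?thesis by blast
  qed
  then show ?thesis using ext add scale by (simp add: radon_measures_def)
qed

end

text \<open>Values are real so that domination of functions and infima of weights can be expressed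
  directly.\<close>

definition Ccp :: "'a topology \<Rightarrow> ('a \<Rightarrow> real) set" where
  "Ccp X = {f. (\<lambda>x. of_real (f x)) \<in> Cc X \<and> (\<forall>x. 0 \<le> f x)}"

lemma CcpD: "f \<in> Ccp X \<Longrightarrow> (\<lambda>x. of_real (f x)) \<in> Cc X" "f \<in> Ccp X \<Longrightarrow> 0 \<le> f x"
  by (auto simp: Ccp_def)

context locally_compact_Hausdorff begin

lemma Ccp_add: "f \<in> Ccp X \<Longrightarrow> g \<in> Ccp X \<Longrightarrow> (\<lambda>x. f x + g x) \<in> Ccp X"
  using Cc_add by (fastforce simp: Ccp_def)

lemma Ccp_scale: "f \<in> Ccp X \<Longrightarrow> 0 \<le> c \<Longrightarrow> (\<lambda>x. c * f x) \<in> Ccp X"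
  using Cc_scale[of "\<lambda>x. complex_of_real (f x)" "complex_of_real c"] by (simp add: Ccp_def)

lemma Ccp_max:
  assumes "(\<lambda>x. of_real (f x)) \<in> Cc X" "0 \<le> c"
  shows "(\<lambda>x. max 0 (f x - c)) \<in> Ccp X"
  using Cc_compose[OF assms(1), of "\<lambda>z. complex_of_real (max 0 (Re z - c))"] assms(2)
  by (simp add: Ccp_def continuous_intros)

lemma Ccp_bounded:
  assumes "f \<in> Ccp X" shows "\<exists>B>0. \<forall>x. f x \<le> B"
proof -
  obtain B where "\<forall>x. norm (complex_of_real (f x)) \<le> B"
    using Cc_bounded[OF CcpD(1)[OF assms]] by blast
  then have "f x \<le> max 1 B" for x using CcpD(2)[OF assms] by (simp add: le_max_iff_disj)
  then show ?thesis by (intro exI[of _ "max 1 B"]) auto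
qed

lemma Ccp_cutoff:
  assumes "compactin X K"
  shows "\<exists>g\<in>Ccp X. \<forall>x\<in>K. g x = 1"
  using Urysohn_cutoff[OF assms openin_topspace compactin_subset_topspace[OF assms]]
  unfolding Ccp_def by blast

end

section \<open>Translates, domination by combinations of translates, and positivity of Haar
  measure\<close>

context locally_compact_group begin

definition translate :: "'a \<Rightarrow> ('a \<Rightarrow> complex) \<Rightarrow> 'a \<Rightarrow> complex" where
  "translate g f = (\<lambda>x. if x \<in> carrier G then f (g \<otimes> x) else 0)"

lemma translate_Cc:
  assumes "f \<in> Cc T" "g \<in> carrier G"
  shows "translate g f \<in> Cc T"
proof (rule CcI(1))
  show "compactin T ((\<lambda>x. inv g \<otimes> x) ` fun_support T f)"
    using assms by (intro image_compactin[OF Cc_compact_support continuous_map_left_mult]) auto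
  have "continuous_map T euclidean (\<lambda>x. f (g \<otimes> x))"
    using continuous_map_compose[OF continuous_map_left_mult[OF assms(2)] Cc_continuous[OF assms(1)]]
    by (simp add: o_def)
  then show "continuous_map T euclidean (translate g f)"
    by (rule continuous_map_eq) (simp add: translate_def topspace_eq)
  fix x assume x: "x \<notin> (\<lambda>x. inv g \<otimes> x) ` fun_support T f"
  show "translate g f x = 0"
  proof (cases "x \<in> carrier G")
    case True
    then have "x = inv g \<otimes> (g \<otimes> x)" using assms(2) by (simp flip: m_assoc)
    then have "g \<otimes> x \<notin> fun_support T f" using x by blast
    then show ?thesis using Cc_outside_support[OF assms(1)] by (simp add: translate_def)
  qed (simp add: translate_def)
qed

lemma haar_radon: "left_haar_measure G T m \<Longrightarrow> m \<in> radon_measures T"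
  and haar_nonneg: "left_haar_measure G T m \<Longrightarrow> f \<in> Cc T \<Longrightarrow> (\<And>x. f x \<in> \<real>\<^sub>\<ge>\<^sub>0) \<Longrightarrow> m f \<in> \<real>\<^sub>\<ge>\<^sub>0"
  and haar_nonzero: "left_haar_measure G T m \<Longrightarrow> \<exists>f\<in>Cc T. m f \<noteq> 0"
  and haar_translate: "left_haar_measure G T m \<Longrightarrow> g \<in> carrier G \<Longrightarrow> f \<in> Cc T \<Longrightarrow> m (translate g f) = m f"
  by (auto simp: left_haar_measure_def translate_def)

text \<open>Left multiplication by \<open>x \<otimes> inv s\<close> sends s to x, where f is
  nonzero. The corresponding translate of f is then nonzero near s, and finitely many s in K
  suffice.\<close>

lemma compact_translate_cover:
  assumes f: "f \<in> Cc T" and x: "x \<in> carrier G" "f x \<noteq> 0" and K: "compactin T K"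
  shows "\<exists>B. finite B \<and> B \<subseteq> carrier G \<and> (\<forall>y\<in>K. \<exists>b\<in>B. f (b \<otimes> y) \<noteq> 0)"
proof -
  have Kc: "K \<subseteq> carrier G" using compactin_subset_topspace[OF K] topspace_eq by blast
  let ?U = "\<lambda>s. {y \<in> topspace T. f (x \<otimes> inv s \<otimes> y) \<in> UNIV - {0}}"
  have U: "openin T (?U s) \<and> s \<in> ?U s" if s: "s \<in> K" for s
  proof
    have sc: "s \<in> carrier G" using s Kc by blast
    then have "continuous_map T euclidean (\<lambda>y. f (x \<otimes> inv s \<otimes> y))"
      using continuous_map_compose[OF continuous_map_left_mult[of "x \<otimes> inv s"] Cc_continuous[OF f]] x
      by (simp add: o_def)
    then show "openin T (?U s)"
      by (rule openin_continuous_map_preimage) (simp add: open_delete)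
    show "s \<in> ?U s" using sc x by (simp add: topspace_eq m_assoc)
  qed
  have "\<exists>B. finite B \<and> B \<subseteq> K \<and> K \<subseteq> (\<Union>s\<in>B. ?U s)"
    by (rule compactin_finite_subcover[OF K U])
  then obtain B where
    "finite B" "B \<subseteq> K" "K \<subseteq> (\<Union>s\<in>B. ?U s)" by (elim exE conjE) (rule that)
  then show ?thesis
    using Kc x by (intro exI[of _ "(\<lambda>s. x \<otimes> inv s) ` B"]) (auto simp: subset_iff)
qed

text \<open>A finite nonnegative combination h of left translates of \<phi>, with the sum v of its
  coefficients. The weight is an argument of its own because h does not determine it, and the
  inductive form replaces finite families by induction.\<close>

inductive translate_comb :: "('a \<Rightarrow> real) \<Rightarrow> real \<Rightarrow> ('a \<Rightarrow> real) \<Rightarrow> bool" for \<phi> where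
  zero: "translate_comb \<phi> 0 (\<lambda>x. 0)"
| step: "translate_comb \<phi> v h \<Longrightarrow> 0 \<le> c \<Longrightarrow> s \<in> carrier G \<Longrightarrow>
    translate_comb \<phi> (v + c) (\<lambda>x. h x + c * \<phi> (s \<otimes> x))"

lemma translate_comb_nonneg: "translate_comb \<phi> v h \<Longrightarrow> 0 \<le> v"
  by (induction rule: translate_comb.induct) auto

lemma translate_comb_add:
  assumes "translate_comb \<phi> v h" "translate_comb \<phi> w k"
  shows "translate_comb \<phi> (v + w) (\<lambda>x. h x + k x)"
  using assms(2)
proof (induction rule: translate_comb.induct)
  case zero then show ?case using assms(1) by simp
next
  case (step w k c s)
  then show ?case using translate_comb.step[OF step.IH step.hyps(2,3)] by (simp add: add.assoc)
qed

lemma translate_comb_scale: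
  assumes "translate_comb \<phi> v h" "0 \<le> a"
  shows "translate_comb \<phi> (a * v) (\<lambda>x. a * h x)"
  using assms(1)
proof (induction rule: translate_comb.induct)
  case zero then show ?case by (simp add: translate_comb.zero)
next
  case (step v h c s)
  then show ?case using translate_comb.step[OF step.IH, of "a * c" s] assms(2)
    by (simp add: distrib_left mult.assoc)
qed

lemma translate_comb_translate:
  assumes "translate_comb \<phi> v h" and g: "g \<in> carrier G"
  shows "\<exists>h'. translate_comb \<phi> v h' \<and> (\<forall>x\<in>carrier G. h' x = h (g \<otimes> x))"
  using assms(1)
proof (induction rule: translate_comb.induct)
  case zero then show ?case using translate_comb.zero by blast
next
  case (step v h c s)
  then obtain h' where h': "translate_comb \<phi> v h'" "\<forall>x\<in>carrier G. h' x = h (g \<otimes> x)" by blast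
  \<comment> \<open>Replacing the translation element s by \<open>s \<otimes> g\<close> keeps the
    coefficient. Associativity is available on the carrier only, hence the restriction to the
    carrier.\<close>
  show ?case
    using translate_comb.step[OF h'(1) step.hyps(2), of "s \<otimes> g"] step.hyps(3) g h'(2)
    by (intro exI[of _ "\<lambda>x. h' x + c * \<phi> (s \<otimes> g \<otimes> x)"]) (simp add: m_assoc)
qed

text \<open>Each translate of \<phi> is dominated by the same translate of k, which again has weight
  w. A coefficient c thus contributes \<open>c * w\<close>.\<close>

lemma translate_comb_trans:
  assumes "translate_comb \<phi> v h" and k: "translate_comb \<psi> w k" "\<And>x. x \<in> carrier G \<Longrightarrow> \<phi> x \<le> k x"
  shows "\<exists>h'. translate_comb \<psi> (v * w) h' \<and> (\<forall>x\<in>carrier G. h x \<le> h' x)"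
  using assms(1)
proof (induction rule: translate_comb.induct)
  case zero then show ?case using translate_comb.zero by auto
next
  case (step v h c s)
  then obtain h' where h': "translate_comb \<psi> (v * w) h'" "\<forall>x\<in>carrier G. h x \<le> h' x" by blast
  obtain k' where k': "translate_comb \<psi> w k'" "\<forall>x\<in>carrier G. k' x = k (s \<otimes> x)"
    using translate_comb_translate[OF k(1) step.hyps(3)] by blast
  have "translate_comb \<psi> ((v + c) * w) (\<lambda>x. h' x + c * k' x)"
    using translate_comb_add[OF h'(1) translate_comb_scale[OF k'(1) step.hyps(2)]]
    by (simp add: distrib_right)
  moreover have "h x + c * \<phi> (s \<otimes> x) \<le> h' x + c * k' x" if "x \<in> carrier G" for x
    using h'(2) k'(2) k(2)[of "s \<otimes> x"] step.hyps that by (intro add_mono mult_left_mono) auto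
  ultimately show ?case by blast
qed

lemma translate_comb_bound:
  assumes "translate_comb \<phi> v h" "\<And>x. \<phi> x \<le> B"
  shows "h x \<le> v * B"
  using assms(1)
proof (induction rule: translate_comb.induct)
  case (step v h c s)
  then show ?case using mult_left_mono[OF assms(2)[of "s \<otimes> x"] step.hyps(2)] by (simp add: distrib_right)
qed simp

lemma translate_comb_exists:
  assumes f: "f \<in> Ccp T" and \<phi>: "\<phi> \<in> Ccp T" and x: "x \<in> carrier G" "0 < \<phi> x"
  shows "\<exists>v h. translate_comb \<phi> v h \<and> (\<forall>y\<in>carrier G. f y \<le> h y)"
proof -
  \<comment> \<open>This function is nonzero exactly where \<phi> exceeds half its value at x.
    Covering by its translates thus gives a uniform lower bound for a translate of \<phi>, not just
    nonvanishing.\<close>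
  have "(\<lambda>y. max 0 (\<phi> y - \<phi> x / 2)) \<in> Ccp T"
    using x by (intro Ccp_max CcpD(1)[OF \<phi>]) auto
  from CcpD(1)[OF this] have \<psi>: "(\<lambda>y. complex_of_real (max 0 (\<phi> y - \<phi> x / 2))) \<in> Cc T" .
  have "\<exists>B. finite B \<and> B \<subseteq> carrier G \<and>
      (\<forall>y\<in>fun_support T (\<lambda>x. complex_of_real (f x)). \<exists>b\<in>B. complex_of_real (max 0 (\<phi> (b \<otimes> y) - \<phi> x / 2)) \<noteq> 0)"
    by (rule compact_translate_cover[OF \<psi> x(1) _ Cc_compact_support[OF CcpD(1)[OF f]]]) (use x in auto)
  then obtain B where B: "finite B" "B \<subseteq> carrier G"
      "\<forall>y\<in>fun_support T (\<lambda>x. complex_of_real (f x)). \<exists>b\<in>B. complex_of_real (max 0 (\<phi> (b \<otimes> y) - \<phi> x / 2)) \<noteq> 0"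
    by (elim exE conjE) (rule that)
  obtain M where M: "M > 0" "\<forall>y. f y \<le> M" using Ccp_bounded[OF f] by blast
  \<comment> \<open>Chosen so that c times the lower bound \<open>\<phi> x / 2\<close> is M: one
    covering translate already dominates f.\<close>
  define c where "c = 2 * M / \<phi> x"
  have c: "0 \<le> c" using M x by (simp add: c_def)
  have "translate_comb \<phi> (\<Sum>b\<in>B. c) (\<lambda>y. \<Sum>b\<in>B. c * \<phi> (b \<otimes> y))"
    using B(1,2)
  proof (induction B rule: finite_induct)
    case (insert b B)
    then have "translate_comb \<phi> ((\<Sum>b\<in>B. c) + c) (\<lambda>y. (\<Sum>b\<in>B. c * \<phi> (b \<otimes> y)) + c * \<phi> (b \<otimes> y))"
      using c by (intro translate_comb.step) auto
    then show ?case by (simp only: sum.insert[OF insert.hyps] add.commute)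
  qed (simp add: translate_comb.zero)
  moreover have "f y \<le> (\<Sum>b\<in>B. c * \<phi> (b \<otimes> y))" for y
  proof (cases "y \<in> fun_support T (\<lambda>x. complex_of_real (f x))")
    case True
    then obtain b where "b \<in> B" "complex_of_real (max 0 (\<phi> (b \<otimes> y) - \<phi> x / 2)) \<noteq> 0" using B(3) by blast
    then have b: "b \<in> B" "\<phi> x / 2 \<le> \<phi> (b \<otimes> y)" by (auto simp: max_def split: if_splits)
    have "f y \<le> c * (\<phi> x / 2)" using M(2) x by (simp add: c_def)
    also have "\<dots> \<le> c * \<phi> (b \<otimes> y)" using b(2) c by (rule mult_left_mono)
    also have "\<dots> \<le> (\<Sum>b\<in>B. c * \<phi> (b \<otimes> y))"
      using b(1) B(1) c CcpD(2)[OF \<phi>] by (intro member_le_sum) auto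
    finally show ?thesis .
  next
    case False
    then have "f y = 0" using Cc_outside_support[OF CcpD(1)[OF f]] by simp
    then show ?thesis using c CcpD(2)[OF \<phi>] by (auto intro: sum_nonneg)
  qed
  ultimately show ?thesis by blast
qed

definition rtranslate :: "'a \<Rightarrow> ('a \<Rightarrow> real) \<Rightarrow> 'a \<Rightarrow> real" where
  "rtranslate g f = (\<lambda>x. if x \<in> carrier G then f (g \<otimes> x) else 0)"

lemma of_real_rtranslate: "complex_of_real (rtranslate g f x) = translate g (\<lambda>x. complex_of_real (f x)) x"
  by (simp add: rtranslate_def translate_def)

lemma rtranslate_Ccp: "f \<in> Ccp T \<Longrightarrow> g \<in> carrier G \<Longrightarrow> rtranslate g f \<in> Ccp T"
  using translate_Cc[of "\<lambda>x. complex_of_real (f x)" g]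
  by (auto simp: Ccp_def of_real_rtranslate) (simp add: rtranslate_def)

lemma rtranslate_inverse:
  assumes "f \<in> Ccp T" "g \<in> carrier G" shows "rtranslate (inv g) (rtranslate g f) = f"
proof
  fix x
  have "x \<notin> carrier G \<Longrightarrow> f x = 0" using Cc_outside[OF CcpD(1)[OF assms(1)], of x] by (simp add: topspace_eq)
  then show "rtranslate (inv g) (rtranslate g f) x = f x"
    using assms(2) by (auto simp: rtranslate_def simp flip: m_assoc)
qed

text \<open>A null nonnegative function would make every function null, since each is dominated by
  a combination of its translates.\<close>

lemma haar_pos:
  assumes m: "left_haar_measure G T m" and f: "f \<in> Cc T" "\<And>x. f x \<in> \<real>\<^sub>\<ge>\<^sub>0"
    and x: "x \<in> carrier G" "f x \<noteq> 0"
  shows "m f \<noteq> 0"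
proof
  assume mf: "m f = 0"
  note \<mu> = haar_radon[OF m]
  define \<phi> where "\<phi> = (\<lambda>x. Re (f x))"
  have f_eq: "f = (\<lambda>x. complex_of_real (\<phi> x))" and \<phi>_nonneg: "\<And>x. 0 \<le> \<phi> x"
    using f(2) by (auto simp: \<phi>_def complex_nonneg_Reals_iff complex_eq_iff)
  then have \<phi>: "\<phi> \<in> Ccp T" and \<phi>x: "0 < \<phi> x"
    using f(1) x(2) by (auto simp: Ccp_def less_le)
  \<comment> \<open>A combination h is uncontrolled outside the carrier, so m is applied to S, its
    extension by 0 from the carrier.\<close>
  have comb: "\<exists>S\<in>Ccp T. (\<forall>y\<in>carrier G. S y = h y) \<and> m (\<lambda>y. complex_of_real (S y)) = 0"
    if "translate_comb \<phi> v h" for v h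
    using that
  proof (induction rule: translate_comb.induct)
    case zero
    show ?case using Cc_zero radon_zero[OF \<mu>] by (intro bexI[of _ "\<lambda>y. 0"]) (auto simp: Ccp_def)
  next
    case (step v h c s)
    then obtain S where S: "S \<in> Ccp T" "\<forall>y\<in>carrier G. S y = h y" "m (\<lambda>y. complex_of_real (S y)) = 0" by blast
    note sf = translate_Cc[OF f(1) step.hyps(3)]
    have "m (\<lambda>y. complex_of_real (S y + c * rtranslate s \<phi> y)) = 0"
      using radon_add[OF \<mu> CcpD(1)[OF S(1)] Cc_scale[OF sf, of c]] radon_scale[OF \<mu> sf]
        haar_translate[OF m step.hyps(3) f(1)] S(3) mf by (simp add: of_real_rtranslate flip: f_eq)
    then show ?case
      using S(1,2) step.hyps(2,3)
      by (intro bexI[of _ "\<lambda>y. S y + c * rtranslate s \<phi> y"] Ccp_add Ccp_scale rtranslate_Ccp \<phi>)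
        (auto simp: rtranslate_def)
  qed
  have null: "m (\<lambda>y. complex_of_real (k y)) = 0" if k: "k \<in> Ccp T" for k
  proof -
    obtain v h where "translate_comb \<phi> v h" "\<forall>y\<in>carrier G. k y \<le> h y"
      using translate_comb_exists[OF k \<phi> x(1) \<phi>x] by blast
    with comb obtain S where S: "S \<in> Ccp T" "\<forall>y\<in>carrier G. k y \<le> S y" "m (\<lambda>y. complex_of_real (S y)) = 0"
      by metis
    have "k y \<le> S y" for y
      using S(2) Cc_outside[OF CcpD(1)[OF k], of y] CcpD(2)[OF S(1), of y] by (cases "y \<in> carrier G") (auto simp: topspace_eq)
    then have "m (\<lambda>y. complex_of_real (S y) - complex_of_real (k y)) \<in> \<real>\<^sub>\<ge>\<^sub>0"
      by (intro haar_nonneg[OF m] Cc_diff CcpD(1) S(1) k) (simp flip: of_real_diff)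
    moreover have "m (\<lambda>y. complex_of_real (k y)) \<in> \<real>\<^sub>\<ge>\<^sub>0"
      by (rule haar_nonneg[OF m CcpD(1)[OF k]]) (simp add: CcpD(2)[OF k])
    ultimately show ?thesis
      using S(3) by (auto simp: radon_diff[OF \<mu> CcpD(1)[OF S(1)] CcpD(1)[OF k]] complex_nonneg_Reals_iff complex_eq_iff)
  qed
  have real_null: "m (\<lambda>y. complex_of_real (r y)) = 0" if r: "(\<lambda>y. complex_of_real (r y)) \<in> Cc T" for r
  proof -
    have pos: "(\<lambda>y. max 0 (r y - 0)) \<in> Ccp T" "(\<lambda>y. max 0 (- r y - 0)) \<in> Ccp T"
      using Ccp_max[OF r, of 0] Ccp_max[of "\<lambda>y. - r y" 0] Cc_scale[OF r, of "-1"] by simp_all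
    have "(\<lambda>y. complex_of_real (r y)) =
        (\<lambda>y. complex_of_real (max 0 (r y - 0)) - complex_of_real (max 0 (- r y - 0)))"
      by (auto simp: max_def)
    then show ?thesis
      using radon_diff[OF \<mu> CcpD(1)[OF pos(1)] CcpD(1)[OF pos(2)]] null[OF pos(1)] null[OF pos(2)] by simp
  qed
  have "m k = 0" if k: "k \<in> Cc T" for k
  proof -
    have "m k = m (\<lambda>x. complex_of_real (Re (k x)) + \<i> * complex_of_real (Im (k x)))"
      by (simp flip: complex_eq)
    then show ?thesis
      by (simp add: radon_add[OF \<mu>] radon_scale[OF \<mu>] Cc_scale Cc_Re[OF k] Cc_Im[OF k] real_null)
  qed
  then show False using haar_nonzero[OF m] by blast
qed

text \<open>With \<open>mem_div\<close>, this confines every t that moves some point of B into A to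
  one compact set, which bounds the supports in the double integrals below.\<close>

lemma compactin_div:
  assumes "compactin T A" "compactin T B"
  shows "compactin T ((\<lambda>z. fst z \<otimes> inv (snd z)) ` (A \<times> B))"
proof (rule image_compactin)
  show "compactin (prod_topology T T) (A \<times> B)" using assms by (simp add: compactin_Times)
  show "continuous_map (prod_topology T T) T (\<lambda>z. fst z \<otimes> inv (snd z))"
    by (intro continuous_map_group_mult continuous_map_group_inv continuous_map_fst continuous_map_snd)
qed

lemma mem_div:
  assumes "a \<in> A" "b \<in> B" "t \<in> carrier G" "b \<in> carrier G" "a = t \<otimes> b"
  shows "t \<in> (\<lambda>z. fst z \<otimes> inv (snd z)) ` (A \<times> B)"
proof -
  have "t = a \<otimes> inv b" using assms by (simp add: m_assoc)
  then show ?thesis using assms by (intro image_eqI[of _ _ "(a, b)"]) auto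
qed

text \<open>Since the Haar integral of \<open>t \<mapsto> g (t x)\<close> does not vanish, one can insert the factor
  \<open>g (t x) / J g(_ x)\<close> into \<open>I f\<close>, interchange the integrals, and translate first \<open>x\<close>, then \<open>t\<close>.
  What remains is \<open>I g\<close> times an integral that does not involve \<open>I\<close>.\<close>

lemma haar_factor:
  assumes J: "left_haar_measure G T J" and g: "g \<in> Cc T" "\<And>x. g x \<in> \<real>\<^sub>\<ge>\<^sub>0" "g \<one> \<noteq> 0" and f: "f \<in> Cc T"
  shows "\<exists>c. \<forall>I. left_haar_measure G T I \<longrightarrow> I f = I g * c"
proof -
  note J' = haar_radon[OF J]
  have cont_fst: "continuous_map (prod_topology T T) T fst" and cont_snd: "continuous_map (prod_topology T T) T snd"
    by (simp_all add: continuous_map_fst continuous_map_snd)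
  have comp: "continuous_map (prod_topology T T) euclidean (\<lambda>z. k (h z))"
    if "continuous_map T euclidean k" "continuous_map (prod_topology T T) T h" for k :: "'a \<Rightarrow> complex" and h
    using continuous_map_compose[OF that(2,1)] by (simp add: o_def)
  \<comment> \<open>Here x acts by right translation, under which the left invariant J need not be
    invariant. So D is not constant in general, and its continuity has to be proved.\<close>
  define D where "D = (\<lambda>x. J (\<lambda>t. if t \<in> carrier G then g (t \<otimes> x) else 0))"
  have gx: "(\<lambda>t. if t \<in> carrier G then g (t \<otimes> x) else 0) \<in> Cc T" if x: "x \<in> carrier G" for x
  proof (rule CcI(1)[OF _ compactin_div[OF Cc_compact_support[OF g(1)]]])
    show "continuous_map T euclidean (\<lambda>t. if t \<in> carrier G then g (t \<otimes> x) else 0)"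
      by (rule continuous_map_eq[OF continuous_map_compose[OF continuous_map_right_mult[OF x] Cc_continuous[OF g(1)]]])
        (simp add: topspace_eq)
    show "compactin T {x}" using x by (simp add: topspace_eq)
    fix t assume "t \<notin> (\<lambda>z. fst z \<otimes> inv (snd z)) ` (fun_support T g \<times> {x})"
    then have "t \<in> carrier G \<Longrightarrow> t \<otimes> x \<notin> fun_support T g"
      using mem_div[of "t \<otimes> x" "fun_support T g" x "{x}" t] x by blast
    then show "(if t \<in> carrier G then g (t \<otimes> x) else 0) = 0"
      using Cc_outside_support[OF g(1)] by simp
  qed
  \<comment> \<open>At t = \<open>inv x\<close> the integrand is \<open>g \<one>\<close>, which is
    nonzero, so \<open>haar_pos\<close> applies.\<close>
  have D0: "D x \<noteq> 0" if x: "x \<in> carrier G" for x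
    unfolding D_def by (rule haar_pos[OF J gx[OF x], of "inv x"]) (use x g in auto)
  have Dc: "continuous_map T euclidean D"
  proof (rule continuous_map_if_Cc_mult)
    fix u assume u: "u \<in> Cc T"
    let ?F = "\<lambda>x t. u x * (if t \<in> carrier G then g (t \<otimes> x) else 0)"
    have "continuous_map T euclidean (\<lambda>x. J (?F x))"
    proof (rule radon_parametric_continuous[OF J' _ compactin_div[OF Cc_compact_support[OF g(1)] Cc_compact_support[OF u]]])
      have "continuous_map (prod_topology T T) euclidean (\<lambda>z. u (fst z) * g (snd z \<otimes> fst z))"
        by (intro continuous_map_mult comp Cc_continuous u g continuous_map_group_mult cont_fst cont_snd)
      then show "continuous_map (prod_topology T T) euclidean (\<lambda>z. ?F (fst z) (snd z))"
        by (rule continuous_map_eq) (auto simp: topspace_eq)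
      fix x t assume x: "x \<in> topspace T"
        and t: "t \<notin> (\<lambda>z. fst z \<otimes> inv (snd z)) ` (fun_support T g \<times> fun_support T u)"
      have "x \<in> fun_support T u \<Longrightarrow> t \<in> carrier G \<Longrightarrow> t \<otimes> x \<notin> fun_support T g"
        using mem_div[of "t \<otimes> x" "fun_support T g" x "fun_support T u" t] x t by (auto simp: topspace_eq)
      then show "?F x t = 0"
        using Cc_outside_support[OF g(1)] Cc_outside_support[OF u] by fastforce
    qed
    then show "continuous_map T euclidean (\<lambda>x. u x * D x)"
      by (rule continuous_map_eq) (simp add: D_def radon_scale[OF J' gx] topspace_eq)
  qed
  define q where "q = (\<lambda>x. f x / D x)"
  have fsupp: "fun_support T f \<subseteq> carrier G" and gsupp: "fun_support T g \<subseteq> carrier G"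
    using closedin_subset[OF closedin_fun_support] topspace_eq by metis+
  have q: "q \<in> Cc T"
    unfolding q_def using D0 fsupp by (intro Cc_divide f Dc) auto
  define K where "K = fun_support T q"
  have Kc: "K \<subseteq> carrier G" using closedin_subset[OF closedin_fun_support] topspace_eq K_def by metis
  have K: "compactin T K" unfolding K_def by (rule Cc_compact_support[OF q])
  have q0: "q x = 0" if "x \<notin> K" for x using Cc_outside_support[OF q] that by (simp add: K_def)
  define L where "L = (\<lambda>z. fst z \<otimes> inv (snd z)) ` (fun_support T g \<times> K)"
  have L: "compactin T L" unfolding L_def by (rule compactin_div[OF Cc_compact_support[OF g(1)] K])
  define F where "F = (\<lambda>x t. if x \<in> carrier G \<and> t \<in> carrier G then q x * g (t \<otimes> x) else 0)"
  \<comment> \<open>This is F after the substitution of \<open>inv t \<otimes> x\<close> for x,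
    which the left invariance of I permits for fixed t.\<close>
  define F' where "F' = (\<lambda>x t. if x \<in> carrier G \<and> t \<in> carrier G then g x * q (inv t \<otimes> x) else 0)"
  have F0: "F x t = 0" if "x \<notin> K \<or> t \<notin> L" for x t
  proof (cases "x \<in> K \<and> t \<in> carrier G")
    case True
    then have "t \<otimes> x \<notin> fun_support T g"
      using mem_div[of "t \<otimes> x" "fun_support T g" x K t] that Kc by (auto simp: L_def)
    then show ?thesis using Cc_outside_support[OF g(1)] by (simp add: F_def)
  qed (auto simp: F_def q0)
  have F'0: "F' x t = 0" if "x \<notin> fun_support T g \<or> t \<notin> L" for x t
  proof (cases "x \<in> fun_support T g \<and> t \<in> carrier G")
    case True
    then have xc: "x \<in> carrier G" using gsupp by blast
    have "inv t \<otimes> x \<notin> K"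
    proof
      assume "inv t \<otimes> x \<in> K"
      then have "t \<in> L" unfolding L_def
        using True xc by (intro mem_div[of x _ "inv t \<otimes> x"]) (auto simp flip: m_assoc)
      then show False using True that by blast
    qed
    then show ?thesis by (simp add: F'_def q0)
  qed (auto simp: F'_def Cc_outside_support[OF g(1)])
  have Fc: "continuous_map (prod_topology T T) euclidean (\<lambda>z. F (fst z) (snd z))"
  proof -
    have "continuous_map (prod_topology T T) euclidean (\<lambda>z. q (fst z) * g (snd z \<otimes> fst z))"
      by (intro continuous_map_mult comp Cc_continuous q g continuous_map_group_mult cont_fst cont_snd)
    then show ?thesis by (rule continuous_map_eq) (auto simp: topspace_eq F_def)
  qed
  have F'c: "continuous_map (prod_topology T T) euclidean (\<lambda>z. F' (fst z) (snd z))"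
  proof -
    have "continuous_map (prod_topology T T) euclidean (\<lambda>z. g (fst z) * q (inv (snd z) \<otimes> fst z))"
      by (intro continuous_map_mult comp Cc_continuous q g continuous_map_group_mult continuous_map_group_inv cont_fst cont_snd)
    then show ?thesis by (rule continuous_map_eq) (auto simp: topspace_eq F'_def)
  qed
  \<comment> \<open>Substituting \<open>x \<otimes> t\<close> for t turns
    \<open>inv t \<otimes> x\<close> into \<open>inv t\<close>; x then remains only in the factor
    \<open>g x\<close>.\<close>
  define c where "c = J (\<lambda>t. if t \<in> carrier G then q (inv t) else 0)"
  have "I f = I g * c" if I: "left_haar_measure G T I" for I
  proof -
    note I' = haar_radon[OF I]
    interpret F: radon_product T T I J F K L
      by unfold_locales (use I' J' Fc K L F0 in auto)
    interpret F': radon_product T T I J F' "fun_support T g" L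
      by unfold_locales (use I' J' F'c Cc_compact_support[OF g(1)] L F'0 in auto)
    interpret S: radon_product T T J I "\<lambda>y x. F x y" L K by (rule F.swap)
    have "J (F x) = f x" for x
    proof (cases "x \<in> carrier G")
      case True
      then have "F x = (\<lambda>t. q x * (if t \<in> carrier G then g (t \<otimes> x) else 0))"
        by (auto simp: F_def)
      then have "J (F x) = q x * D x" using radon_scale[OF J' gx[OF True]] by (simp add: D_def)
      then show ?thesis using D0[OF True] by (simp add: q_def)
    next
      case False
      then show ?thesis using Cc_outside[OF f] radon_zero[OF J'] by (simp add: F_def topspace_eq)
    qed
    then have "I f = I (\<lambda>x. J (F x))" by simp
    also have "\<dots> = J (\<lambda>t. I (\<lambda>x. F x t))" by (rule F.Fubini)
    also have "(\<lambda>t. I (\<lambda>x. F x t)) = (\<lambda>t. I (\<lambda>x. F' x t))"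
    proof
      fix t
      show "I (\<lambda>x. F x t) = I (\<lambda>x. F' x t)"
      proof (cases "t \<in> carrier G")
        case True
        have "F' x t = translate (inv t) (\<lambda>x. F x t) x" for x
          using True by (auto simp: translate_def F_def F'_def simp flip: m_assoc)
        then have "(\<lambda>x. F' x t) = translate (inv t) (\<lambda>x. F x t)" by blast
        then show ?thesis using haar_translate[OF I _ S.slice_Y, of "inv t"] True by simp
      qed (simp add: F_def F'_def)
    qed
    also have "J (\<lambda>t. I (\<lambda>x. F' x t)) = I (\<lambda>x. J (F' x))" by (rule F'.Fubini[symmetric])
    also have "(\<lambda>x. J (F' x)) = (\<lambda>x. c * g x)"
    proof
      fix x
      show "J (F' x) = c * g x"
      proof (cases "x \<in> carrier G")
        case True
        show ?thesis
        \<comment> \<open>Membership of the function under J in C_c is read off by dividing a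
          translate of \<open>F' x\<close> by \<open>g x\<close>. If \<open>g x = 0\<close>, both
          sides vanish.\<close>
        proof (cases "g x = 0")
          case False
          have shift: "translate x (F' x) = (\<lambda>t. g x * (if t \<in> carrier G then q (inv t) else 0))"
            using True by (auto simp: translate_def F'_def inv_mult_group m_assoc)
          then have "(\<lambda>t. g x * (if t \<in> carrier G then q (inv t) else 0)) \<in> Cc T"
            using translate_Cc[OF F'.slice_Y True, of x] by simp
          from Cc_scale[OF this, of "1 / g x"] have "(\<lambda>t. if t \<in> carrier G then q (inv t) else 0) \<in> Cc T"
            using False by simp
          then show ?thesis
            using haar_translate[OF J True F'.slice_Y[of x]] radon_scale[OF J'] shift by (simp add: c_def mult.commute)
        qed (simp add: F'_def radon_zero[OF J'] cong: if_cong)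
      next
        case False
        then show ?thesis using Cc_outside[OF g(1)] radon_zero[OF J'] by (simp add: F'_def topspace_eq)
      qed
    qed
    also have "I (\<lambda>x. c * g x) = I g * c" by (simp add: radon_scale[OF I' g(1)])
    finally show ?thesis .
  qed
  then show ?thesis by blast
qed

text \<open>The factor c in \<open>haar_factor\<close> does not depend on the Haar measure, so I and
  J share it. Hence the ratios of the values at f and at the bump g agree, and
  \<open>haar_pos\<close> allows division by \<open>J g\<close>.\<close>

lemma haar_unique:
  assumes I: "left_haar_measure G T I" and J: "left_haar_measure G T J"
  shows "\<exists>c. \<forall>f\<in>Cc T. I f = c * J f"
proof -
  obtain g where g: "g \<in> Cc T" "\<forall>x. g x \<in> \<real>\<^sub>\<ge>\<^sub>0" "g \<one> = 1"
    using nonneg_bump[of \<one>] topspace_eq by auto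
  have Jg: "J g \<noteq> 0" using haar_pos[OF J g(1), of \<one>] g by auto
  have "I f = (I g / J g) * J f" if f: "f \<in> Cc T" for f
  proof -
    have "\<exists>c. \<forall>I. left_haar_measure G T I \<longrightarrow> I f = I g * c"
      by (rule haar_factor[OF J g(1) _ _ f]) (use g in auto)
    then obtain c where "\<forall>I. left_haar_measure G T I \<longrightarrow> I f = I g * c" ..
    then have "I f = I g * c" "J f = J g * c" using I J by blast+
    then show ?thesis using Jg by simp
  qed
  then show ?thesis by blast
qed

section \<open>Existence of Haar measure\<close>

text \<open>Weil's covering number (f : \<phi>). If \<phi> vanishes on the carrier the set may be
  empty, hence the assumption \<open>0 < \<phi> x0\<close> in the context below.\<close>

definition covering_number :: "('a \<Rightarrow> real) \<Rightarrow> ('a \<Rightarrow> real) \<Rightarrow> real" where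
  "covering_number f \<phi> = Inf {v. \<exists>h. translate_comb \<phi> v h \<and> (\<forall>x\<in>carrier G. f x \<le> h x)}"

lemma covering_number_le:
  "translate_comb \<phi> v h \<Longrightarrow> (\<And>x. x \<in> carrier G \<Longrightarrow> f x \<le> h x) \<Longrightarrow> covering_number f \<phi> \<le> v"
  unfolding covering_number_def
  by (rule cInf_lower) (auto intro: bdd_belowI[of _ 0] dest: translate_comb_nonneg)

context
  fixes \<phi> :: "'a \<Rightarrow> real" and x0 :: 'a
  assumes \<phi>: "\<phi> \<in> Ccp T" and x0: "x0 \<in> carrier G" "0 < \<phi> x0"
begin

lemma covering_number_approx:
  assumes "f \<in> Ccp T" "0 < \<epsilon>"
  shows "\<exists>v h. translate_comb \<phi> v h \<and> (\<forall>x\<in>carrier G. f x \<le> h x) \<and> v < covering_number f \<phi> + \<epsilon>"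
proof -
  let ?S = "{v. \<exists>h. translate_comb \<phi> v h \<and> (\<forall>x\<in>carrier G. f x \<le> h x)}"
  have ne: "?S \<noteq> {}" using translate_comb_exists[OF assms(1) \<phi> x0] by blast
  have "Inf ?S < covering_number f \<phi> + \<epsilon>" using assms(2) by (simp add: covering_number_def)
  from cInf_lessD[OF ne this] show ?thesis by blast
qed

lemma covering_number_greatest:
  assumes "f \<in> Ccp T" "\<And>v h. translate_comb \<phi> v h \<Longrightarrow> (\<And>x. x \<in> carrier G \<Longrightarrow> f x \<le> h x) \<Longrightarrow> b \<le> v"
  shows "b \<le> covering_number f \<phi>"
  unfolding covering_number_def
proof (rule cInf_greatest)
  show "{v. \<exists>h. translate_comb \<phi> v h \<and> (\<forall>x\<in>carrier G. f x \<le> h x)} \<noteq> {}"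
    using translate_comb_exists[OF assms(1) \<phi> x0] by blast
  fix v assume "v \<in> {v. \<exists>h. translate_comb \<phi> v h \<and> (\<forall>x\<in>carrier G. f x \<le> h x)}"
  then obtain h where "translate_comb \<phi> v h" "\<forall>x\<in>carrier G. f x \<le> h x" by blast
  then show "b \<le> v" using assms(2)[of v h] by blast
qed

lemma covering_number_nonneg: "f \<in> Ccp T \<Longrightarrow> 0 \<le> covering_number f \<phi>"
  by (rule covering_number_greatest) (auto dest: translate_comb_nonneg)

lemma covering_number_add:
  assumes f: "f \<in> Ccp T" and g: "g \<in> Ccp T"
  shows "covering_number (\<lambda>x. f x + g x) \<phi> \<le> covering_number f \<phi> + covering_number g \<phi>"
proof (rule field_le_epsilon)
  fix \<epsilon> :: real assume "0 < \<epsilon>"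
  then have \<epsilon>: "0 < \<epsilon> / 2" by simp
  obtain v h where v: "translate_comb \<phi> v h" "\<forall>x\<in>carrier G. f x \<le> h x" "v < covering_number f \<phi> + \<epsilon> / 2"
    using covering_number_approx[OF f \<epsilon>] by blast
  obtain w k where w: "translate_comb \<phi> w k" "\<forall>x\<in>carrier G. g x \<le> k x" "w < covering_number g \<phi> + \<epsilon> / 2"
    using covering_number_approx[OF g \<epsilon>] by blast
  have "covering_number (\<lambda>x. f x + g x) \<phi> \<le> v + w"
    by (rule covering_number_le[OF translate_comb_add[OF v(1) w(1)]]) (use v(2) w(2) in \<open>auto intro: add_mono\<close>)
  then show "covering_number (\<lambda>x. f x + g x) \<phi> \<le> covering_number f \<phi> + covering_number g \<phi> + \<epsilon>"
    using v(3) w(3) by linarith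
qed

lemma covering_number_scale_le:
  assumes f: "f \<in> Ccp T" and a: "0 < a"
  shows "covering_number (\<lambda>x. a * f x) \<phi> \<le> a * covering_number f \<phi>"
proof -
  have "covering_number (\<lambda>x. a * f x) \<phi> / a \<le> covering_number f \<phi>"
  proof (rule covering_number_greatest[OF f])
    fix v h assume v: "translate_comb \<phi> v h" "\<And>x. x \<in> carrier G \<Longrightarrow> f x \<le> h x"
    have "covering_number (\<lambda>x. a * f x) \<phi> \<le> a * v"
      by (rule covering_number_le[OF translate_comb_scale[OF v(1)]]) (use a v(2) in auto)
    then show "covering_number (\<lambda>x. a * f x) \<phi> / a \<le> v" using a by (simp add: field_simps)
  qed
  then show ?thesis using a by (simp add: field_simps)
qed

lemma covering_number_scale:
  assumes f: "f \<in> Ccp T" and a: "0 < a"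
  shows "covering_number (\<lambda>x. a * f x) \<phi> = a * covering_number f \<phi>"
proof -
  have "covering_number f \<phi> \<le> (1 / a) * covering_number (\<lambda>x. a * f x) \<phi>"
    using covering_number_scale_le[OF Ccp_scale[OF f, of a], of "1 / a"] a by simp
  then show ?thesis using covering_number_scale_le[OF f a] a by (simp add: field_simps)
qed

lemma covering_number_translate_le:
  assumes f: "f \<in> Ccp T" and g: "g \<in> carrier G"
  shows "covering_number (rtranslate g f) \<phi> \<le> covering_number f \<phi>"
proof (rule covering_number_greatest[OF f])
  fix v h assume v: "translate_comb \<phi> v h" "\<And>x. x \<in> carrier G \<Longrightarrow> f x \<le> h x"
  obtain h' where h': "translate_comb \<phi> v h'" "\<forall>x\<in>carrier G. h' x = h (g \<otimes> x)"
    using translate_comb_translate[OF v(1) g] by blast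
  show "covering_number (rtranslate g f) \<phi> \<le> v"
    by (rule covering_number_le[OF h'(1)]) (use h'(2) v(2) g in \<open>simp add: rtranslate_def\<close>)
qed

lemma covering_number_translate:
  assumes f: "f \<in> Ccp T" and g: "g \<in> carrier G"
  shows "covering_number (rtranslate g f) \<phi> = covering_number f \<phi>"
  using covering_number_translate_le[OF f g]
    covering_number_translate_le[OF rtranslate_Ccp[OF f g], of "inv g"] rtranslate_inverse[OF f g] g by simp

text \<open>At a point x, a combination of weight v is at most v times a bound B of \<phi>, so
  \<open>f x / B\<close> bounds every admissible v from below.\<close>

lemma covering_number_pos:
  assumes f: "f \<in> Ccp T" and x: "x \<in> carrier G" "0 < f x"
  shows "0 < covering_number f \<phi>"
proof -
  obtain B where B: "0 < B" "\<forall>x. \<phi> x \<le> B" using Ccp_bounded[OF \<phi>] by blast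
  have "f x / B \<le> covering_number f \<phi>"
  proof (rule covering_number_greatest[OF f])
    fix v h assume v: "translate_comb \<phi> v h" "\<And>x. x \<in> carrier G \<Longrightarrow> f x \<le> h x"
    have "f x \<le> v * B" using v(2)[OF x(1)] translate_comb_bound[OF v(1), of B x] B(2) by simp
    then show "f x / B \<le> v" using B(1) by (simp add: field_simps)
  qed
  moreover have "0 < f x / B" using x B by simp
  ultimately show ?thesis by linarith
qed

end

text \<open>Insert a near-optimal covering of \<phi> by \<psi> into one of f by \<phi>. This
  confines the normalised covering numbers to compact intervals that do not depend on the small
  function.\<close>

lemma covering_number_trans:
  assumes f: "f \<in> Ccp T" and \<phi>: "\<phi> \<in> Ccp T" "x \<in> carrier G" "0 < \<phi> x"
    and \<psi>: "\<psi> \<in> Ccp T" "y \<in> carrier G" "0 < \<psi> y"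
  shows "covering_number f \<psi> \<le> covering_number f \<phi> * covering_number \<phi> \<psi>"
proof (rule le_limit_at_right_0)
  show "((\<lambda>\<epsilon>. (covering_number f \<phi> + \<epsilon>) * (covering_number \<phi> \<psi> + \<epsilon>))
      \<longlongrightarrow> covering_number f \<phi> * covering_number \<phi> \<psi>) (at_right 0)"
    by (auto intro!: tendsto_eq_intros)
  fix \<epsilon> :: real assume \<epsilon>: "0 < \<epsilon>"
  obtain v h where v: "translate_comb \<phi> v h" "\<forall>x\<in>carrier G. f x \<le> h x" "v < covering_number f \<phi> + \<epsilon>"
    using covering_number_approx[OF \<phi> f \<epsilon>] by blast
  obtain w k where w: "translate_comb \<psi> w k" "\<forall>x\<in>carrier G. \<phi> x \<le> k x" "w < covering_number \<phi> \<psi> + \<epsilon>"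
    using covering_number_approx[OF \<psi> \<phi>(1) \<epsilon>] by blast
  obtain h' where h': "translate_comb \<psi> (v * w) h'" "\<forall>x\<in>carrier G. h x \<le> h' x"
    using translate_comb_trans[OF v(1) w(1)] w(2) by blast
  have "covering_number f \<psi> \<le> v * w"
    by (rule covering_number_le[OF h'(1)]) (use v(2) h'(2) order_trans in blast)
  also have "\<dots> \<le> (covering_number f \<phi> + \<epsilon>) * (covering_number \<phi> \<psi> + \<epsilon>)"
    using v(3) w(3) translate_comb_nonneg[OF v(1)] translate_comb_nonneg[OF w(1)] by (intro mult_mono) auto
  finally show "covering_number f \<psi> \<le> (covering_number f \<phi> + \<epsilon>) * (covering_number \<phi> \<psi> + \<epsilon>)" .
qed

text \<open>Stated with \<open>inv s\<close> because a translate of \<phi> by s, for \<phi>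
  supported near \<open>\<one>\<close>, is concentrated near \<open>inv s\<close>.\<close>

lemma uniformly_continuous_Cc:
  assumes f: "f \<in> Cc T" and \<delta>: "0 < \<delta>"
  shows "\<exists>V. openin T V \<and> \<one> \<in> V \<and>
    (\<forall>x\<in>carrier G. \<forall>s\<in>carrier G. s \<otimes> x \<in> V \<longrightarrow> norm (f x - f (inv s)) \<le> \<delta>)"
proof -
  have "continuous_map (prod_topology T T) T (\<lambda>z. snd z \<otimes> fst z)"
    by (intro continuous_map_group_mult continuous_map_fst continuous_map_snd)
  from continuous_map_compose[OF this Cc_continuous[OF f]]
  have "continuous_map (prod_topology T T) euclidean (\<lambda>z. f (snd z \<otimes> fst z))" by (simp add: o_def)
  from uniform_slice[OF this Cc_compact_support[OF f] _ \<delta>, of \<one>]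
  obtain U where U: "openin T U" "\<one> \<in> U" "\<forall>v\<in>U. \<forall>x\<in>fun_support T f. norm (f (x \<otimes> v) - f (x \<otimes> \<one>)) \<le> \<delta>"
    by (auto simp: topspace_eq)
  \<comment> \<open>The estimate from U needs its base point in the support of f. Symmetry of the
    neighbourhood lets either x or \<open>inv s\<close> be that point.\<close>
  let ?V = "U \<inter> {v \<in> topspace T. inv v \<in> U}"
  have supp: "fun_support T f \<subseteq> carrier G" using closedin_subset[OF closedin_fun_support] topspace_eq by metis
  have "openin T ?V"
    by (intro openin_Int U(1) openin_continuous_map_preimage[OF continuous_inv U(1)])
  moreover have "\<one> \<in> ?V" using U(2) by (simp add: topspace_eq)
  moreover have "norm (f x - f (inv s)) \<le> \<delta>" if x: "x \<in> carrier G" and s: "s \<in> carrier G" and sx: "s \<otimes> x \<in> ?V" for x s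
  proof -
    consider "inv s \<in> fun_support T f" | "x \<in> fun_support T f" | "inv s \<notin> fun_support T f" "x \<notin> fun_support T f"
      by blast
    then show ?thesis
    proof cases
      case 1
      moreover have "inv s \<otimes> (s \<otimes> x) = x" using x s by (simp flip: m_assoc)
      ultimately show ?thesis using U(3) sx s by force
    next
      case 2
      moreover have "x \<otimes> inv (s \<otimes> x) = inv s" using x s by (simp add: inv_mult_group flip: m_assoc)
      moreover have "inv (s \<otimes> x) \<in> U" using sx by blast
      ultimately have "norm (f (inv s) - f x) \<le> \<delta>" using U(3) x by force
      then show ?thesis by (simp add: norm_minus_commute)
    next
      case 3
      then show ?thesis using Cc_outside_support[OF f] \<delta> by simp
    qed
  qed
  ultimately show ?thesis by blast
qed

text \<open>Split a covering of h, slightly larger than \<open>f1 + f2\<close>, by multiplying it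
  with \<open>f1 / h\<close> and \<open>f2 / h\<close>. These quotients are almost constant on the
  support of a translate of a function concentrated near \<open>\<one>\<close>, so each part is
  dominated by the same translates with proportional weights.\<close>

lemma covering_number_almost_additive:
  assumes f: "f1 \<in> Ccp T" "f2 \<in> Ccp T" and g: "g \<in> Ccp T"
    and g1: "\<And>x. x \<in> fun_support T (\<lambda>x. complex_of_real (f1 x)) \<union> fun_support T (\<lambda>x. complex_of_real (f2 x)) \<Longrightarrow> g x = 1"
    and \<delta>: "0 < \<delta>"
  shows "\<exists>V. openin T V \<and> \<one> \<in> V \<and> (\<forall>\<phi>\<in>Ccp T. (\<exists>x\<in>carrier G. 0 < \<phi> x) \<longrightarrow> (\<forall>x. x \<notin> V \<longrightarrow> \<phi> x = 0) \<longrightarrow>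
    covering_number f1 \<phi> + covering_number f2 \<phi> \<le>
      (1 + 2 * \<delta>) * (covering_number (\<lambda>x. f1 x + f2 x) \<phi> + \<delta> * covering_number g \<phi>))"
proof -
  \<comment> \<open>The term \<open>\<delta> * g\<close> keeps h at least \<delta> on both supports,
    where g is 1; the quotients by h are then in C_c.\<close>
  define h where "h = (\<lambda>x. f1 x + f2 x + \<delta> * g x)"
  have hP: "h \<in> Ccp T"
    unfolding h_def using \<delta> by (intro Ccp_add Ccp_scale f g) auto
  have quot: "(\<lambda>x. of_real (f' x / h x)) \<in> Cc T"
    if "f' \<in> Ccp T" "\<And>x. x \<in> fun_support T (\<lambda>x. complex_of_real (f' x)) \<Longrightarrow> g x = 1" for f'
  proof -
    have "h x \<noteq> 0" if "g x = 1" for x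
      using that \<delta> CcpD(2)[OF f(1), of x] CcpD(2)[OF f(2), of x] by (simp add: h_def)
    then have "(\<lambda>x. complex_of_real (f' x) / complex_of_real (h x)) \<in> Cc T"
      using that by (intro Cc_divide CcpD(1) Cc_continuous[OF CcpD(1)[OF hP]]) auto
    then show ?thesis by simp
  qed
  define h1 where "h1 = (\<lambda>x. f1 x / h x)"
  define h2 where "h2 = (\<lambda>x. f2 x / h x)"
  have hc: "(\<lambda>x. of_real (h1 x)) \<in> Cc T" "(\<lambda>x. of_real (h2 x)) \<in> Cc T"
    unfolding h1_def h2_def by (rule quot; use f g1 in blast)+
  have nonneg: "0 \<le> h1 x" "0 \<le> h2 x" for x
    using CcpD(2)[OF f(1)] CcpD(2)[OF f(2)] CcpD(2)[OF hP] by (auto simp: h1_def h2_def)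
  have hsum: "h1 x + h2 x \<le> 1" for x
  proof -
    have "f1 x + f2 x \<le> h x" using \<delta> CcpD(2)[OF g, of x] by (simp add: h_def)
    then show ?thesis
      using CcpD(2)[OF hP, of x] by (cases "h x = 0") (auto simp: h1_def h2_def simp flip: add_divide_distrib)
  qed
  have fh: "f1 x = h x * h1 x" "f2 x = h x * h2 x" for x
  proof -
    have "0 \<le> \<delta> * g x" using \<delta> CcpD(2)[OF g] by simp
    then have "h x = 0 \<Longrightarrow> f1 x = 0 \<and> f2 x = 0"
      using CcpD(2)[OF f(1), of x] CcpD(2)[OF f(2), of x] unfolding h_def by linarith
    then show "f1 x = h x * h1 x" "f2 x = h x * h2 x" by (auto simp: h1_def h2_def)
  qed
  obtain V1 where V1: "openin T V1" "\<one> \<in> V1" "\<forall>x\<in>carrier G. \<forall>s\<in>carrier G. s \<otimes> x \<in> V1 \<longrightarrow>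
      norm (complex_of_real (h1 x) - complex_of_real (h1 (inv s))) \<le> \<delta>"
    using uniformly_continuous_Cc[OF hc(1) \<delta>] by blast
  obtain V2 where V2: "openin T V2" "\<one> \<in> V2" "\<forall>x\<in>carrier G. \<forall>s\<in>carrier G. s \<otimes> x \<in> V2 \<longrightarrow>
      norm (complex_of_real (h2 x) - complex_of_real (h2 (inv s))) \<le> \<delta>"
    using uniformly_continuous_Cc[OF hc(2) \<delta>] by blast
  have near: "h1 x \<le> h1 (inv s) + \<delta>" "h2 x \<le> h2 (inv s) + \<delta>"
    if "x \<in> carrier G" "s \<in> carrier G" "s \<otimes> x \<in> V1 \<inter> V2" for x s
  proof -
    have "\<bar>h1 x - h1 (inv s)\<bar> \<le> \<delta>" "\<bar>h2 x - h2 (inv s)\<bar> \<le> \<delta>"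
      using V1(3) V2(3) that by (auto simp flip: of_real_diff)
    then show "h1 x \<le> h1 (inv s) + \<delta>" "h2 x \<le> h2 (inv s) + \<delta>" by linarith+
  qed
  have "covering_number f1 \<phi> + covering_number f2 \<phi> \<le>
      (1 + 2 * \<delta>) * (covering_number (\<lambda>x. f1 x + f2 x) \<phi> + \<delta> * covering_number g \<phi>)"
    if \<phi>: "\<phi> \<in> Ccp T" and x0: "\<exists>x\<in>carrier G. 0 < \<phi> x" and V: "\<forall>x. x \<notin> V1 \<inter> V2 \<longrightarrow> \<phi> x = 0" for \<phi>
  proof -
    obtain x0 where x0: "x0 \<in> carrier G" "0 < \<phi> x0" using x0 by blast
    have split: "\<exists>v1 k1 v2 k2. translate_comb \<phi> v1 k1 \<and> translate_comb \<phi> v2 k2 \<and> v1 + v2 \<le> (1 + 2 * \<delta>) * v \<and>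
        (\<forall>x\<in>carrier G. H x * h1 x \<le> k1 x \<and> H x * h2 x \<le> k2 x)" if "translate_comb \<phi> v H" for v H
      using that
    proof (induction rule: translate_comb.induct)
      case zero
      show ?case by (intro exI[of _ 0] exI[of _ "\<lambda>x. 0"] conjI translate_comb.zero) auto
    next
      case (step v H c s)
      then obtain v1 k1 v2 k2 where k: "translate_comb \<phi> v1 k1" "translate_comb \<phi> v2 k2" "v1 + v2 \<le> (1 + 2 * \<delta>) * v"
          "\<forall>x\<in>carrier G. H x * h1 x \<le> k1 x \<and> H x * h2 x \<le> k2 x" by blast
      \<comment> \<open>Where \<open>\<phi> (s \<otimes> x)\<close> is nonzero, x is so close to
        \<open>inv s\<close> that h1 exceeds its value there by at most \<delta>. As
        \<open>h1 + h2\<close> is at most 1, the new weights add up to at most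
        \<open>c * (1 + 2 * \<delta>)\<close>.\<close>
      define c1 where "c1 = c * (h1 (inv s) + \<delta>)"
      define c2 where "c2 = c * (h2 (inv s) + \<delta>)"
      have c0: "0 \<le> c1" "0 \<le> c2" using step.hyps(2) nonneg \<delta> by (auto simp: c1_def c2_def less_imp_le)
      have "c1 + c2 = c * (h1 (inv s) + h2 (inv s) + 2 * \<delta>)"
        by (simp add: c1_def c2_def algebra_simps)
      also have "\<dots> \<le> c * (1 + 2 * \<delta>)"
        using step.hyps(2) hsum by (intro mult_left_mono) auto
      finally have "(v1 + c1) + (v2 + c2) \<le> (1 + 2 * \<delta>) * (v + c)"
        using k(3) by (simp add: algebra_simps)
      moreover have "(H x + c * \<phi> (s \<otimes> x)) * h1 x \<le> k1 x + c1 * \<phi> (s \<otimes> x) \<and>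
          (H x + c * \<phi> (s \<otimes> x)) * h2 x \<le> k2 x + c2 * \<phi> (s \<otimes> x)" if x: "x \<in> carrier G" for x
      proof -
        have "c * \<phi> (s \<otimes> x) * h1 x \<le> c1 * \<phi> (s \<otimes> x) \<and> c * \<phi> (s \<otimes> x) * h2 x \<le> c2 * \<phi> (s \<otimes> x)"
        proof (cases "s \<otimes> x \<in> V1 \<inter> V2")
          case True
          have "0 \<le> c * \<phi> (s \<otimes> x)" using step.hyps(2) CcpD(2)[OF \<phi>] by simp
          from mult_left_mono[OF near(1)[OF x step.hyps(3) True] this]
            mult_left_mono[OF near(2)[OF x step.hyps(3) True] this]
          show ?thesis by (simp add: c1_def c2_def mult_ac)
        next
          case False
          then show ?thesis using V by simp
        qed
        then show ?thesis using k(4) x by (auto simp: distrib_right intro: add_mono)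
      qed
      ultimately show ?case
        using translate_comb.step[OF k(1) c0(1) step.hyps(3)] translate_comb.step[OF k(2) c0(2) step.hyps(3)] by blast
    qed
    have "(covering_number f1 \<phi> + covering_number f2 \<phi>) / (1 + 2 * \<delta>) \<le> covering_number h \<phi>"
    proof (rule covering_number_greatest[OF \<phi> x0 hP])
      fix v H assume v: "translate_comb \<phi> v H" "\<And>x. x \<in> carrier G \<Longrightarrow> h x \<le> H x"
      obtain v1 k1 v2 k2 where k: "translate_comb \<phi> v1 k1" "translate_comb \<phi> v2 k2" "v1 + v2 \<le> (1 + 2 * \<delta>) * v"
          "\<forall>x\<in>carrier G. H x * h1 x \<le> k1 x \<and> H x * h2 x \<le> k2 x" using split[OF v(1)] by blast
      have "f1 x \<le> k1 x \<and> f2 x \<le> k2 x" if "x \<in> carrier G" for x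
        using k(4) that mult_right_mono[OF v(2)[OF that] nonneg(1)[of x]] mult_right_mono[OF v(2)[OF that] nonneg(2)[of x]]
          fh[of x] by fastforce
      then have "covering_number f1 \<phi> \<le> v1" "covering_number f2 \<phi> \<le> v2"
        by (auto intro: covering_number_le[OF k(1)] covering_number_le[OF k(2)])
      then have "covering_number f1 \<phi> + covering_number f2 \<phi> \<le> (1 + 2 * \<delta>) * v" using k(3) by linarith
      then show "(covering_number f1 \<phi> + covering_number f2 \<phi>) / (1 + 2 * \<delta>) \<le> v"
        using \<delta> by (simp add: pos_divide_le_eq mult.commute)
    qed
    also have "covering_number h \<phi> \<le> covering_number (\<lambda>x. f1 x + f2 x) \<phi> + covering_number (\<lambda>x. \<delta> * g x) \<phi>"
      unfolding h_def using \<delta> by (intro covering_number_add[OF \<phi> x0] Ccp_add Ccp_scale f g) auto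
    also have "covering_number (\<lambda>x. \<delta> * g x) \<phi> = \<delta> * covering_number g \<phi>"
      by (rule covering_number_scale[OF \<phi> x0 g \<delta>])
    finally show ?thesis using \<delta> by (simp add: pos_divide_le_eq mult.commute)
  qed
  then show ?thesis
    using V1 V2 by (intro exI[of _ "V1 \<inter> V2"]) auto
qed

text \<open>Covering numbers are homogeneous, invariant and subadditive, and nearly additive once
  \<phi> is concentrated near \<open>\<one>\<close>. Their quotients by the covering number of f0
  lie in a compact product; a cluster point as the support of \<phi> shrinks to
  \<open>\<one>\<close> inherits these properties and is additive.\<close>

lemma haar_functional_exists:
  "\<exists>I. (\<forall>f\<in>Ccp T. 0 \<le> I f) \<and> (\<exists>f\<in>Ccp T. I f = 1) \<and>
     (\<forall>f\<in>Ccp T. \<forall>g\<in>Ccp T. I (\<lambda>x. f x + g x) = I f + I g) \<and>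
     (\<forall>f\<in>Ccp T. \<forall>a>0. I (\<lambda>x. a * f x) = a * I f) \<and>
     (\<forall>f\<in>Ccp T. \<forall>g\<in>carrier G. I (rtranslate g f) = (I f :: real))"
proof -
  let ?P = "Ccp T"
  have one: "compactin T {\<one>}" by (simp add: topspace_eq)
  obtain f0 where f0: "f0 \<in> ?P" "f0 \<one> = 1" using Ccp_cutoff[OF one] by blast
  have f0': "\<one> \<in> carrier G" "0 < f0 \<one>" using f0 by auto
  \<comment> \<open>By \<open>covering_number_trans\<close>, the quotient of the covering numbers of
    f and f0 by \<phi> is at most that of f by f0, whatever \<phi> is.\<close>
  define S where "S = (\<Pi>\<^sub>E f\<in>?P. {0..covering_number f f0})"
  let ?X = "product_topology (\<lambda>_. euclideanreal) ?P"
  define Q where "Q = (\<lambda>\<phi>. \<lambda>f\<in>?P. covering_number f \<phi> / covering_number f0 \<phi>)"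
  define B where "B = (\<lambda>V. {\<phi>\<in>?P. (\<exists>x\<in>carrier G. 0 < \<phi> x) \<and> (\<forall>x. x \<notin> V \<longrightarrow> \<phi> x = 0)})"
  define \<V> where "\<V> = {V. openin T V \<and> \<one> \<in> V}"
  have top: "topspace ?X = (\<Pi>\<^sub>E f\<in>?P. UNIV)" by simp
  have S: "compactin ?X S" unfolding S_def by (subst compactin_PiE) (simp add: compactin_euclidean_iff)
  have pos: "0 < covering_number f0 \<phi>" if \<phi>: "\<phi> \<in> B V" for \<phi> V
  proof -
    obtain x where "\<phi> \<in> ?P" "x \<in> carrier G" "0 < \<phi> x" using \<phi> by (auto simp: B_def)
    from covering_number_pos[OF this f0(1) f0'] show ?thesis .
  qed
  have QS: "Q \<phi> \<in> S" if \<phi>: "\<phi> \<in> B V" for \<phi> V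
  proof -
    obtain x where x: "\<phi> \<in> ?P" "x \<in> carrier G" "0 < \<phi> x" using \<phi> by (auto simp: B_def)
    have "covering_number f \<phi> \<le> covering_number f f0 * covering_number f0 \<phi>" "0 \<le> covering_number f \<phi>"
      if f: "f \<in> ?P" for f
      by (rule covering_number_trans[OF f f0(1) f0' x], rule covering_number_nonneg[OF x f])
    then show ?thesis using pos[OF \<phi>] by (auto simp: Q_def S_def pos_divide_le_eq)
  qed
  have B_ne: "B V \<noteq> {}" if V: "V \<in> \<V>" for V
  proof -
    have "openin T V" "{\<one>} \<subseteq> V" using V by (auto simp: \<V>_def)
    from Urysohn_cutoff[OF one this] obtain f L where "(\<lambda>x. of_real (f x)) \<in> Cc T"
        "\<forall>x. 0 \<le> f x \<and> f x \<le> (1::real)" "\<forall>x\<in>{\<one>}. f x = 1" "L \<subseteq> V" "\<forall>x. x \<notin> L \<longrightarrow> f x = 0"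
      by (elim exE conjE) (rule that)
    then have "f \<in> B V" by (auto simp: B_def Ccp_def intro!: bexI[of _ \<one>])
    then show ?thesis by blast
  qed
  define \<C> where "\<C> = (\<lambda>V. ?X closure_of (Q ` B V)) ` \<V>"
  have "S \<inter> \<Inter>\<F> \<noteq> {}" if \<F>: "finite \<F>" "\<F> \<subseteq> \<C>" for \<F>
  proof -
    obtain \<W> where \<W>: "finite \<W>" "\<W> \<subseteq> \<V>" "\<F> = (\<lambda>V. ?X closure_of (Q ` B V)) ` \<W>"
      using \<F> unfolding \<C>_def by (meson finite_subset_image)
    \<comment> \<open>The intersection with the whole space takes care of the empty family.\<close>
    let ?W = "topspace T \<inter> \<Inter>\<W>"
    have "openin T ?W"
    proof (cases "\<W> = {}")
      case False
      then have "openin T (\<Inter>\<W>)" using \<W> by (intro openin_Inter) (auto simp: \<V>_def)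
      then show ?thesis by (rule openin_Int[OF openin_topspace])
    qed simp
    then have "?W \<in> \<V>" using \<W> by (auto simp: \<V>_def topspace_eq)
    from B_ne[OF this] obtain \<phi> where \<phi>: "\<phi> \<in> B ?W" by blast
    have "Q \<phi> \<in> ?X closure_of (Q ` B V)" if "V \<in> \<W>" for V
    proof -
      have "\<phi> \<in> B V" using \<phi> that by (auto simp: B_def)
      moreover have "Q ` B V \<subseteq> topspace ?X" by (auto simp: Q_def)
      ultimately show ?thesis using closure_of_subset by blast
    qed
    then show ?thesis using QS[OF \<phi>] \<W>(3) by blast
  qed
  moreover have "\<forall>C\<in>\<C>. closedin ?X C" by (auto simp: \<C>_def)
  ultimately have "S \<inter> \<Inter>\<C> \<noteq> {}" using S unfolding compactin_fip by blast
  then obtain I where I: "I \<in> S" "\<And>V. V \<in> \<V> \<Longrightarrow> I \<in> ?X closure_of (Q ` B V)"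
    unfolding \<C>_def by blast
  \<comment> \<open>Closed conditions pass to the cluster point: an inequality between continuous
    functions of the coordinates that holds for all \<phi> concentrated in one V holds for
    I.\<close>
  have lim: "0 \<le> h I" if V: "V \<in> \<V>" and h: "continuous_map ?X euclideanreal h"
    and nn: "\<And>\<phi>. \<phi> \<in> B V \<Longrightarrow> 0 \<le> h (Q \<phi>)" for V h
  proof -
    have "closedin ?X {J \<in> topspace ?X. h J \<in> {0..}}"
      by (rule closedin_continuous_map_preimage[OF h]) auto
    moreover have "Q ` B V \<subseteq> {J \<in> topspace ?X. h J \<in> {0..}}" using nn by (auto simp: Q_def)
    ultimately have "?X closure_of (Q ` B V) \<subseteq> {J \<in> topspace ?X. h J \<in> {0..}}"
      by (rule closure_of_minimal[rotated])
    then show ?thesis using I(2)[OF V] by auto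
  qed
  have carr: "carrier G \<in> \<V>" using openin_topspace[of T] by (simp add: \<V>_def topspace_eq)
  have proj: "continuous_map ?X euclideanreal (\<lambda>J. J f)" if "f \<in> ?P" for f
    using that by (rule continuous_map_product_projection)
  note cont = continuous_map_add continuous_map_diff continuous_map_real_mult_left proj
  have B_carr: "\<exists>x. \<phi> \<in> ?P \<and> x \<in> carrier G \<and> 0 < \<phi> x" if "\<phi> \<in> B V" for \<phi> V
    using that by (auto simp: B_def)
  have Qf: "Q \<phi> f = covering_number f \<phi> / covering_number f0 \<phi>" if "f \<in> ?P" for f \<phi>
    using that by (simp add: Q_def)
  have I0: "0 \<le> I f" if "f \<in> ?P" for f
    using I(1) that by (auto simp: S_def PiE_iff)
  have norm1: "I f0 = 1"
  proof -
    have "0 \<le> I f0 - 1"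
      by (rule lim[OF carr, of "\<lambda>J. J f0 - 1"]) (use pos Qf[OF f0(1)] in \<open>auto intro!: cont f0\<close>, fastforce)
    moreover have "0 \<le> 1 - I f0"
      by (rule lim[OF carr, of "\<lambda>J. 1 - J f0"]) (use pos Qf[OF f0(1)] in \<open>auto intro!: cont f0\<close>)
    ultimately show ?thesis by simp
  qed
  have add: "I (\<lambda>x. f x + g x) = I f + I g" if f: "f \<in> ?P" and g: "g \<in> ?P" for f g
  proof (rule antisym)
    note fg = Ccp_add[OF f g]
    have "0 \<le> (I f + I g) - I (\<lambda>x. f x + g x)"
    proof (rule lim[OF carr, of "\<lambda>J. (J f + J g) - J (\<lambda>x. f x + g x)"])
      show "continuous_map ?X euclideanreal (\<lambda>J. (J f + J g) - J (\<lambda>x. f x + g x))"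
        by (intro cont f g fg)
      fix \<phi> assume \<phi>: "\<phi> \<in> B (carrier G)"
      then obtain x where x: "\<phi> \<in> ?P" "x \<in> carrier G" "0 < \<phi> x" using B_carr by blast
      show "0 \<le> (Q \<phi> f + Q \<phi> g) - Q \<phi> (\<lambda>x. f x + g x)"
        using covering_number_add[OF x f g] pos[OF \<phi>]
        by (simp add: Qf f g fg divide_right_mono flip: add_divide_distrib)
    qed
    then show "I (\<lambda>x. f x + g x) \<le> I f + I g" by simp
    let ?K = "fun_support T (\<lambda>x. complex_of_real (f x)) \<union> fun_support T (\<lambda>x. complex_of_real (g x))"
    have "compactin T ?K" by (intro compactin_Un Cc_compact_support CcpD f g)
    from Ccp_cutoff[OF this] obtain k where k: "k \<in> ?P" "\<forall>x\<in>?K. k x = 1" by blast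
    have bound: "I f + I g \<le> (1 + 2 * \<delta>) * (I (\<lambda>x. f x + g x) + \<delta> * I k)" if \<delta>: "0 < \<delta>" for \<delta>
    proof -
      have "\<exists>V. openin T V \<and> \<one> \<in> V \<and> (\<forall>\<phi>\<in>Ccp T. (\<exists>x\<in>carrier G. 0 < \<phi> x) \<longrightarrow> (\<forall>x. x \<notin> V \<longrightarrow> \<phi> x = 0) \<longrightarrow>
          covering_number f \<phi> + covering_number g \<phi> \<le>
            (1 + 2 * \<delta>) * (covering_number (\<lambda>x. f x + g x) \<phi> + \<delta> * covering_number k \<phi>))"
        by (rule covering_number_almost_additive[OF f g k(1) _ \<delta>]) (use k(2) in blast)
      then obtain V where V: "V \<in> \<V>" "\<forall>\<phi>\<in>B V. covering_number f \<phi> + covering_number g \<phi> \<le>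
            (1 + 2 * \<delta>) * (covering_number (\<lambda>x. f x + g x) \<phi> + \<delta> * covering_number k \<phi>)"
        unfolding B_def \<V>_def by blast
      have "0 \<le> (1 + 2 * \<delta>) * (I (\<lambda>x. f x + g x) + \<delta> * I k) - (I f + I g)"
      proof (rule lim[OF V(1), of "\<lambda>J. (1 + 2 * \<delta>) * (J (\<lambda>x. f x + g x) + \<delta> * J k) - (J f + J g)"])
        show "continuous_map ?X euclideanreal (\<lambda>J. (1 + 2 * \<delta>) * (J (\<lambda>x. f x + g x) + \<delta> * J k) - (J f + J g))"
          by (intro cont f g fg k(1))
        fix \<phi> assume \<phi>: "\<phi> \<in> B V"
        let ?c = "covering_number f0 \<phi>"
        have "(covering_number f \<phi> + covering_number g \<phi>) / ?c \<le>
            (1 + 2 * \<delta>) * (covering_number (\<lambda>x. f x + g x) \<phi> + \<delta> * covering_number k \<phi>) / ?c"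
          using V(2) \<phi> pos[OF \<phi>] by (intro divide_right_mono) auto
        also have "\<dots> = (1 + 2 * \<delta>) * (covering_number (\<lambda>x. f x + g x) \<phi> / ?c + \<delta> * (covering_number k \<phi> / ?c))"
          using pos[OF \<phi>] by (simp add: field_simps)
        finally show "0 \<le> (1 + 2 * \<delta>) * (Q \<phi> (\<lambda>x. f x + g x) + \<delta> * Q \<phi> k) - (Q \<phi> f + Q \<phi> g)"
          by (simp only: Qf f g fg k(1) add_divide_distrib diff_ge_0_iff_ge)
      qed
      then show ?thesis by simp
    qed
    show "I f + I g \<le> I (\<lambda>x. f x + g x)"
      by (rule le_limit_at_right_0[OF _ bound]) (auto intro!: tendsto_eq_intros)
  qed
  have eq_lim: "I f = a * I g" if f: "f \<in> ?P" and g: "g \<in> ?P"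
    and eq: "\<And>\<phi> x. \<phi> \<in> ?P \<Longrightarrow> x \<in> carrier G \<Longrightarrow> 0 < \<phi> x \<Longrightarrow> covering_number f \<phi> = a * covering_number g \<phi>" for f g a
  proof -
    have Q_eq: "Q \<phi> f = a * Q \<phi> g" if "\<phi> \<in> B (carrier G)" for \<phi>
      using B_carr[OF that] eq by (auto simp: Qf f g)
    have "0 \<le> I f - a * I g"
      by (rule lim[OF carr, of "\<lambda>J. J f - a * J g"]) (intro cont f g, simp add: Q_eq)
    moreover have "0 \<le> a * I g - I f"
      by (rule lim[OF carr, of "\<lambda>J. a * J g - J f"]) (intro cont f g, simp add: Q_eq)
    ultimately show ?thesis by simp
  qed
  have scale: "I (\<lambda>x. a * f x) = a * I f" if f: "f \<in> ?P" and a: "0 < a" for f a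
    by (rule eq_lim[OF Ccp_scale[OF f less_imp_le[OF a]] f covering_number_scale[OF _ _ _ f a]])
  have trans: "I (rtranslate g f) = I f" if f: "f \<in> ?P" and g: "g \<in> carrier G" for f g
    using eq_lim[OF rtranslate_Ccp[OF f g] f, of 1] covering_number_translate[OF _ _ _ f g] by simp
  show ?thesis
    using I0 f0(1) norm1 add scale trans by (intro exI[of _ I]) blast
qed

text \<open>Extends the functional from the cone to real functions through positive and negative
  parts, then to complex functions through real and imaginary parts;
  \<open>positive_form_radon\<close> supplies the continuity.\<close>

lemma haar_exists: "\<exists>m. left_haar_measure G T m"
proof -
  obtain I where I0: "\<forall>f\<in>Ccp T. 0 \<le> I f" and I1: "\<exists>f\<in>Ccp T. I f = (1::real)"
    and add: "\<forall>f\<in>Ccp T. \<forall>g\<in>Ccp T. I (\<lambda>x. f x + g x) = I f + I g"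
    and scale: "\<forall>f\<in>Ccp T. \<forall>a>0. I (\<lambda>x. a * f x) = a * I f"
    and trans: "\<forall>f\<in>Ccp T. \<forall>g\<in>carrier G. I (rtranslate g f) = I f"
    using haar_functional_exists by (elim exE conjE) (rule that)
  have zeroP: "(\<lambda>x. 0) \<in> Ccp T" using Cc_zero by (simp add: Ccp_def)
  have zero: "I (\<lambda>x. 0) = 0" using add[rule_format, OF zeroP zeroP] by simp
  have scale0: "I (\<lambda>x. a * f x) = a * I f" if "f \<in> Ccp T" "0 \<le> a" for a f
    using scale that zero by (cases "a = 0") auto
  define R where "R = {r. (\<lambda>x. of_real (r x)) \<in> Cc T}"
  have PR: "(\<lambda>x. max 0 (r x)) \<in> Ccp T" "(\<lambda>x. max 0 (- r x)) \<in> Ccp T" if "r \<in> R" for r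
    using Ccp_max[of r 0] Ccp_max[of "\<lambda>x. - r x" 0] that Cc_scale[of "\<lambda>x. complex_of_real (r x)" "-1"]
    by (simp_all add: R_def)
  define E where "E = (\<lambda>r. I (\<lambda>x. max 0 (r x)) - I (\<lambda>x. max 0 (- r x)))"
  \<comment> \<open>Any decomposition into nonnegative functions computes E. This gives additivity
    although positive parts are not additive.\<close>
  have E_diff: "E (\<lambda>x. a x - b x) = I a - I b" if a: "a \<in> Ccp T" and b: "b \<in> Ccp T" for a b
  proof -
    have "(\<lambda>x. a x - b x) \<in> R" using Cc_diff[OF CcpD(1)[OF a] CcpD(1)[OF b]] by (simp add: R_def)
    note parts = PR[OF this]
    have "(\<lambda>x. max 0 (a x - b x) + b x) = (\<lambda>x. max 0 (- (a x - b x)) + a x)" by (auto simp: max_def)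
    then have "I (\<lambda>x. max 0 (a x - b x)) + I b = I (\<lambda>x. max 0 (- (a x - b x))) + I a"
      using add[rule_format, OF parts(1) b] add[rule_format, OF parts(2) a] by simp
    then show ?thesis by (simp add: E_def)
  qed
  have split: "r = (\<lambda>x. max 0 (r x) - max 0 (- r x))" for r :: "'a \<Rightarrow> real" by (auto simp: max_def)
  have E_add: "E (\<lambda>x. r x + s x) = E r + E s" if r: "r \<in> R" and s: "s \<in> R" for r s
  proof -
    have "(\<lambda>x. r x + s x) =
        (\<lambda>x. (max 0 (r x) + max 0 (s x)) - (max 0 (- r x) + max 0 (- s x)))"
      by (auto simp: max_def)
    then have "E (\<lambda>x. r x + s x) = I (\<lambda>x. max 0 (r x) + max 0 (s x)) - I (\<lambda>x. max 0 (- r x) + max 0 (- s x))"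
      using E_diff[OF Ccp_add[OF PR(1)[OF r] PR(1)[OF s]] Ccp_add[OF PR(2)[OF r] PR(2)[OF s]]] by simp
    then show ?thesis using add PR[OF r] PR[OF s] by (simp add: E_def)
  qed
  have E_scale: "E (\<lambda>x. c * r x) = c * E r" if r: "r \<in> R" for c r
  proof (cases "0 \<le> c")
    case True
    have "(\<lambda>x. c * r x) = (\<lambda>x. c * max 0 (r x) - c * max 0 (- r x))" by (auto simp: max_def)
    then have "E (\<lambda>x. c * r x) = I (\<lambda>x. c * max 0 (r x)) - I (\<lambda>x. c * max 0 (- r x))"
      using E_diff[OF Ccp_scale[OF PR(1)[OF r] True] Ccp_scale[OF PR(2)[OF r] True]] by simp
    then show ?thesis using scale0 PR[OF r] True by (simp add: E_def right_diff_distrib)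
  next
    case False
    then have c: "0 \<le> - c" by simp
    have "(\<lambda>x. c * r x) = (\<lambda>x. - c * max 0 (- r x) - (- c) * max 0 (r x))" by (auto simp: max_def)
    then have "E (\<lambda>x. c * r x) = I (\<lambda>x. - c * max 0 (- r x)) - I (\<lambda>x. - c * max 0 (r x))"
      using E_diff[OF Ccp_scale[OF PR(2)[OF r] c] Ccp_scale[OF PR(1)[OF r] c]] by simp
    then show ?thesis
      using scale0[OF PR(1)[OF r] c] scale0[OF PR(2)[OF r] c] by (simp add: E_def algebra_simps)
  qed
  have R_scale: "(\<lambda>x. c * r x) \<in> R" if "r \<in> R" for c r
    using Cc_scale[of "\<lambda>x. complex_of_real (r x)" "complex_of_real c"] that by (simp add: R_def)
  have ReR: "(\<lambda>x. Re (f x)) \<in> R" and ImR: "(\<lambda>x. Im (f x)) \<in> R" if "f \<in> Cc T" for f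
    using Cc_Re[OF that] Cc_Im[OF that] by (simp_all add: R_def)
  define m where "m = (\<lambda>f\<in>Cc T. Complex (E (\<lambda>x. Re (f x))) (E (\<lambda>x. Im (f x))))"
  have m_add: "m (\<lambda>x. f x + g x) = m f + m g" if "f \<in> Cc T" "g \<in> Cc T" for f g
    using that E_add ReR ImR Cc_add by (simp add: m_def complex_eq_iff)
  have m_scale: "m (\<lambda>x. c * f x) = c * m f" if f: "f \<in> Cc T" for c f
  proof -
    note R' = ReR[OF f] ImR[OF f]
    have "E (\<lambda>x. Re c * Re (f x) + - Im c * Im (f x)) = Re c * E (\<lambda>x. Re (f x)) + - Im c * E (\<lambda>x. Im (f x))"
      by (simp only: E_add[OF R_scale[OF R'(1)] R_scale[OF R'(2)]] E_scale[OF R'(1)] E_scale[OF R'(2)])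
    moreover have "E (\<lambda>x. Re c * Im (f x) + Im c * Re (f x)) = Re c * E (\<lambda>x. Im (f x)) + Im c * E (\<lambda>x. Re (f x))"
      by (simp only: E_add[OF R_scale[OF R'(2)] R_scale[OF R'(1)]] E_scale[OF R'(1)] E_scale[OF R'(2)])
    ultimately show ?thesis using f Cc_scale[OF f, of c] by (simp add: m_def complex_eq_iff)
  qed
  have m_real: "m (\<lambda>x. complex_of_real (f x)) = complex_of_real (I f)" if f: "f \<in> Ccp T" for f
  proof -
    have "E (\<lambda>x. 0) = 0" using zero by (simp add: E_def)
    moreover have "E f = I f" using E_diff[OF f zeroP] zero by simp
    ultimately show ?thesis using CcpD(1)[OF f] by (simp add: m_def complex_eq_iff)
  qed
  have m_pos: "m f \<in> \<real>\<^sub>\<ge>\<^sub>0" if f: "f \<in> Cc T" "\<And>x. f x \<in> \<real>\<^sub>\<ge>\<^sub>0" for f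
  proof -
    have f_eq: "f = (\<lambda>x. complex_of_real (Re (f x)))"
      using f(2) by (auto simp: complex_nonneg_Reals_iff complex_eq_iff)
    moreover have "(\<lambda>x. Re (f x)) \<in> Ccp T"
      using f f_eq by (auto simp: Ccp_def complex_nonneg_Reals_iff)
    ultimately have "m f = complex_of_real (I (\<lambda>x. Re (f x)))" "0 \<le> I (\<lambda>x. Re (f x))"
      using m_real I0 by (metis, blast)
    then show ?thesis by simp
  qed
  have E_trans: "E (rtranslate g r) = E r" if r: "r \<in> R" and g: "g \<in> carrier G" for r g
  proof -
    have "(\<lambda>x. max 0 (rtranslate g r x)) = rtranslate g (\<lambda>x. max 0 (r x))"
      "(\<lambda>x. max 0 (- rtranslate g r x)) = rtranslate g (\<lambda>x. max 0 (- r x))"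
      by (auto simp: rtranslate_def)
    then show ?thesis using trans PR[OF r] g by (simp add: E_def)
  qed
  have m_trans: "m (\<lambda>x. if x \<in> carrier G then f (g \<otimes> x) else 0) = m f" if f: "f \<in> Cc T" and g: "g \<in> carrier G" for f g
  proof -
    have "(\<lambda>x. Re (if x \<in> carrier G then f (g \<otimes> x) else 0)) = rtranslate g (\<lambda>x. Re (f x))"
      "(\<lambda>x. Im (if x \<in> carrier G then f (g \<otimes> x) else 0)) = rtranslate g (\<lambda>x. Im (f x))"
      by (auto simp: rtranslate_def)
    moreover have "(\<lambda>x. if x \<in> carrier G then f (g \<otimes> x) else 0) \<in> Cc T"
      using translate_Cc[OF f g] by (simp add: translate_def)
    ultimately show ?thesis
      using f E_trans[OF ReR[OF f] g] E_trans[OF ImR[OF f] g] by (simp add: m_def)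
  qed
  have "m \<in> extensional (Cc T)"
    unfolding m_def by (rule restrict_extensional)
  then have "m \<in> radon_measures T"
    by (rule positive_form_radon[OF _ m_add m_scale m_pos])
  moreover have "\<exists>f\<in>Cc T. m f \<noteq> 0"
  proof -
    obtain f where "f \<in> Ccp T" "I f = 1" using I1 by blast
    then show ?thesis
      using m_real by (intro bexI[of _ "\<lambda>x. complex_of_real (f x)"] CcpD(1)) auto
  qed
  ultimately show ?thesis
    unfolding left_haar_measure_def using m_pos m_trans by blast
qed

end

lemma proper_continuous_map_cong:
  assumes "\<And>x. x \<in> topspace X \<Longrightarrow> p x = q x"
  shows "proper_continuous_map X Y p \<longleftrightarrow> proper_continuous_map X Y q"
proof -
  have "continuous_map X Y p \<longleftrightarrow> continuous_map X Y q"
    using continuous_map_eq[of X Y p q] continuous_map_eq[of X Y q p] assms by auto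
  moreover have "{x \<in> topspace X. p x \<in> K} = {x \<in> topspace X. q x \<in> K}" for K
    using assms by auto
  ultimately show ?thesis by (simp add: proper_continuous_map_def)
qed

section \<open>Measures with density and Weil's formula\<close>

context locally_compact_Hausdorff begin

lemma density_measure_radon:
  assumes m: "m \<in> radon_measures X" and \<phi>: "continuous_map X euclidean \<phi>"
  shows "density_measure X \<phi> m \<in> radon_measures X"
proof -
  let ?\<mu> = "density_measure X \<phi> m"
  have "?\<mu> (\<lambda>x. f x + g x) = ?\<mu> f + ?\<mu> g" if "f \<in> Cc X" "g \<in> Cc X" for f g
    using that radon_add[OF m Cc_mult[OF _ \<phi>] Cc_mult[OF _ \<phi>]] Cc_add
    by (simp add: density_measure_def distrib_left)
  moreover have "?\<mu> (\<lambda>x. c * f x) = c * ?\<mu> f" if "f \<in> Cc X" for c f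
    using that radon_scale[OF m Cc_mult[OF _ \<phi>], of f c] Cc_scale
    by (simp add: density_measure_def mult.left_commute)
  moreover have "\<exists>C. \<forall>f\<in>Cc X. fun_support X f \<subseteq> K \<longrightarrow> norm (?\<mu> f) \<le> C * sup_norm f" if K: "compactin X K" for K
  proof -
    obtain C where C: "C \<ge> 0" "\<forall>f B. f \<in> Cc X \<longrightarrow> (\<forall>x. x \<notin> K \<longrightarrow> f x = 0) \<longrightarrow>
        (\<forall>x. norm (f x) \<le> B) \<longrightarrow> norm (m f) \<le> C * B"
      using radon_bound[OF m K] by blast
    have "compact (\<phi> ` K)" using image_compactin[OF K \<phi>] by simp
    then obtain B where B: "\<forall>y\<in>\<phi> ` K. norm y \<le> B" using compact_imp_bounded bounded_iff by blast
    have "norm (?\<mu> f) \<le> C * \<bar>B\<bar> * sup_norm f" if f: "f \<in> Cc X" "fun_support X f \<subseteq> K" for f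
    proof -
      have out: "f x = 0" if "x \<notin> K" for x using Cc_outside_support[OF f(1)] f(2) that by blast
      have "norm (\<phi> x * f x) \<le> \<bar>B\<bar> * sup_norm f" for x
      proof (cases "x \<in> K")
        case True
        then have "norm (\<phi> x) \<le> \<bar>B\<bar>" using B by fastforce
        then show ?thesis using norm_le_sup_norm[OF f(1), of x] by (simp add: norm_mult mult_mono)
      next
        case False
        then show ?thesis using out sup_norm_nonneg[OF f(1)] by simp
      qed
      then have "norm (m (\<lambda>x. \<phi> x * f x)) \<le> C * (\<bar>B\<bar> * sup_norm f)"
        using out by (intro C(2)[rule_format] Cc_mult f \<phi>) auto
      then show ?thesis using f(1) by (simp add: density_measure_def mult.assoc)
    qed
    then show ?thesis by blast
  qed
  moreover have "?\<mu> \<in> extensional (Cc X)" unfolding density_measure_def by (rule restrict_extensional)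
  ultimately show ?thesis unfolding radon_measures_def by blast
qed

lemma measure_support_density_measure:
  assumes m: "m \<in> radon_measures X"
  shows "measure_support X (density_measure X \<phi> m) \<subseteq> fun_support X \<phi>"
proof (rule measure_support_subset[OF closedin_fun_support])
  fix f assume f: "f \<in> Cc X" "\<And>x. x \<in> fun_support X \<phi> \<Longrightarrow> f x = 0"
  have "\<phi> x * f x = 0" for x
    using f fun_support_outside[of x X \<phi>] Cc_outside[OF f(1), of x] by (cases "x \<in> fun_support X \<phi>") auto
  then have "(\<lambda>x. \<phi> x * f x) = (\<lambda>x. 0)" by blast
  then show "density_measure X \<phi> m f = 0"
    using f(1) radon_zero[OF m] by (simp add: density_measure_def)
qed

lemma density_measure_pushable:
  assumes m: "m \<in> radon_measures X" and \<phi>: "continuous_map X euclidean \<phi>" and p: "continuous_map X Y p"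
    and proper: "proper_continuous_map (subtopology X (fun_support X \<phi>)) Y p"
  shows "density_measure X \<phi> m \<in> pushable_measures X Y p"
  unfolding pushable_measures_def
  using density_measure_radon[OF m \<phi>] p
    proper_continuous_map_closed_subset[OF proper closedin_measure_support measure_support_density_measure[OF m]]
  by simp

end

lemma density_measure_cong:
  assumes "\<And>x. x \<in> topspace X \<Longrightarrow> \<phi> x = \<psi> x"
  shows "density_measure X \<phi> m = density_measure X \<psi> m"
proof -
  have "(\<lambda>x. \<phi> x * f x) = (\<lambda>x. \<psi> x * f x)" if "f \<in> Cc X" for f
    using assms Cc_outside[OF that] by (metis mult_zero_right)
  then show ?thesis unfolding density_measure_def by (intro restrict_ext) simp
qed

section \<open>Averages over the cosets of N\<close>

locale normal_closed_subgroup = locally_compact_group G T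
  for G :: "('a, 'b) monoid_scheme" (structure) and T :: "'a topology" +
  fixes N :: "'a set" and \<kappa> :: "('a \<Rightarrow> complex) \<Rightarrow> complex"
  assumes normal: "N \<lhd> G" and closed: "closed_subgroup N G T"
    and \<kappa>: "left_haar_measure (G\<lparr>carrier := N\<rparr>) (subtopology T N) \<kappa>"
begin

abbreviation "Q \<equiv> coset_space G T N"
abbreviation "p \<equiv> coset_proj G N"
abbreviation "TN \<equiv> subtopology T N"

sublocale N: locally_compact_group "G\<lparr>carrier := N\<rparr>" TN
  by (rule locally_compact_group_subgroup[OF closed])

sublocale Q: locally_compact_group "G Mod N" Q
  by (rule locally_compact_group_quotient[OF normal closed])

lemma subgroup_N: "subgroup N G" and closedin_N: "closedin T N"
  using closed by (auto simp: closed_subgroup_def)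

lemma N_carrier: "n \<in> N \<Longrightarrow> n \<in> carrier G"
  by (rule subgroup.mem_carrier[OF subgroup_N])

lemma topspace_TN: "topspace TN = N"
  using N.topspace_eq by simp

lemma p_mult: "g \<in> carrier G \<Longrightarrow> n \<in> N \<Longrightarrow> p (g \<otimes> n) = p g"
  by (rule coset_proj_mult_right[OF subgroup_N])

lemma topspace_Q: "topspace Q = p ` carrier G"
  by (rule topspace_coset_space)

definition fiber :: "('a \<Rightarrow> complex) \<Rightarrow> 'a \<Rightarrow> 'a \<Rightarrow> complex" where
  "fiber f g = (\<lambda>n. if n \<in> N then f (g \<otimes> n) else 0)"

text \<open>The representative is immaterial for proper densities by \<open>average_coset\<close>;
  the value 0 off the space is the convention of \<open>Cc\<close>.\<close>

definition average :: "('a \<Rightarrow> complex) \<Rightarrow> 'a set \<Rightarrow> complex" where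
  "average f C = (if C \<in> topspace Q then \<kappa> (fiber f (SOME g. g \<in> carrier G \<and> p g = C)) else 0)"

text \<open>This class contains both C_c of G, on which the Haar integral is built, and the
  densities to be pushed forward, so averaging is treated once for both.\<close>

definition proper_densities :: "('a \<Rightarrow> complex) set" where
  "proper_densities = {f. continuous_map T euclidean f \<and> (\<forall>x. x \<notin> carrier G \<longrightarrow> f x = 0) \<and>
     proper_continuous_map (subtopology T (fun_support T f)) Q p}"

lemma Cc_proper_density: "f \<in> Cc T \<Longrightarrow> f \<in> proper_densities"
proof -
  assume f: "f \<in> Cc T"
  have "proper_continuous_map (subtopology T (fun_support T f)) Q p"
    unfolding proper_continuous_map_subtopology_iff
  proof (intro conjI allI impI)
    show "continuous_map (subtopology T (fun_support T f)) Q p"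
      by (rule continuous_map_from_subtopology[OF continuous_map_coset_proj])
    fix C assume "compactin Q C"
    then have "closedin T {x \<in> topspace T. p x \<in> C}"
      by (rule closedin_continuous_map_preimage[OF continuous_map_coset_proj Q.closedin_compactin])
    from closed_Int_compactin[OF this Cc_compact_support[OF f]]
    have "compactin T ({x \<in> topspace T. p x \<in> C} \<inter> fun_support T f)" .
    also have "{x \<in> topspace T. p x \<in> C} \<inter> fun_support T f = {x \<in> topspace T. x \<in> fun_support T f \<and> p x \<in> C}"
      by blast
    finally show "compactin T {x \<in> topspace T. x \<in> fun_support T f \<and> p x \<in> C}" .
  qed
  then show ?thesis
    using Cc_continuous[OF f] Cc_outside[OF f] by (simp add: proper_densities_def topspace_eq)
qed

text \<open>A point of G/N is compact, so by properness the support of f meets the coset of g in a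
  compact set; left multiplication by \<open>inv g\<close> carries it into N.\<close>

lemma fiber_Cc:
  assumes f: "f \<in> proper_densities" and g: "g \<in> carrier G"
  shows "fiber f g \<in> Cc TN"
proof -
  have fc: "continuous_map T euclidean f" and
    proper: "\<And>C. compactin Q C \<Longrightarrow> compactin T {x \<in> topspace T. x \<in> fun_support T f \<and> p x \<in> C}"
    using f by (auto simp: proper_densities_def proper_continuous_map_subtopology_iff)
  let ?C = "{x \<in> topspace T. x \<in> fun_support T f \<and> p x \<in> {p g}}"
  let ?L = "(\<lambda>x. inv g \<otimes> x) ` ?C"
  have "compactin Q {p g}" using g by (simp add: topspace_Q)
  then have "compactin T ?C" by (rule proper)
  then have "compactin T ?L" using g by (rule_tac image_compactin[OF _ continuous_map_left_mult]) auto
  moreover have "?L \<subseteq> N"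
    using coset_proj_eq_iff[OF subgroup_N g] by (auto simp: topspace_eq)
  ultimately have L: "compactin TN ?L" by (simp add: compactin_subtopology)
  show ?thesis
  proof (rule N.CcI(1)[OF _ L])
    have "continuous_map TN T (\<lambda>n. g \<otimes> n)"
      by (rule continuous_map_from_subtopology[OF continuous_map_left_mult[OF g]])
    from continuous_map_compose[OF this fc] show "continuous_map TN euclidean (fiber f g)"
      by (rule continuous_map_eq) (simp add: fiber_def)
    fix n assume n: "n \<notin> ?L"
    show "fiber f g n = 0"
    proof (cases "n \<in> N")
      case True
      then have gn: "g \<otimes> n \<in> carrier G" "p (g \<otimes> n) = p g" "n = inv g \<otimes> (g \<otimes> n)"
        using g N_carrier p_mult by (auto simp flip: m_assoc)
      then have "g \<otimes> n \<notin> ?C" using n by blast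
      then have "f (g \<otimes> n) = 0" using gn fun_support_outside[of "g \<otimes> n" T f] by (simp add: topspace_eq)
      then show ?thesis by (simp add: fiber_def)
    qed (simp add: fiber_def)
  qed
qed

text \<open>Two representatives of a coset differ by an element of N on the right, which becomes a
  left translation of the function on N; \<kappa> is invariant under it.\<close>

lemma average_coset:
  assumes f: "f \<in> proper_densities" and g: "g \<in> carrier G"
  shows "average f (p g) = \<kappa> (fiber f g)"
proof -
  define h where "h = (SOME h. h \<in> carrier G \<and> p h = p g)"
  have h: "h \<in> carrier G" "p h = p g"
    using someI[of "\<lambda>h. h \<in> carrier G \<and> p h = p g" g] g by (auto simp: h_def)
  define n where "n = inv g \<otimes> h"
  have n: "n \<in> N" using coset_proj_eq_iff[OF subgroup_N g h(1)] h(2) by (simp add: n_def)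
  have "h = g \<otimes> n" using g h by (simp add: n_def flip: m_assoc)
  then have "fiber f h = N.translate n (fiber f g)"
    using n g N_carrier subgroup.m_closed[OF subgroup_N]
    by (auto simp: fiber_def N.translate_def m_assoc)
  then have "\<kappa> (fiber f h) = \<kappa> (fiber f g)"
    using N.haar_translate[OF \<kappa> _ fiber_Cc[OF f g], of n] n by simp
  then show ?thesis using g by (simp add: average_def topspace_Q h_def)
qed

lemma average_outside: "C \<notin> topspace Q \<Longrightarrow> average f C = 0"
  by (simp add: average_def)

text \<open>The product vanishes off the points of supp f over the compact support of u. Together
  with \<open>average_mult\<close> this reduces questions about proper densities to C_c.\<close>

lemma proper_density_mult:
  assumes f: "f \<in> proper_densities" and u: "u \<in> Cc Q"
  shows "(\<lambda>x. u (p x) * f x) \<in> Cc T"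
proof (rule CcI(1))
  have fc: "continuous_map T euclidean f" and f0: "\<And>x. x \<notin> carrier G \<Longrightarrow> f x = 0" and
    proper: "\<And>C. compactin Q C \<Longrightarrow> compactin T {x \<in> topspace T. x \<in> fun_support T f \<and> p x \<in> C}"
    using f by (auto simp: proper_densities_def proper_continuous_map_subtopology_iff)
  show "compactin T {x \<in> topspace T. x \<in> fun_support T f \<and> p x \<in> fun_support Q u}"
    by (rule proper[OF Cc_compact_support[OF u]])
  show "continuous_map T euclidean (\<lambda>x. u (p x) * f x)"
    using continuous_map_compose[OF continuous_map_coset_proj Cc_continuous[OF u]] fc
    by (intro continuous_map_mult) (simp_all add: o_def)
  fix x assume "x \<notin> {x \<in> topspace T. x \<in> fun_support T f \<and> p x \<in> fun_support Q u}"
  then show "u (p x) * f x = 0"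
    using f0[of x] fun_support_outside[of x T f] Cc_outside_support[OF u, of "p x"] by (auto simp: topspace_eq)
qed

lemma average_mult:
  assumes f: "f \<in> proper_densities" and u: "u \<in> Cc Q"
  shows "average (\<lambda>x. u (p x) * f x) = (\<lambda>C. u C * average f C)"
proof
  fix C
  show "average (\<lambda>x. u (p x) * f x) C = u C * average f C"
  proof (cases "C \<in> topspace Q")
    case True
    then obtain g where g: "g \<in> carrier G" "C = p g" by (auto simp: topspace_Q)
    have "fiber (\<lambda>x. u (p x) * f x) g = (\<lambda>n. u (p g) * fiber f g n)"
      using g p_mult by (auto simp: fiber_def)
    then show ?thesis
      using average_coset[OF f g(1)] average_coset[OF Cc_proper_density[OF proper_density_mult[OF f u]] g(1)]
        radon_scale[OF N.haar_radon[OF \<kappa>] fiber_Cc[OF f g(1)]] g by simp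
  qed (simp add: average_outside)
qed

lemma continuous_average_Cc:
  assumes f: "f \<in> Cc T"
  shows "continuous_map Q euclidean (average f)"
proof (rule continuous_compose_quotient_map[OF quotient_map_coset_proj])
  have "continuous_map T euclidean (\<lambda>g. \<kappa> (fiber f g))"
  proof (rule continuous_map_if_Cc_mult)
    fix u assume u: "u \<in> Cc T"
    \<comment> \<open>If \<open>g \<otimes> n\<close> lies in supp f and g in supp u, then n lies in
      this compact set. The factor u is there to make it independent of g.\<close>
    let ?M = "(\<lambda>z. inv (fst z) \<otimes> snd z) ` (fun_support T u \<times> fun_support T f)"
    have "continuous_map (prod_topology T T) T (\<lambda>z. inv (fst z) \<otimes> snd z)"
      by (intro continuous_map_group_mult continuous_map_group_inv continuous_map_fst continuous_map_snd)
    then have "compactin T ?M"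
      by (rule image_compactin[rotated]) (simp add: compactin_Times Cc_compact_support u f)
    from closed_Int_compactin[OF closedin_N this]
    have L: "compactin TN (N \<inter> ?M)" by (simp add: compactin_subtopology)
    let ?F = "\<lambda>g n. u g * fiber f g n"
    have "continuous_map T euclidean (\<lambda>g. \<kappa> (?F g))"
    proof (rule N.radon_parametric_continuous[OF N.haar_radon[OF \<kappa>] _ L])
      have fst': "continuous_map (prod_topology T TN) T fst" by (rule continuous_map_fst)
      have "continuous_map (prod_topology T TN) TN snd" by (rule continuous_map_snd)
      then have snd': "continuous_map (prod_topology T TN) T snd"
        by (rule continuous_map_into_fulltopology)
      have "continuous_map (prod_topology T TN) euclidean (\<lambda>z. u (fst z) * f (fst z \<otimes> snd z))"
        using continuous_map_compose[OF fst' Cc_continuous[OF u]]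
          continuous_map_compose[OF continuous_map_group_mult[OF fst' snd'] Cc_continuous[OF f]]
        by (intro continuous_map_mult) (simp_all add: o_def)
      then show "continuous_map (prod_topology T TN) euclidean (\<lambda>z. ?F (fst z) (snd z))"
        by (rule continuous_map_eq) (auto simp: fiber_def topspace_TN)
      fix g n assume g: "g \<in> topspace T" and n: "n \<notin> N \<inter> ?M"
      show "?F g n = 0"
      proof (cases "n \<in> N \<and> g \<in> fun_support T u")
        case True
        then have nc: "n = inv g \<otimes> (g \<otimes> n)" using g N_carrier by (simp add: topspace_eq flip: m_assoc)
        have "g \<otimes> n \<notin> fun_support T f"
        proof
          assume "g \<otimes> n \<in> fun_support T f"
          then have "n \<in> ?M" using nc True by (intro image_eqI[of _ _ "(g, g \<otimes> n)"]) auto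
          then show False using n True by blast
        qed
        then show ?thesis using Cc_outside_support[OF f] by (simp add: fiber_def)
      qed (auto simp: fiber_def Cc_outside_support[OF u])
    qed
    then show "continuous_map T euclidean (\<lambda>g. u g * \<kappa> (fiber f g))"
      by (rule continuous_map_eq)
        (simp add: radon_scale[OF N.haar_radon[OF \<kappa>] fiber_Cc[OF Cc_proper_density[OF f]]] topspace_eq)
  qed
  then show "continuous_map T euclidean (average f \<circ> p)"
    by (rule continuous_map_eq) (simp add: average_coset[OF Cc_proper_density[OF f]] topspace_eq)
qed

lemma continuous_average:
  assumes f: "f \<in> proper_densities"
  shows "continuous_map Q euclidean (average f)"
proof (rule Q.continuous_map_if_Cc_mult)
  fix u assume u: "u \<in> Cc Q"
  from continuous_average_Cc[OF proper_density_mult[OF f u]]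
  show "continuous_map Q euclidean (\<lambda>C. u C * average f C)" unfolding average_mult[OF f u] .
qed

lemma average_support:
  assumes f: "f \<in> proper_densities" and C: "C \<notin> p ` fun_support T f"
  shows "average f C = 0"
proof (cases "C \<in> topspace Q")
  case True
  then obtain g where g: "g \<in> carrier G" "C = p g" by (auto simp: topspace_Q)
  have "f (g \<otimes> n) = 0" if n: "n \<in> N" for n
  proof -
    have "p (g \<otimes> n) = C" using g p_mult n by simp
    then have "g \<otimes> n \<notin> fun_support T f" using C by blast
    then show ?thesis using fun_support_outside[of "g \<otimes> n" T f] g N_carrier[OF n] by (simp add: topspace_eq)
  qed
  then have "fiber f g = (\<lambda>n. 0)" by (auto simp: fiber_def)
  then show ?thesis using average_coset[OF f g(1)] g N.radon_zero[OF N.haar_radon[OF \<kappa>]] by simp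
qed (rule average_outside)

lemma average_Cc: assumes f: "f \<in> Cc T" shows "average f \<in> Cc Q"
  by (rule Q.CcI(1)[OF continuous_average_Cc[OF f]
        image_compactin[OF Cc_compact_support[OF f] continuous_map_coset_proj[of N]]])
    (rule average_support[OF Cc_proper_density[OF f]])

text \<open>Averaging intertwines translation by g on G with translation by \<open>p g\<close> on
  G/N, so invariance of J gives invariance of the iterated integral. It is nonzero because a bump at
  \<open>\<one>\<close> has a nonzero average, by \<open>haar_pos\<close> on N, hence a nonzero
  integral, by \<open>haar_pos\<close> on G/N.\<close>

lemma iterated_haar:
  assumes J: "left_haar_measure (G Mod N) Q J"
  shows "left_haar_measure G T (\<lambda>f\<in>Cc T. J (average f))"
proof -
  note J' = Q.haar_radon[OF J] and K' = N.haar_radon[OF \<kappa>]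
  define W where "W = (\<lambda>f\<in>Cc T. J (average f))"
  have ext: "W \<in> extensional (Cc T)" unfolding W_def by (rule restrict_extensional)
  have coset: "average f (p g) = \<kappa> (fiber f g)" if "f \<in> Cc T" "g \<in> carrier G" for f g
    by (rule average_coset[OF Cc_proper_density[OF that(1)] that(2)])
  have fib: "fiber f g \<in> Cc TN" if "f \<in> Cc T" "g \<in> carrier G" for f g
    by (rule fiber_Cc[OF Cc_proper_density[OF that(1)] that(2)])
  have ptwise: "a = b" if "\<And>g. g \<in> carrier G \<Longrightarrow> a (p g) = b (p g)" "\<And>C. C \<notin> topspace Q \<Longrightarrow> a C = b C"
    for a b :: "'a set \<Rightarrow> complex"
  proof
    fix C show "a C = b C"
      using that by (cases "C \<in> topspace Q") (auto simp: topspace_Q)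
  qed
  have W_add: "W (\<lambda>x. f x + g x) = W f + W g" if f: "f \<in> Cc T" and g: "g \<in> Cc T" for f g
  proof -
    have "average (\<lambda>x. f x + g x) = (\<lambda>C. average f C + average g C)"
    proof (rule ptwise)
      fix x assume x: "x \<in> carrier G"
      have "fiber (\<lambda>x. f x + g x) x = (\<lambda>n. fiber f x n + fiber g x n)" by (auto simp: fiber_def)
      then show "average (\<lambda>x. f x + g x) (p x) = average f (p x) + average g (p x)"
        using coset x f g Cc_add[OF f g] radon_add[OF K' fib[OF f x] fib[OF g x]] by simp
    qed (simp add: average_outside)
    then show ?thesis
      using radon_add[OF J' average_Cc[OF f] average_Cc[OF g]] f g Cc_add[OF f g] by (simp add: W_def)
  qed
  have W_scale: "W (\<lambda>x. c * f x) = c * W f" if f: "f \<in> Cc T" for c f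
  proof -
    have "average (\<lambda>x. c * f x) = (\<lambda>C. c * average f C)"
    proof (rule ptwise)
      fix x assume x: "x \<in> carrier G"
      have "fiber (\<lambda>x. c * f x) x = (\<lambda>n. c * fiber f x n)" by (auto simp: fiber_def)
      then show "average (\<lambda>x. c * f x) (p x) = c * average f (p x)"
        using coset x f Cc_scale[OF f] radon_scale[OF K' fib[OF f x]] by simp
    qed (simp add: average_outside)
    then show ?thesis
      using radon_scale[OF J' average_Cc[OF f]] f Cc_scale[OF f] by (simp add: W_def)
  qed
  have avg_pos: "average f C \<in> \<real>\<^sub>\<ge>\<^sub>0" if f: "f \<in> Cc T" "\<And>x. f x \<in> \<real>\<^sub>\<ge>\<^sub>0" for f C
  proof (cases "C \<in> topspace Q")
    case True
    then obtain g where g: "g \<in> carrier G" "C = p g" by (auto simp: topspace_Q)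
    have "\<kappa> (fiber f g) \<in> \<real>\<^sub>\<ge>\<^sub>0"
      by (rule N.haar_nonneg[OF \<kappa> fib[OF f(1) g(1)]]) (simp add: fiber_def f(2))
    then show ?thesis using coset[OF f(1) g(1)] g by simp
  qed (simp add: average_outside)
  have W_pos: "W f \<in> \<real>\<^sub>\<ge>\<^sub>0" if f: "f \<in> Cc T" "\<And>x. f x \<in> \<real>\<^sub>\<ge>\<^sub>0" for f
    using Q.haar_nonneg[OF J average_Cc[OF f(1)] avg_pos[OF f]] f(1) by (simp add: W_def)
  have "W \<in> radon_measures T"
    by (rule positive_form_radon[OF ext W_add W_scale W_pos])
  moreover have "\<exists>f\<in>Cc T. W f \<noteq> 0"
  proof -
    have "\<one> \<in> topspace T" by (simp add: topspace_eq)
    then obtain f where f: "f \<in> Cc T" "\<forall>x. f x \<in> \<real>\<^sub>\<ge>\<^sub>0" "f \<one> = 1" using nonneg_bump by blast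
    have "\<kappa> (fiber f \<one>) \<noteq> 0"
      by (rule N.haar_pos[OF \<kappa> fib[OF f(1)], of _ \<one>])
        (use f subgroup.one_closed[OF subgroup_N] in \<open>auto simp: fiber_def\<close>)
    then have "average f (p \<one>) \<noteq> 0" using coset[OF f(1), of \<one>] by simp
    then have "J (average f) \<noteq> 0"
      by (rule Q.haar_pos[OF J average_Cc[OF f(1)] avg_pos[OF f(1)], rotated -1])
        (use f(2) Q.topspace_eq topspace_Q in auto)
    then show ?thesis using f(1) by (intro bexI[of _ f]) (simp_all add: W_def)
  qed
  moreover have "W (translate g f) = W f" if g: "g \<in> carrier G" and f: "f \<in> Cc T" for g f
  proof -
    have pg: "p g \<in> carrier (G Mod N)" using g carrier_Mod_normal[OF normal] by blast
    have "average (translate g f) = Q.translate (p g) (average f)"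
    proof (rule ptwise)
      fix x assume x: "x \<in> carrier G"
      then have px: "p x \<in> carrier (G Mod N)" using carrier_Mod_normal[OF normal] by blast
      have "fiber (translate g f) x = fiber f (g \<otimes> x)"
        using g x N_carrier by (auto simp: fiber_def translate_def m_assoc)
      then have "average (translate g f) (p x) = average f (p (g \<otimes> x))"
        using coset translate_Cc[OF f g] f x g by simp
      then show "average (translate g f) (p x) = Q.translate (p g) (average f) (p x)"
        using px coset_proj_normal_mult[OF normal g x] by (simp add: Q.translate_def)
    qed (simp add: average_outside Q.translate_def Q.topspace_eq)
    then show ?thesis
      using Q.haar_translate[OF J pg average_Cc[OF f]] f translate_Cc[OF f g] by (simp add: W_def)
  qed
  ultimately have "left_haar_measure G T W"
    unfolding left_haar_measure_def using W_pos by (auto simp: translate_def)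
  then show ?thesis unfolding W_def .
qed

text \<open>For a lift v of u, the product of f and v is \<open>(u \<circ> p) f\<close>, which is in
  C_c. Integrating over cosets first pulls u out and leaves the average of f. The factor c compares
  m with the iterated Haar measure.\<close>

lemma pushforward_density:
  assumes m: "left_haar_measure G T m" and J: "left_haar_measure (G Mod N) Q J" and f: "f \<in> proper_densities"
  shows "\<exists>c. pushforward T Q p (density_measure T f m) = density_measure Q (\<lambda>C. c * average f C) J"
proof -
  note m' = haar_radon[OF m]
  have fc: "continuous_map T euclidean f" and f0: "\<And>x. x \<notin> carrier G \<Longrightarrow> f x = 0"
    and proper: "proper_continuous_map (subtopology T (fun_support T f)) Q p"
    using f by (auto simp: proper_densities_def)
  have push: "density_measure T f m \<in> pushable_measures T Q p"
    by (rule density_measure_pushable[OF m' fc continuous_map_coset_proj proper])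
  interpret P: proper_pushforward T Q p "density_measure T f m"
    by unfold_locales (rule push)
  obtain c where c: "\<forall>h\<in>Cc T. m h = c * (\<lambda>f\<in>Cc T. J (average f)) h"
    using haar_unique[OF m iterated_haar[OF J]] by blast
  have "pushforward T Q p (density_measure T f m) u = density_measure Q (\<lambda>C. c * average f C) J u" for u
  proof (cases "u \<in> Cc Q")
    case u: True
    have "\<forall>C. C \<notin> fun_support Q u \<longrightarrow> u C = 0" using Cc_outside_support[OF u] by blast
    then obtain v where v: "v \<in> Cc T" "\<forall>x\<in>topspace T \<inter> fun_support T f. v x = u (p x)"
      using proper_lift_cutoff[OF continuous_map_coset_proj proper Cc_compact_support[OF u] Q.Haus] u by blast
    have "pushforward T Q p (density_measure T f m) u = density_measure T f m v"
      using measure_support_density_measure[OF m', of f] measure_support_subset_topspace[of T] v(2)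
      by (intro P.pushforward_eq u v(1)) blast
    also have "\<dots> = m (\<lambda>x. u (p x) * f x)"
    proof -
      have "f x * v x = u (p x) * f x" for x
        using v(2) f0[of x] fun_support_outside[of x T f] by (cases "x \<in> topspace T \<inter> fun_support T f") (auto simp: topspace_eq)
      then have "(\<lambda>x. f x * v x) = (\<lambda>x. u (p x) * f x)" by blast
      then show ?thesis using v(1) by (simp add: density_measure_def)
    qed
    also have "\<dots> = c * J (average (\<lambda>x. u (p x) * f x))"
      using c proper_density_mult[OF f u] by simp
    also have "\<dots> = c * J (\<lambda>C. average f C * u C)" by (simp only: average_mult[OF f u]) (simp add: mult.commute)
    also have "\<dots> = J (\<lambda>C. c * (average f C * u C))"
      by (rule radon_scale[OF Q.haar_radon[OF J] Q.Cc_mult[OF u continuous_average[OF f]], symmetric])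
    finally show ?thesis using u by (simp add: density_measure_def mult.assoc)
  qed (simp_all add: pushforward_def density_measure_def)
  then show ?thesis by blast
qed

end

section \<open>Part (4): the pushed-forward measure has a properly supported density\<close>

context locally_compact_group begin

lemma pushforward_M_space:
  assumes N: "N \<lhd> G" "closed_subgroup N G T" and H: "closed_subgroup H G T" and NH: "N \<subseteq> H"
    and m: "left_haar_measure G T m" and \<phi>: "continuous_map T euclidean \<phi>"
    and proper: "proper_continuous_map (subtopology T (fun_support T \<phi>)) (coset_space G T H) (coset_proj G H)"
  shows "pushforward T (coset_space G T N) (coset_proj G N) (density_measure T \<phi> m) \<in>
    M_space (G Mod N) (coset_space G T N) (quotient_subgroup G N H)"
proof -
  have sub: "subgroup N G" "subgroup H G" using N H by (auto simp: closed_subgroup_def)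
  obtain \<kappa> where "left_haar_measure (G\<lparr>carrier := N\<rparr>) (subtopology T N) \<kappa>"
    using locally_compact_group.haar_exists[OF locally_compact_group_subgroup[OF N(2)]] by blast
  then interpret normal_closed_subgroup G T N \<kappa>
    using N by (intro normal_closed_subgroup.intro normal_closed_subgroup_axioms.intro locally_compact_group_axioms)
  obtain J where J: "left_haar_measure (G Mod N) Q J" using Q.haar_exists by blast
  let ?HN = "quotient_subgroup G N H"
  let ?Z = "coset_space (G Mod N) Q ?HN" and ?q = "coset_proj (G Mod N) ?HN"
  have q: "continuous_map Q ?Z ?q" by (rule Q.continuous_map_coset_proj)
  \<comment> \<open>\<open>M_space\<close> leaves the density arbitrary off the carrier, whereas
    \<open>proper_densities\<close> asks for 0 there; the measure and the support stay the
    same.\<close>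
  define f where "f = (\<lambda>x. if x \<in> carrier G then \<phi> x else 0)"
  have supp: "fun_support T f = fun_support T \<phi>"
  proof -
    have "{x \<in> topspace T. f x \<noteq> 0} = {x \<in> topspace T. \<phi> x \<noteq> 0}" by (auto simp: f_def topspace_eq)
    then show ?thesis by (simp add: fun_support_def)
  qed
  have "proper_continuous_map (subtopology T (fun_support T f)) ?Z (quotient_coset_map G N \<circ> coset_proj G H)"
    unfolding supp by (rule proper_continuous_map_compose_homeomorphic[OF proper
          homeomorphic_maps_quotient_coset_map[OF N(1) sub(2) NH]])
  also have "proper_continuous_map (subtopology T (fun_support T f)) ?Z (quotient_coset_map G N \<circ> coset_proj G H) \<longleftrightarrow>
      proper_continuous_map (subtopology T (fun_support T f)) ?Z (?q \<circ> p)"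
    by (rule proper_continuous_map_cong)
      (use quotient_coset_map_coset_proj[OF N(1) sub(2)] in \<open>simp add: topspace_eq\<close>)
  finally have "proper_continuous_map (subtopology T (fun_support T f)) ?Z (?q \<circ> p)" .
  note propers = proper_continuous_map_compose_left[OF Q.Haus continuous_map_coset_proj q closedin_fun_support this]
  have f: "f \<in> proper_densities"
    unfolding proper_densities_def
    using propers(1) continuous_map_eq[OF \<phi>, of f] by (auto simp: f_def topspace_eq)
  obtain c where c: "pushforward T Q p (density_measure T f m) = density_measure Q (\<lambda>C. c * average f C) J"
    using pushforward_density[OF m J f] by blast
  let ?\<psi> = "\<lambda>C. c * average f C"
  have \<psi>: "continuous_map Q euclidean ?\<psi>"
    by (intro continuous_map_mult continuous_average[OF f]) simp
  have "closedin Q (p ` fun_support T f)"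
    by (rule proper_continuous_map_closed_image[OF Q.locally_compact_Hausdorff_axioms propers(1)
          closedin_subset[OF closedin_fun_support]])
  then have "fun_support Q ?\<psi> \<subseteq> p ` fun_support T f"
    by (rule fun_support_subset) (simp add: average_support[OF f])
  then have \<psi>_proper: "proper_continuous_map (subtopology Q (fun_support Q ?\<psi>)) ?Z ?q"
    by (rule proper_continuous_map_closed_subset[OF propers(2) closedin_fun_support])
  have "density_measure T \<phi> m = density_measure T f m"
    by (rule density_measure_cong) (simp add: f_def topspace_eq)
  then show ?thesis
    unfolding M_space_def mem_Collect_eq using c J \<psi> \<psi>_proper
    by (intro exI[of _ ?\<psi>] exI[of _ J]) simp
qed

end

lemma pushable_measures_cong:
  assumes "\<And>x. x \<in> topspace X \<Longrightarrow> p x = q x"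
  shows "pushable_measures X Y p = pushable_measures X Y q"
proof -
  have "continuous_map X Y p \<longleftrightarrow> continuous_map X Y q"
    using continuous_map_eq[of X Y p q] continuous_map_eq[of X Y q p] assms by auto
  moreover have "proper_continuous_map (subtopology X S) Y p \<longleftrightarrow> proper_continuous_map (subtopology X S) Y q" for S
    by (rule proper_continuous_map_cong) (simp add: assms)
  ultimately show ?thesis by (simp add: pushable_measures_def)
qed

text \<open>Composites of canonical maps agree only at points of the space, so they are exchanged by
  congruence rather than by equality of functions.\<close>

lemma pushforward_cong:
  assumes "\<And>x. x \<in> topspace X \<Longrightarrow> p x = q x"
  shows "pushforward X Y p \<mu> = pushforward X Y q \<mu>"
proof -
  have "(\<forall>x\<in>measure_support X \<mu>. \<beta> x = \<alpha> (p x)) \<longleftrightarrow> (\<forall>x\<in>measure_support X \<mu>. \<beta> x = \<alpha> (q x))"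
    for \<alpha> \<beta> :: "_ \<Rightarrow> complex"
    using assms measure_support_subset_topspace[of X \<mu>] by (metis subsetD)
  then show ?thesis by (simp add: pushforward_def)
qed

theorem theorem1p3:
  fixes G :: "('a, 'b) monoid_scheme" and T :: "'a topology" and H N :: "'a set"
  assumes "locally_compact_group G T"
    and "closed_subgroup H G T"
    and "closed_subgroup N G T"
    and "N \<subseteq> H"
  defines "GN \<equiv> coset_space G T N"
    and "GH \<equiv> coset_space G T H"
    and "HN \<equiv> quotient_subgroup G N H"
    and "GNHN \<equiv> coset_space (G Mod N) (coset_space G T N) (quotient_subgroup G N H)"
    and "p_G_GN \<equiv> coset_proj G N"
    and "p_G_GH \<equiv> coset_proj G H"
    and "p_GN_GH \<equiv> coset_map G H"
    and "p_GH_GNHN \<equiv> quotient_coset_map G N"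
    and "p_GN_GNHN \<equiv> coset_proj (G Mod N) (quotient_subgroup G N H)"
  shows
    "M_space G T H \<subseteq> M_space G T N \<and>
     (\<forall>\<mu> \<in> M_space G T H.
        \<mu> \<in> pushable_measures T GH (p_GN_GH \<circ> p_G_GN) \<and>
        \<mu> \<in> pushable_measures T GN p_G_GN \<and>
        pushforward T GN p_G_GN \<mu> \<in> pushable_measures GN GH p_GN_GH \<and>
        pushforward T GH (p_GN_GH \<circ> p_G_GN) \<mu> =
          pushforward GN GH p_GN_GH (pushforward T GN p_G_GN \<mu>)) \<and>
     (N \<lhd> G \<longrightarrow>
        locally_compact_group (G Mod N) GN \<and> closed_subgroup HN (G Mod N) GN \<and>
        (\<forall>\<mu> \<in> M_space G T H.
           \<mu> \<in> pushable_measures T GH p_G_GH \<and>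
           pushforward T GH p_G_GH \<mu> \<in> pushable_measures GH GNHN p_GH_GNHN \<and>
           \<mu> \<in> pushable_measures T GN p_G_GN \<and>
           pushforward T GN p_G_GN \<mu> \<in> pushable_measures GN GNHN p_GN_GNHN \<and>
           pushforward GH GNHN p_GH_GNHN (pushforward T GH p_G_GH \<mu>) =
             pushforward GN GNHN p_GN_GNHN (pushforward T GN p_G_GN \<mu>))) \<and>
     (N \<lhd> G \<longrightarrow>
        (\<forall>\<mu> \<in> M_space G T H. pushforward T GN p_G_GN \<mu> \<in> M_space (G Mod N) GN HN))"
proof -
  interpret locally_compact_group G T by fact
  note H = assms(2) and N = assms(3) and NH = assms(4)
  have subH: "subgroup H G" and subN: "subgroup N G" using H N by (auto simp: closed_subgroup_def)
  have lcT: "locally_compact_Hausdorff T" by (rule locally_compact_Hausdorff_axioms)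
  have lcGN: "locally_compact_Hausdorff GN" and lcGH: "locally_compact_Hausdorff GH"
    unfolding GN_def GH_def by (intro locally_compact_Hausdorff_coset_space N H)+
  have cGN: "continuous_map T GN p_G_GN" and cGH: "continuous_map T GH p_G_GH"
    unfolding GN_def GH_def p_G_GN_def p_G_GH_def by (rule continuous_map_coset_proj)+
  have cGNGH: "continuous_map GN GH p_GN_GH"
    unfolding GN_def GH_def p_GN_GH_def by (rule continuous_map_coset_map[OF subN subH NH])
  have comp: "(p_GN_GH \<circ> p_G_GN) x = p_G_GH x" if "x \<in> topspace T" for x
    using that coset_map_coset_proj[OF subN subH NH, of x]
    by (simp add: p_GN_GH_def p_G_GN_def p_G_GH_def topspace_eq)
  have pushH: "\<mu> \<in> pushable_measures T GH p_G_GH" if "\<mu> \<in> M_space G T H" for \<mu>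
    using that cGH density_measure_pushable[OF haar_radon] unfolding M_space_def GH_def p_G_GH_def by blast
  have part1: "M_space G T H \<subseteq> M_space G T N"
  proof
    fix \<mu> assume "\<mu> \<in> M_space G T H"
    then obtain \<phi> m where m: "\<mu> = density_measure T \<phi> m" "left_haar_measure G T m" "continuous_map T euclidean \<phi>"
      and proper: "proper_continuous_map (subtopology T (fun_support T \<phi>)) GH p_G_GH"
      unfolding M_space_def GH_def p_G_GH_def by blast
    \<comment> \<open>Written as a composite through G/N, properness over G/H yields properness over
      G/N.\<close>
    have "proper_continuous_map (subtopology T (fun_support T \<phi>)) GH (p_GN_GH \<circ> p_G_GN)"
      using proper proper_continuous_map_cong[of "subtopology T (fun_support T \<phi>)" "p_GN_GH \<circ> p_G_GN" p_G_GH] comp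
      by simp
    from proper_continuous_map_compose_left(1)[OF locally_compact_Hausdorff.Haus[OF lcGN] cGN cGNGH closedin_fun_support this]
    show "\<mu> \<in> M_space G T N"
      using m unfolding M_space_def GN_def p_G_GN_def by blast
  qed
  show ?thesis
  proof (intro conjI ballI impI)
    show "M_space G T H \<subseteq> M_space G T N" by (rule part1)
  next
    fix \<mu> assume \<mu>: "\<mu> \<in> M_space G T H"
    show push: "\<mu> \<in> pushable_measures T GH (p_GN_GH \<circ> p_G_GN)"
      using pushH[OF \<mu>] pushable_measures_cong[of T "p_GN_GH \<circ> p_G_GN" p_G_GH GH] comp by simp
    note compose = pushforward_compose[OF lcT lcGN lcGH cGN cGNGH push]
    show "\<mu> \<in> pushable_measures T GN p_G_GN"
      "pushforward T GN p_G_GN \<mu> \<in> pushable_measures GN GH p_GN_GH"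
      "pushforward T GH (p_GN_GH \<circ> p_G_GN) \<mu> = pushforward GN GH p_GN_GH (pushforward T GN p_G_GN \<mu>)"
      by (rule compose)+
  next
    assume normal: "N \<lhd> G"
    show lcgQ: "locally_compact_group (G Mod N) GN"
      unfolding GN_def by (rule locally_compact_group_quotient[OF normal N])
    show closedHN: "closed_subgroup HN (G Mod N) GN"
      unfolding HN_def GN_def by (rule closed_subgroup_quotient[OF normal H NH])
    interpret Q: locally_compact_group "G Mod N" GN by (rule lcgQ)
    have lcZ: "locally_compact_Hausdorff GNHN"
      using Q.locally_compact_Hausdorff_coset_space[OF closedHN] by (simp add: GNHN_def HN_def GN_def)
    have cGNZ: "continuous_map GN GNHN p_GN_GNHN"
      using Q.continuous_map_coset_proj[of HN] by (simp add: GNHN_def HN_def GN_def p_GN_GNHN_def)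
    have homeo: "homeomorphic_maps GH GNHN p_GH_GNHN Union"
      unfolding GH_def GNHN_def p_GH_GNHN_def by (rule homeomorphic_maps_quotient_coset_map[OF normal subH NH])
    then have cGHZ: "continuous_map GH GNHN p_GH_GNHN" by (simp add: homeomorphic_maps_def)
    have eq: "(p_GH_GNHN \<circ> p_G_GH) x = (p_GN_GNHN \<circ> p_G_GN) x" if "x \<in> topspace T" for x
      using that quotient_coset_map_coset_proj[OF normal subH, of x]
      by (simp add: p_GH_GNHN_def p_G_GH_def p_GN_GNHN_def p_G_GN_def topspace_eq)
    fix \<mu> assume \<mu>: "\<mu> \<in> M_space G T H"
    note pushH = pushH[OF \<mu>]
    \<comment> \<open>Both sides of (3) will be the pushforward along one map from G to the iterated
      quotient, factored through G/H and through G/N. Here its properness comes from G/H by the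
      homeomorphism.\<close>
    have viaH: "\<mu> \<in> pushable_measures T GNHN (p_GH_GNHN \<circ> p_G_GH)"
      using pushable_measuresD(1,2)[OF pushH] continuous_map_compose[OF cGH cGHZ]
        proper_continuous_map_compose_homeomorphic[OF pushable_measuresD(3)[OF pushH] homeo]
      by (simp add: pushable_measures_def)
    then have viaN: "\<mu> \<in> pushable_measures T GNHN (p_GN_GNHN \<circ> p_G_GN)"
      using pushable_measures_cong[of T "p_GH_GNHN \<circ> p_G_GH" "p_GN_GNHN \<circ> p_G_GN" GNHN] eq by simp
    note composeH = pushforward_compose[OF lcT lcGH lcZ cGH cGHZ viaH]
      and composeN = pushforward_compose[OF lcT lcGN lcZ cGN cGNZ viaN]
    show "\<mu> \<in> pushable_measures T GH p_G_GH" "\<mu> \<in> pushable_measures T GN p_G_GN"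
      by (rule composeH(1), rule composeN(1))
    show "pushforward T GH p_G_GH \<mu> \<in> pushable_measures GH GNHN p_GH_GNHN"
      "pushforward T GN p_G_GN \<mu> \<in> pushable_measures GN GNHN p_GN_GNHN"
      by (rule composeH(2), rule composeN(2))
    show "pushforward GH GNHN p_GH_GNHN (pushforward T GH p_G_GH \<mu>) =
        pushforward GN GNHN p_GN_GNHN (pushforward T GN p_G_GN \<mu>)"
      using composeH(3) composeN(3) pushforward_cong[of T "p_GH_GNHN \<circ> p_G_GH" "p_GN_GNHN \<circ> p_G_GN" GNHN \<mu>] eq
      by simp
  next
    fix \<mu> assume "N \<lhd> G" "\<mu> \<in> M_space G T H"
    then show "pushforward T GN p_G_GN \<mu> \<in> M_space (G Mod N) GN HN"
      using pushforward_M_space[OF _ N H NH]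
      unfolding M_space_def[of G T H] GN_def HN_def p_G_GN_def by blast
  qed
qed

end
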